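(* There is a $\mathbb Q(v)$-algebra isomorphism $\Phi:{}^{\mathrm{Dr}}\widetilde{\mathbf U}^{\imath}\rightarrow \widetilde{\mathbf U}^{\imath}$ which sends $$B_{1,r}\mapsto B_{1,r},\quad \Theta_m\mapsto \Theta_m,\quad \mathbb K_1\mapsto \mathbb K_1,\quad C\mapsto \mathbb K_\delta,\qquad m\ge 1,\ r\in\mathbb Z.$$ The inverse $\Phi^{-1}:\widetilde{\mathbf U}^{\imath}\rightarrow {}^{\mathrm{Dr}}\widetilde{\mathbf U}^{\imath}$ sends $\mathbb K_1\mapsto \mathbb K_1$, $\mathbb K_0\mapsto C\mathbb K_1^{-1}$, $B_1\mapsto B_{1,0}$, $B_0\mapsto B_{1,-1}C\mathbb K_1^{-1}$.
   Context: Let $v$ be an indeterminate; algebras are unital associative over $\mathbb Q(v)$. Put $[n]=\frac{v^n-v^{-n}}{v-v^{-1}}$, $\begin{bmatrix} n\\ r\end{bmatrix}=\frac{[n][n-1]\cdots[n-r+1]}{[r]!}$, $[A,B]_{v^a}=AB-v^aBA$, $[A,B]=AB-BA$. The universal $q$-Onsager algebra $\widetilde{\mathbf U}^{\imath}=\widetilde{\mathbf U}^{\imath}(\widehat{\mathfrak{sl}}_2)$ is the $\mathbb Q(v)$-algebra generated by $B_0,B_1,\mathbb K_0^{\pm1},\mathbb K_1^{\pm1}$, where $\mathbb K_0,\mathbb K_1$ are central and invertible, subject to, for $\{i,j\}=\{0,1\}$, $$\sum_{r=0}^3(-1)^r\begin{bmatrix}3\\ r\end{bmatrix}B_i^{3-r}B_jB_i^{r}=-v^{-1}[2]^2(B_iB_j-B_jB_i)\mathbb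 K_i .$$ Put $\mathbb K_\delta=\mathbb K_0\mathbb K_1$ and $\mathbb K_{a\delta}=\mathbb K_\delta^a$. Let $\dagger$ be the involution of $\widetilde{\mathbf U}^{\imath}$ with $B_0\leftrightarrow B_1$, $\mathbb K_0\leftrightarrow\mathbb K_1$. Let $\mathrm T_1$ be the automorphism of $\widetilde{\mathbf U}^{\imath}$ with $\mathrm T_1(\mathbb K_1)=\mathbb K_1^{-1}$, $\mathrm T_1(\mathbb K_0)=\mathbb K_\delta\mathbb K_1$, $\mathrm T_1(B_1)=\mathbb K_1^{-1}B_1$, $\mathrm T_1(B_0)=[2]^{-1}(B_0B_1^2-v[2]B_1B_0B_1+v^2B_1^2B_0)+B_0\mathbb K_1$. Elements of $\widetilde{\mathbf U}^{\imath}$: for $n\in\mathbb Z$, $B_{1,n}=(\dagger\mathrm T_1)^{-n}(B_1)$; for $m\ge1$, $$\acute\Theta_m=-B_{1,m-1}B_0+v^2B_0B_{1,m-1}+(v^2-1)\sum_{p=0}^{m-2}B_{1,p}B_{1,m-p-2}\mathbb K_0,$$ $$\Theta_m=\acute\Theta_m-\sum_{a=1}^{\lfloor\frac{m-1}{2}\rfloor}(v^2-1)v^{-2a}\acute\Theta_{m-2a}\mathbb K_{a\delta}-\delta_{m,ev}v^{1-m}\mathbb K_{\frac m2\delta},$$ where $\delta_{m,ev}=1$ if $m$ is even and $0$ if $m$ is odd. The algebra ${}^{\mathrm{Dr}}\widetilde{\mathbf U}^{\imath}$ is the $\mathbb Q(v)$-algebra generated by $\mathbb K_1^{\pm1}$,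 $C^{\pm1}$, $H_m$ ($m\ge1$), $B_{1,r}$ ($r\in\mathbb Z$), subject to, for $m,n\ge1$, $r,s\in\mathbb Z$: - $\mathbb K_1\mathbb K_1^{-1}=1$, $CC^{-1}=1$, and $\mathbb K_1,C$ are central; - $[H_m,H_n]=0$; - $[H_m,B_{1,r}]=\frac{[2m]}{m}B_{1,r+m}-\frac{[2m]}{m}B_{1,r-m}C^m$; - $[B_{1,r},B_{1,s+1}]_{v^{-2}}-v^{-2}[B_{1,r+1},B_{1,s}]_{v^2}=v^{-2}\Theta_{s-r+1}C^r\mathbb K_1-v^{-4}\Theta_{s-r-1}C^{r+1}\mathbb K_1+v^{-2}\Theta_{r-s+1}C^s\mathbb K_1-v^{-4}\Theta_{r-s-1}C^{s+1}\mathbb K_1$. Here $\Theta_m\in{}^{\mathrm{Dr}}\widetilde{\mathbf U}^{\imath}$ is defined by $1+\sum_{m\ge1}(v-v^{-1})\Theta_mz^m=\exp\big((v-v^{-1})\sum_{m\ge1}H_mz^m\big)$, with $\Theta_0=\frac1{v-v^{-1}}$ and $\Theta_m=0$ for $m<0$. *)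

theory Defs
  imports
    "HOL-Computational_Algebra.Computational_Algebra"
    "HOL-Library.Poly_Mapping"
begin

section \<open>The ground field and quantum integers\<close>

type_synonym qv = "rat poly fract"

definition v :: qv where
  "v = Fract [:0, 1:] 1"

definition qint :: "int \<Rightarrow> qv" where
  "qint n = (v powi n - v powi (- n)) / (v - v powi (-1))"

definition qbinom :: "int \<Rightarrow> nat \<Rightarrow> qv" where
  "qbinom n r = (\<Prod>k<r. qint (n - int k)) / (\<Prod>k=1..r. qint (int k))"


section \<open>Unital associative algebras over the ground field\<close>

text \<open>The class deliberately does not require \<open>0 \<noteq> 1\<close>: an algebra given by generators and relations
  is not a priori nonzero.\<close>

class qv_algebra = ring + monoid_mult +
  fixes qscale :: "qv \<Rightarrow> 'a \<Rightarrow> 'a"  (infixr \<open>*\<^sub>q\<close> 75)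
  assumes qscale_add_right: "c *\<^sub>q (x + y) = c *\<^sub>q x + c *\<^sub>q y"
    and qscale_add_left: "(c + d) *\<^sub>q x = c *\<^sub>q x + d *\<^sub>q x"
    and qscale_qscale: "c *\<^sub>q (d *\<^sub>q x) = (c * d) *\<^sub>q x"
    and qscale_one: "1 *\<^sub>q x = x"
    and qscale_mult_left: "(c *\<^sub>q x) * y = c *\<^sub>q (x * y)"
    and qscale_mult_right: "x * (c *\<^sub>q y) = c *\<^sub>q (x * y)"

definition algebra_hom :: "('a::qv_algebra \<Rightarrow> 'b::qv_algebra) \<Rightarrow> bool" where
  "algebra_hom f \<longleftrightarrow>
     f 1 = 1 \<and> (\<forall>x y. f (x + y) = f x + f y) \<and> (\<forall>x y. f (x * y) = f x * f y) \<and>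
     (\<forall>c x. f (c *\<^sub>q x) = c *\<^sub>q f x)"

definition algebra_iso :: "('a::qv_algebra \<Rightarrow> 'b::qv_algebra) \<Rightarrow> bool" where
  "algebra_iso f \<longleftrightarrow> algebra_hom f \<and> bij f"

text \<open>\<open>[A, B]\<^sub>v\<^sup>a = A B - v\<^sup>a B A\<close>; the plain commutator is the case \<open>a = 0\<close>.\<close>

definition vcomm :: "int \<Rightarrow> 'a::qv_algebra \<Rightarrow> 'a \<Rightarrow> 'a" where
  "vcomm a A B = A * B - (v powi a) *\<^sub>q (B * A)"

text \<open>Integer power of an element \<open>x\<close> whose inverse \<open>y\<close> is supplied explicitly.\<close>

definition zpow :: "'a::monoid_mult \<Rightarrow> 'a \<Rightarrow> int \<Rightarrow> 'a" where
  "zpow x y n = (if 0 \<le> n then x ^ nat n else y ^ nat (- n))"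


section \<open>Free algebras\<close>

datatype 'g word = Word "'g list"

instantiation word :: (type) monoid_add
begin

definition zero_word :: "'g word" where
  "zero_word = Word []"

fun plus_word :: "'g word \<Rightarrow> 'g word \<Rightarrow> 'g word" where
  "plus_word (Word xs) (Word ys) = Word (xs @ ys)"

instance
proof
  fix a b c :: "'g word"
  show "a + b + c = a + (b + c)" by (cases a; cases b; cases c) simp
  show "0 + a = a" by (cases a) (simp add: zero_word_def)
  show "a + 0 = a" by (cases a) (simp add: zero_word_def)
qed

end

text \<open>The free algebra on \<open>'g\<close> is the monoid algebra of the free monoid (written additively because
  of the convolution product on \<^type>\<open>poly_mapping\<close>).\<close>

typedef 'g free_algebra = "UNIV :: ('g word \<Rightarrow>\<^sub>0 qv) set"
  by simp

setup_lifting type_definition_free_algebra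

instantiation free_algebra :: (type) ring_1
begin
lift_definition zero_free_algebra :: "'g free_algebra" is 0 .
lift_definition one_free_algebra :: "'g free_algebra" is 1 .
lift_definition plus_free_algebra :: "'g free_algebra \<Rightarrow> 'g free_algebra \<Rightarrow> 'g free_algebra" is "(+)" .
lift_definition minus_free_algebra :: "'g free_algebra \<Rightarrow> 'g free_algebra \<Rightarrow> 'g free_algebra" is "(-)" .
lift_definition uminus_free_algebra :: "'g free_algebra \<Rightarrow> 'g free_algebra" is uminus .
lift_definition times_free_algebra :: "'g free_algebra \<Rightarrow> 'g free_algebra \<Rightarrow> 'g free_algebra" is "(*)" .
instance
  by standard (transfer; simp add: algebra_simps)+
end

lemma single_zero_central:
  fixes p :: "'g word \<Rightarrow>\<^sub>0 qv"
  shows "p * Poly_Mapping.single 0 c = Poly_Mapping.single 0 c * p"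
proof (induction p rule: update_induct)
  case const
  then show ?case by simp
next
  case (update f a b)
  have "Poly_Mapping.update a b f = f + Poly_Mapping.single a b"
  proof (rule poly_mapping_eqI)
    fix k
    show "Poly_Mapping.lookup (Poly_Mapping.update a b f) k
        = Poly_Mapping.lookup (f + Poly_Mapping.single a b) k"
      using update(1)
      by (cases "k = a") (auto simp: lookup_update lookup_add lookup_single in_keys_iff)
  qed
  then show ?case
    using update(3) by (simp add: distrib_left distrib_right mult_single mult.commute)
qed

instantiation free_algebra :: (type) qv_algebra
begin
lift_definition qscale_free_algebra :: "qv \<Rightarrow> 'g free_algebra \<Rightarrow> 'g free_algebra"
  is "\<lambda>(c :: qv) p. Poly_Mapping.single 0 c * p" .
instance
proof
  fix c d :: qv and x y :: "'g free_algebra"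
  show "c *\<^sub>q (x + y) = c *\<^sub>q x + c *\<^sub>q y"
    by transfer (simp add: distrib_left)
  show "(c + d) *\<^sub>q x = c *\<^sub>q x + d *\<^sub>q x"
    by transfer (simp add: single_add distrib_right)
  show "c *\<^sub>q (d *\<^sub>q x) = (c * d) *\<^sub>q x"
    by transfer (simp add: mult_single flip: mult.assoc)
  show "1 *\<^sub>q x = x"
    by transfer simp
  show "(c *\<^sub>q x) * y = c *\<^sub>q (x * y)"
    by transfer (simp add: mult.assoc)
  show "x * (c *\<^sub>q y) = c *\<^sub>q (x * y)"
    by transfer (simp add: single_zero_central flip: mult.assoc)
qed
end

lift_definition gen :: "'g \<Rightarrow> 'g free_algebra"
  is "\<lambda>g. Poly_Mapping.single (Word [g]) (1 :: qv)" .

lifting_forget free_algebra.lifting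


section \<open>Algebras presented by generators and relations\<close>

text \<open>A presentation is attached to the type of its generators; a pair \<open>(l, r)\<close> in
  \<open>relators\<close> stands for the defining relation \<open>l = r\<close>.\<close>

class presentation =
  fixes relators :: "('a free_algebra \<times> 'a free_algebra) set"

inductive_set relation_ideal :: "'g::presentation free_algebra set" where
  zero: "0 \<in> relation_ideal"
| rel: "(l, r) \<in> relators \<Longrightarrow> l - r \<in> relation_ideal"
| add: "x \<in> relation_ideal \<Longrightarrow> y \<in> relation_ideal \<Longrightarrow> x + y \<in> relation_ideal"
| mult_left: "x \<in> relation_ideal \<Longrightarrow> a * x \<in> relation_ideal"
| mult_right: "x \<in> relation_ideal \<Longrightarrow> x * a \<in> relation_ideal"

definition presentation_eq :: "'g::presentation free_algebra \<Rightarrow> 'g free_algebra \<Rightarrow> bool" where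
  "presentation_eq x y \<longleftrightarrow> x - y \<in> relation_ideal"

lemma relation_ideal_uminus: "x \<in> relation_ideal \<Longrightarrow> - x \<in> relation_ideal"
  using relation_ideal.mult_left[of x "- 1"] by simp

lemma relation_ideal_qscale: "x \<in> relation_ideal \<Longrightarrow> c *\<^sub>q x \<in> relation_ideal"
  using relation_ideal.mult_left[of x "c *\<^sub>q 1"] by (simp add: qscale_mult_left)

lemma presentation_eq_equivp: "equivp presentation_eq"
proof (rule equivpI)
  show "reflp presentation_eq"
    by (auto simp: reflp_def presentation_eq_def relation_ideal.zero)
  show "symp presentation_eq"
    by (rule sympI) (use relation_ideal_uminus in \<open>force simp: presentation_eq_def\<close>)
  show "transp presentation_eq"
    by (rule transpI) (use relation_ideal.add in \<open>force simp: presentation_eq_def\<close>)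
qed

quotient_type (overloaded) 'g presented = "'g::presentation free_algebra" / presentation_eq
  by (rule presentation_eq_equivp)

lift_definition of_free :: "'g::presentation free_algebra \<Rightarrow> 'g presented" is "\<lambda>x. x" .

instantiation presented :: (presentation) qv_algebra
begin

lift_definition zero_presented :: "'g::presentation presented" is "0 :: 'g free_algebra" .

lift_definition one_presented :: "'g::presentation presented" is "1 :: 'g free_algebra" .

lift_definition plus_presented :: "'g::presentation presented \<Rightarrow> 'g presented \<Rightarrow> 'g presented" is "(+) :: 'g free_algebra \<Rightarrow> _"
  unfolding presentation_eq_def
  by (drule (1) relation_ideal.add) (simp add: algebra_simps)

lift_definition uminus_presented :: "'g::presentation presented \<Rightarrow> 'g presented" is "uminus :: 'g free_algebra \<Rightarrow> _"
  unfolding presentation_eq_def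
  by (drule relation_ideal_uminus) (simp add: algebra_simps)

lift_definition minus_presented :: "'g::presentation presented \<Rightarrow> 'g presented \<Rightarrow> 'g presented" is "(-) :: 'g free_algebra \<Rightarrow> _"
  unfolding presentation_eq_def
  by (drule (1) relation_ideal.add[OF _ relation_ideal_uminus]) (simp add: algebra_simps)

lift_definition times_presented :: "'g::presentation presented \<Rightarrow> 'g presented \<Rightarrow> 'g presented" is "(*) :: 'g free_algebra \<Rightarrow> _"
proof -
  fix a a' b b' :: "'g::presentation free_algebra"
  assume "presentation_eq a a'" "presentation_eq b b'"
  then have "(a - a') * b + a' * (b - b') \<in> relation_ideal"
    unfolding presentation_eq_def
    by (intro relation_ideal.add relation_ideal.mult_left relation_ideal.mult_right)
  then show "presentation_eq (a * b) (a' * b')"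
    by (simp add: presentation_eq_def algebra_simps)
qed

lift_definition qscale_presented :: "qv \<Rightarrow> 'g::presentation presented \<Rightarrow> 'g presented" is "(*\<^sub>q) :: qv \<Rightarrow> 'g free_algebra \<Rightarrow> _"
proof -
  fix c and x y :: "'g::presentation free_algebra"
  assume "presentation_eq x y"
  then have "c *\<^sub>q (x - y) \<in> relation_ideal"
    unfolding presentation_eq_def by (rule relation_ideal_qscale)
  moreover have "c *\<^sub>q (x - y) = c *\<^sub>q x - c *\<^sub>q y"
    using qscale_add_right[of c "x - y" y] by (simp add: algebra_simps)
  ultimately show "presentation_eq (c *\<^sub>q x) (c *\<^sub>q y)"
    by (simp add: presentation_eq_def)
qed

instance
proof
  fix a b c :: "'g::presentation presented" and k l :: qv
  note [simp] = presentation_eq_def relation_ideal.zero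
  show "a + b + c = a + (b + c)" by transfer (simp add: algebra_simps)
  show "a + b = b + a" by transfer (simp add: algebra_simps)
  show "0 + a = a" by transfer simp
  show "- a + a = 0" by transfer simp
  show "a - b = a + - b" by transfer simp
  show "a * b * c = a * (b * c)" by transfer (simp add: algebra_simps)
  show "(a + b) * c = a * c + b * c" by transfer (simp add: algebra_simps)
  show "a * (b + c) = a * b + a * c" by transfer (simp add: algebra_simps)
  show "1 * a = a" by transfer simp
  show "a * 1 = a" by transfer simp
  show "k *\<^sub>q (a + b) = k *\<^sub>q a + k *\<^sub>q b" by transfer (simp add: qscale_add_right)
  show "(k + l) *\<^sub>q a = k *\<^sub>q a + l *\<^sub>q a" by transfer (simp add: qscale_add_left)
  show "k *\<^sub>q (l *\<^sub>q a) = (k * l) *\<^sub>q a" by transfer (simp add: qscale_qscale)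
  show "1 *\<^sub>q a = a" by transfer (simp add: qscale_one)
  show "(k *\<^sub>q a) * b = k *\<^sub>q (a * b)" by transfer (simp add: qscale_mult_left)
  show "a * (k *\<^sub>q b) = k *\<^sub>q (a * b)" by transfer (simp add: qscale_mult_right)
qed

end


section \<open>The universal q-Onsager algebra\<close>

datatype node = N0 | N1

fun other :: "node \<Rightarrow> node" where
  "other N0 = N1"
| "other N1 = N0"

datatype onsager_gen = GB node | GK node | GKinv node

instantiation onsager_gen :: presentation
begin

definition relators_onsager_gen :: "(onsager_gen free_algebra \<times> onsager_gen free_algebra) set" where
  "relators_onsager_gen =
     {(gen (GK i) * gen (GKinv i), 1) | i. True}
   \<union> {(gen (GKinv i) * gen (GK i), 1) | i. True}
   \<union> {(gen (GK i) * gen x, gen x * gen (GK i)) | i x. True}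
   \<union> {(\<Sum>r\<le>3. ((-1) ^ r * qbinom 3 r) *\<^sub>q
            (gen (GB i) ^ (3 - r) * gen (GB j) * gen (GB i) ^ r),
       (- (v powi (-1)) * (qint 2)\<^sup>2) *\<^sub>q
            ((gen (GB i) * gen (GB j) - gen (GB j) * gen (GB i)) * gen (GK i))) | i j. j = other i}"

instance ..

end

type_synonym onsager = "onsager_gen presented"

definition oB :: "node \<Rightarrow> onsager" where "oB i = of_free (gen (GB i))"
definition oK :: "node \<Rightarrow> onsager" where "oK i = of_free (gen (GK i))"
definition oKinv :: "node \<Rightarrow> onsager" where "oKinv i = of_free (gen (GKinv i))"

definition oKdelta :: onsager where
  "oKdelta = oK N0 * oK N1"

text \<open>The descriptions below denote: each automorphism exists, and it is unique since it is
  prescribed on the generators \<open>B\<^sub>i\<close>, \<open>K\<^sub>i\<close> (hence on \<open>K\<^sub>i\<^sup>-\<^sup>1\<close>).\<close>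

definition dagger :: "onsager \<Rightarrow> onsager" where
  "dagger = (THE f. algebra_iso f \<and> f \<circ> f = id \<and>
     f (oB N0) = oB N1 \<and> f (oB N1) = oB N0 \<and> f (oK N0) = oK N1 \<and> f (oK N1) = oK N0)"

definition T1 :: "onsager \<Rightarrow> onsager" where
  "T1 = (THE f. algebra_iso f \<and>
     f (oK N1) = oKinv N1 \<and>
     f (oK N0) = oKdelta * oK N1 \<and>
     f (oB N1) = oKinv N1 * oB N1 \<and>
     f (oB N0) =
       (1 / qint 2) *\<^sub>q (oB N0 * (oB N1)\<^sup>2 - (v * qint 2) *\<^sub>q (oB N1 * oB N0 * oB N1)
                        + v\<^sup>2 *\<^sub>q ((oB N1)\<^sup>2 * oB N0))
       + oB N0 * oK N1)"

definition int_iterate :: "('a \<Rightarrow> 'a) \<Rightarrow> int \<Rightarrow> 'a \<Rightarrow> 'a" where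
  "int_iterate f n = (if 0 \<le> n then f ^^ nat n else (inv f) ^^ nat (- n))"

text \<open>The real root vectors \<open>B\<^sub>1\<^sub>,\<^sub>n\<close>.\<close>

definition oB1 :: "int \<Rightarrow> onsager" where
  "oB1 n = int_iterate (dagger \<circ> T1) (- n) (oB N1)"

definition oTheta_acute :: "nat \<Rightarrow> onsager" where
  "oTheta_acute m =
     - (oB1 (int m - 1) * oB N0) + v\<^sup>2 *\<^sub>q (oB N0 * oB1 (int m - 1))
     + (v\<^sup>2 - 1) *\<^sub>q (\<Sum>p\<in>{0..int m - 2}. oB1 p * oB1 (int m - p - 2) * oK N0)"

definition oTheta :: "nat \<Rightarrow> onsager" where
  "oTheta m =
     oTheta_acute m
     - (\<Sum>a=1..(m - 1) div 2.
          ((v\<^sup>2 - 1) * v powi (- 2 * int a)) *\<^sub>q (oTheta_acute (m - 2 * a) * oKdelta ^ a))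
     - (if even m then (v powi (1 - int m)) *\<^sub>q (oKdelta ^ (m div 2)) else 0)"


section \<open>The Drinfeld type presentation\<close>

text \<open>Since the generators \<open>H\<^sub>m\<close> exist only for \<open>m \<ge> 1\<close>, \<open>DH k\<close> stands for \<open>H\<close> with index \<open>k + 1\<close>.\<close>

datatype drinfeld_gen = DK1 | DK1inv | DC | DCinv | DH nat | DB int

definition fH :: "nat \<Rightarrow> drinfeld_gen free_algebra" where
  "fH m = gen (DH (m - 1))"

text \<open>Exponential of a power series without constant term: for such \<open>X\<close>, \<open>X ^ k\<close> does not
  contribute to the coefficient of \<open>z ^ m\<close> when \<open>k > m\<close>.\<close>

definition series_exp :: "'a::{ring_1, qv_algebra} fps \<Rightarrow> 'a fps" where
  "series_exp X = Abs_fps (\<lambda>m. \<Sum>k\<le>m. (1 / fact k) *\<^sub>q fps_nth (X ^ k) m)"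

text \<open>\<open>\<Theta>\<^sub>k\<close> as an expression in the \<open>H\<^sub>m\<close>. The order of factors is immaterial once the \<open>H\<^sub>m\<close>
  commute. The constant term \<open>1\<close> of the exponential yields \<open>\<Theta>\<^sub>0 = 1 / (v - v\<^sup>-\<^sup>1)\<close>.\<close>

definition fTheta :: "int \<Rightarrow> drinfeld_gen free_algebra" where
  "fTheta k =
     (if k < 0 then 0
      else (1 / (v - v powi (-1))) *\<^sub>q
        fps_nth (series_exp (Abs_fps (\<lambda>m. if m = 0 then 0 else (v - v powi (-1)) *\<^sub>q fH m))) (nat k))"

definition fCpow :: "int \<Rightarrow> drinfeld_gen free_algebra" where
  "fCpow n = zpow (gen DC) (gen DCinv) n"

instantiation drinfeld_gen :: presentation
begin

definition relators_drinfeld_gen ::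
    "(drinfeld_gen free_algebra \<times> drinfeld_gen free_algebra) set" where
  "relators_drinfeld_gen =
     {(gen DK1 * gen DK1inv, 1), (gen DC * gen DCinv, 1)}
   \<union> {(gen DK1 * gen x, gen x * gen DK1) | x. True}
   \<union> {(gen DC * gen x, gen x * gen DC) | x. True}
   \<union> {(fH m * fH n - fH n * fH m, 0) | m n. 1 \<le> m \<and> 1 \<le> n}
   \<union> {(fH m * gen (DB r) - gen (DB r) * fH m,
       (qint (2 * int m) / of_nat m) *\<^sub>q gen (DB (r + int m))
       - (qint (2 * int m) / of_nat m) *\<^sub>q (gen (DB (r - int m)) * gen DC ^ m)) | m r. 1 \<le> m}
   \<union> {(vcomm (-2) (gen (DB r)) (gen (DB (s + 1)))
       - (v powi (-2)) *\<^sub>q vcomm 2 (gen (DB (r + 1))) (gen (DB s)),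
       (v powi (-2)) *\<^sub>q (fTheta (s - r + 1) * fCpow r * gen DK1)
       - (v powi (-4)) *\<^sub>q (fTheta (s - r - 1) * fCpow (r + 1) * gen DK1)
       + (v powi (-2)) *\<^sub>q (fTheta (r - s + 1) * fCpow s * gen DK1)
       - (v powi (-4)) *\<^sub>q (fTheta (r - s - 1) * fCpow (s + 1) * gen DK1)) | r s. True}"

instance ..

end

type_synonym drinfeld = "drinfeld_gen presented"

definition dK1 :: drinfeld where "dK1 = of_free (gen DK1)"
definition dK1inv :: drinfeld where "dK1inv = of_free (gen DK1inv)"
definition dC :: drinfeld where "dC = of_free (gen DC)"
definition dB1 :: "int \<Rightarrow> drinfeld" where "dB1 r = of_free (gen (DB r))"
definition dTheta :: "int \<Rightarrow> drinfeld" where "dTheta m = of_free (fTheta m)"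

end

theory Submission
  imports Defs
begin

text \<open>The proof compares both algebras with one kind of datum: a sequence \<open>B r\<close> indexed by the integers,
an element \<open>t\<close> (playing \<open>\<Theta>\<^sub>1 = H\<^sub>1\<close>) and central invertible elements \<open>C\<close>, \<open>K\<close> such that
\<open>t * B r - B r * t = [2] (B (r + 1) - C * B (r - 1))\<close>. Such a sequence is determined by \<open>B (-1)\<close>, \<open>B 0\<close>
and \<open>t\<close>.

Let \<open>Q r s\<close> (below \<open>BB B r s\<close>) be the left-hand side of the quadratic Drinfeld relation. At \<open>r = s = -1\<close> that
relation expresses \<open>t\<close> through \<open>B (-1)\<close> and \<open>B 0\<close>; after substitution its instances at \<open>r = s = 0\<close> and at
\<open>r = s = -2\<close> are exactly the two Serre-type relations of the q-Onsager algebra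
(\<open>serre_right_iff\<close>, \<open>serre_left_iff\<close>). Hence there is a homomorphism \<open>\<Psi>\<close> from the q-Onsager algebra to the
Drinfeld algebra, and the q-Onsager algebra carries a sequence which satisfies the three diagonal instances. What has
to be shown is that these three instances imply all the Drinfeld relations, in any algebra (locale
\<open>drinfeld_data\<close>).

Put \<open>U r s = Q r s - C * Q (r - 1) (s - 1)\<close>. If all \<open>U r s\<close> vanish, then \<open>C\<^sup>-\<^sup>r Q r (r + d)\<close> depends on \<open>d\<close>
alone, and its values define the \<open>\<Theta>\<close>'s; the quadratic relation then holds by construction. The vanishing
comes from the interplay of three facts.

\<^item> The bracket with \<open>t\<close> maps \<open>Q r s\<close> to \<open>[2] (U r (s + 1) + U (r + 1) s)\<close>; more generally an element that moves
each \<open>B j\<close> by \<open>c (B (j + m) - C\<^sup>m B (j - m))\<close> maps \<open>Q r r\<close> to a combination of values of \<open>U\<close>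
(\<open>t_BB\<close>, \<open>BB_diagonal_commutator\<close>).
\<^item> A polynomial identity in three terms of an arbitrary sequence (\<open>BB_move_cyclic\<close>), obtained by reversing a
product of three factors in two ways, forces the commutation rule between \<open>\<Theta>\<^sub>k\<close> and \<open>B r\<close> as soon as \<open>U r s\<close>
vanishes for \<open>\<bar>s - r\<bar> < k\<close>. Taking logarithmic derivatives (\<open>log_derivative_B\<close>) turns this rule into the required
action of \<open>H\<^sub>k\<close>.
\<^item> The bracket of \<open>H\<^sub>m\<close> and \<open>\<Theta>\<^sub>1\<close> can be computed from the action of \<open>H\<^sub>m\<close> on \<open>Q 0 0\<close>, which is
proportional to \<open>\<Theta>\<^sub>1\<close>, and from the action of \<open>\<Theta>\<^sub>1\<close> on \<open>\<Theta>\<^sub>m\<close>. Both are multiples of \<open>U 0 m\<close>, and comparing them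
gives \<open>([2m] + [2]) U 0 m = 0\<close>. As \<open>v\<close> is an indeterminate, \<open>U 0 m = 0\<close>.

Induction on \<open>\<bar>s - r\<bar>\<close> finishes the argument (\<open>vanish_step\<close>, \<open>U_eq_0\<close>), and the same comparison for \<open>m = 2\<close>
propagates the diagonal instances from three consecutive places to all places (\<open>diagonal_propagates\<close>). The \<open>H\<^sub>m\<close>
commute because the image of \<open>Q r s\<close> under the bracket with \<open>H\<^sub>m\<close> is a combination of values of \<open>U\<close>.

Moving the index of the sequence by \<open>1\<close>, with \<open>K\<close> replaced by \<open>C * K\<close>, gives a datum of the same kind. So the q-Onsager
algebra has automorphisms \<open>B r \<mapsto> B (r + n)\<close>. The automorphism \<open>T1\<close> turns out to be \<open>dagger\<close> after the one with
\<open>n = -1\<close>, which identifies \<open>oB1\<close> with the sequence; summing the quadratic relation along an antidiagonal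
identifies \<open>oTheta\<close> with the \<open>\<Theta>\<close>'s. This yields \<open>\<Phi>\<close>. Finally \<open>\<Phi> \<circ> \<Psi> = id\<close> is checked on generators, and \<open>\<Psi>\<close> is onto
because the Drinfeld relations produce all generators from \<open>B\<^sub>1\<^sub>,\<^sub>0\<close>, its predecessor, \<open>K\<^sub>1\<close> and \<open>C\<close>
(\<open>drinfeld_generators\<close>).\<close>

section \<open>Scalars\<close>

lemma v_power: "v ^ n = to_fract (monom 1 n)"
proof -
  have "v = to_fract (monom 1 1)"
    by (simp add: v_def Fract_conv_to_fract monom_altdef)
  then have "v ^ n = to_fract (monom 1 1 ^ n)"
    by (induction n) simp_all
  then show ?thesis by (simp add: monom_power)
qed

lemma v_nonzero: "v \<noteq> 0"
proof -
  have "v ^ 1 \<noteq> 0"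
    unfolding v_power by (simp add: monom_eq_0_iff)
  then show ?thesis by simp
qed

text \<open>Non-vanishing of a polynomial in \<open>v\<close> is detected by the specialisation \<open>v = 2\<close>, at which the signs in the
expressions below are evident.\<close>

lemma poly_in_v_nonzero:
  assumes "poly P 2 \<noteq> 0"
  shows "to_fract P \<noteq> (0 :: qv)"
  using assms by auto

lemma v_power_neq_1: "0 < n \<Longrightarrow> v ^ n \<noteq> 1"
proof -
  assume "0 < n"
  then have "(1 :: rat) < 2 ^ n"
    by (intro one_less_power) simp_all
  then have "poly (monom 1 n - 1) 2 \<noteq> (0 :: rat)"
    by (simp add: poly_monom)
  from poly_in_v_nonzero[OF this] show ?thesis by (simp add: v_power)
qed

abbreviation vi :: qv where "vi \<equiv> inverse v"

lemma v_vi [simp]: "v * vi = 1" "vi * v = 1" "v * (vi * x) = x" "vi * (v * x) = x"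
  using v_nonzero by (simp_all flip: mult.assoc)

lemma v_minus_vi_nonzero: "v - vi \<noteq> 0"
proof
  assume "v - vi = 0"
  then have "v * (v - vi) = 0" by simp
  then have "v ^ 2 = 1" by (simp add: algebra_simps power2_eq_square)
  then show False using v_power_neq_1[of 2] by simp
qed

text \<open>This is \<open>(v - v\<^sup>-\<^sup>1) [2m]\<close>, the coefficient with which the logarithmic derivative of the series of the
\<open>\<Theta>\<close>'s acts on the sequence.\<close>

definition cv :: "nat \<Rightarrow> qv" where
  "cv m = v ^ (2 * m) - vi ^ (2 * m)"

lemma qint_even: "qint (2 * int m) = cv m / (v - vi)"
proof -
  have "v powi (2 * int m) = v ^ (2 * m)"
    using power_int_of_nat[of v "2 * m"] by simp
  then show ?thesis
    by (simp add: qint_def cv_def power_int_minus power_inverse)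
qed

text \<open>The inequality \<open>[2m] + [2] \<noteq> 0\<close> on which both propagation arguments rest.\<close>

lemma cv_add_cv1_nonzero:
  assumes "0 < m"
  shows "cv m + cv 1 \<noteq> 0"
proof
  assume "cv m + cv 1 = 0"
  then have "v ^ (2 * m) * (cv m + cv 1) = 0" by simp
  moreover have "v ^ (2 * m) * vi ^ (2 * m) = 1"
    using v_nonzero by (simp add: power_inverse)
  moreover have "v ^ (2 * m) * vi ^ 2 = v ^ (2 * m - 2)"
  proof -
    obtain k where "m = Suc k"
      using assms by (cases m) auto
    then have "v ^ (2 * m) = v ^ (2 * m - 2) * v ^ 2"
      by (simp add: power2_eq_square mult_ac)
    then show ?thesis by (simp add: power2_eq_square mult.assoc)
  qed
  ultimately have "v ^ (2 * m) * v ^ (2 * m) - 1 + v ^ (2 * m) * v ^ 2 - v ^ (2 * m - 2) = 0"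
    by (simp add: cv_def algebra_simps power2_eq_square)
  moreover have "v ^ (2 * m) * v ^ (2 * m) - 1 + v ^ (2 * m) * v ^ 2 - v ^ (2 * m - 2)
      = to_fract (monom 1 (4 * m) - 1 + monom 1 (2 * m + 2) - monom 1 (2 * m - 2))"
    by (simp add: v_power mult_monom flip: to_fract_mult)
  moreover have "poly (monom 1 (4 * m) - 1 + monom 1 (2 * m + 2) - monom 1 (2 * m - 2)) 2 \<noteq> (0 :: rat)"
  proof -
    have "(2 :: rat) ^ (2 * m - 2) < 2 ^ (2 * m + 2)"
      by (rule power_strict_increasing) simp_all
    moreover have "(1 :: rat) \<le> 2 ^ (4 * m)" by simp
    moreover have "poly (monom 1 (4 * m) - 1 + monom 1 (2 * m + 2) - monom 1 (2 * m - 2)) 2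
        = (2 :: rat) ^ (4 * m) - 1 + 2 ^ (2 * m + 2) - 2 ^ (2 * m - 2)"
      by (simp only: poly_monom poly_add poly_diff poly_1 mult_1)
    ultimately show ?thesis by linarith
  qed
  ultimately show False using poly_in_v_nonzero by metis
qed

lemma cv_nonzero: "0 < m \<Longrightarrow> cv m \<noteq> 0"
proof
  assume "0 < m" "cv m = 0"
  then have "v ^ (2 * m) * cv m = 0" by simp
  moreover have "v ^ (2 * m) * vi ^ (2 * m) = 1"
    using v_nonzero by (simp add: power_inverse)
  ultimately have "v ^ (4 * m) = 1"
    by (simp add: cv_def algebra_simps flip: power_add)
  then show False using v_power_neq_1[of "4 * m"] \<open>0 < m\<close> by simp
qed

lemma qint_2: "qint 2 = v + vi"
proof -
  have "(v - vi) * (v + vi) = v ^ 2 - vi ^ 2"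
    by (simp add: algebra_simps power2_eq_square)
  then show ?thesis
    using qint_even[of 1] v_minus_vi_nonzero
    by (simp add: cv_def divide_eq_eq mult.commute)
qed

lemma cv_1: "cv 1 = (v - vi) * qint 2"
  using qint_even[of 1] v_minus_vi_nonzero by simp

lemma qint_2_nonzero: "qint 2 \<noteq> 0"
proof -
  have "cv 1 + cv 1 \<noteq> 0" by (rule cv_add_cv1_nonzero) simp
  then have "cv 1 \<noteq> 0" by auto
  then show ?thesis using cv_1 by auto
qed

section \<open>Scalars acting on algebras, and central elements\<close>

global_interpretation qs: vector_space "qscale :: qv \<Rightarrow> 'a::qv_algebra \<Rightarrow> 'a"
  by unfold_locales (simp_all add: qscale_add_right qscale_add_left qscale_qscale qscale_one)

lemmas qscale_linear = qscale_add_right qscale_add_left qscale_qscale qscale_one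
  qscale_mult_left qscale_mult_right qs.scale_right_diff_distrib qs.scale_left_diff_distrib
  qs.scale_minus_left qs.scale_minus_right

lemmas qscale_simps [simp] = qs.scale_zero_left qs.scale_zero_right qscale_one

definition central :: "'a::qv_algebra \<Rightarrow> bool" where
  "central z \<longleftrightarrow> (\<forall>x. z * x = x * z)"

lemma centralD: "central z \<Longrightarrow> x * z = z * x"
  by (simp add: central_def)

text \<open>As a rewrite rule for noncommutative products this has to be instantiated at the non-central factor \<open>x\<close>; for
\<open>x = z\<close> it would loop.\<close>

lemma central_left_commute: "central z \<Longrightarrow> x * (z * y) = z * (x * y)"
  by (metis central_def mult.assoc)

lemma central_mult: "central a \<Longrightarrow> central b \<Longrightarrow> central (a * b)"
  unfolding central_def by (metis mult.assoc)

lemma central_one: "central 1"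
  by (simp add: central_def)

lemma central_power: "central a \<Longrightarrow> central (a ^ n)"
  by (induction n) (simp_all add: central_one central_mult)

lemma central_inverse:
  assumes "central a" and ab: "a * b = 1"
  shows "central b"
  unfolding central_def
proof
  fix x
  have "b * a = 1" using centralD[OF assms(1)] ab by metis
  then have "b * x = b * x * (a * b)" using ab by simp
  also have "\<dots> = b * (x * a) * b" by (simp only: mult.assoc)
  also have "\<dots> = b * a * x * b" by (simp only: centralD[OF assms(1), of x] mult.assoc)
  finally show "b * x = x * b" using \<open>b * a = 1\<close> by simp
qed

lemma central_zpow: "central a \<Longrightarrow> central b \<Longrightarrow> central (zpow a b n)"
  by (simp add: zpow_def central_power)

lemma zpow_plus_1:
  assumes "central a" "a * b = 1"
  shows "zpow a b (n + 1) = a * zpow a b n"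
proof (cases "0 \<le> n")
  case True
  then have "nat (n + 1) = Suc (nat n)" by simp
  then show ?thesis using True by (simp add: zpow_def)
next
  case False
  then have "nat (- n) = Suc (nat (- (n + 1)))" by simp
  moreover have "a * (b * x) = x" for x using assms(2) by (simp flip: mult.assoc)
  ultimately show ?thesis using False by (auto simp: zpow_def)
qed

lemma zpow_0 [simp]: "zpow a b 0 = 1"
  by (simp add: zpow_def)

section \<open>The quadratic relation and its cyclic identity\<close>

abbreviation pv :: qv where "pv \<equiv> vi * vi"

text \<open>The left-hand side of the quadratic Drinfeld relation, with the brackets expanded; \<open>pv\<close> is \<open>v\<^sup>-\<^sup>2\<close>. With
\<open>B(z)\<close> the generating series of the \<open>B r z\<^sup>-\<^sup>r\<close> it is the coefficient in
\<open>(w - v\<^sup>-\<^sup>2 z) B(z) B(w) + (z - v\<^sup>-\<^sup>2 w) B(w) B(z)\<close>,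
which makes the symmetry in \<open>r\<close>, \<open>s\<close> visible.\<close>

definition BB :: "(int \<Rightarrow> 'a::qv_algebra) \<Rightarrow> int \<Rightarrow> int \<Rightarrow> 'a" where
  "BB B r s = B r * B (s + 1) - pv *\<^sub>q (B (r + 1) * B s)
            + B s * B (r + 1) - pv *\<^sub>q (B (s + 1) * B r)"

lemma BB_commute: "BB B r s = BB B s r"
  by (simp add: BB_def algebra_simps)

text \<open>Measures how far the series \<open>BB(z,w)\<close> of all \<open>BB B a b\<close> is from commuting with a third series \<open>B(u)\<close> up to
polynomial factors: it is the coefficient in
\<open>(u - v\<^sup>-\<^sup>2 z)(u - v\<^sup>-\<^sup>2 w) BB(z,w) B(u) - (z - v\<^sup>-\<^sup>2 u)(w - v\<^sup>-\<^sup>2 u) B(u) BB(z,w)\<close>.\<close>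

definition BB_move :: "(int \<Rightarrow> 'a::qv_algebra) \<Rightarrow> int \<Rightarrow> int \<Rightarrow> int \<Rightarrow> 'a" where
  "BB_move B a b c =
     BB B a b * B (c + 2) + (pv * pv) *\<^sub>q (BB B (a + 1) (b + 1) * B c)
     - pv *\<^sub>q ((BB B (a + 1) b + BB B a (b + 1)) * B (c + 1))
     - (B c * BB B (a + 1) (b + 1) + (pv * pv) *\<^sub>q (B (c + 2) * BB B a b)
        - pv *\<^sub>q (B (c + 1) * (BB B (a + 1) b + BB B a (b + 1))))"

text \<open>Write \<open>BB(z,w)\<close> as a relation that exchanges \<open>B(z)\<close> and \<open>B(w)\<close> up to polynomial factors. Reversing the product
\<open>B(z) B(w) B(u)\<close> by adjacent exchanges is possible in two ways, as in the braid relation, and the two sets of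
correction terms must agree. The agreement is an identity between polynomials in the entries of an arbitrary
sequence.\<close>

lemma BB_move_cyclic: "BB_move B a b c + BB_move B b c a + BB_move B a c b = 0"
  unfolding BB_move_def BB_def by (simp add: algebra_simps qscale_linear)

lemma BB_move_commute: "BB_move B a b c = BB_move B b a c"
  unfolding BB_move_def
  by (simp only: BB_commute[of B b a] BB_commute[of B "b + 1" "a + 1"] BB_commute[of B "b + 1" a]
      BB_commute[of B b "a + 1"] add.commute[of "BB B a (b + 1)"])

text \<open>All three terms of the cyclic identity coincide.\<close>

lemma BB_move_diagonal: "BB_move B a a a = 0"
proof -
  have "(1 + 1 + 1) *\<^sub>q BB_move B a a a = 0"
    using BB_move_cyclic[of B a a a] by (simp only: qscale_linear)
  then show ?thesis by simp
qed

text \<open>With two equal indices the cyclic identity expresses a general term through a diagonal one.\<close>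

lemma BB_move_adjacent: "BB_move B a a b = 0 \<Longrightarrow> BB_move B a b a = 0"
proof -
  assume "BB_move B a a b = 0"
  then have "(1 + 1) *\<^sub>q BB_move B a b a = 0"
    using BB_move_cyclic[of B a b a] BB_move_commute[of B b a a] by (simp only: qscale_linear) simp
  then show ?thesis by simp
qed

lemma BB_commutator:
  assumes "\<And>j. j \<in> {r, r + 1, s, s + 1} \<Longrightarrow> h * B j - B j * h = c *\<^sub>q (B (j + m) - D * B (j - m))"
    and D: "central D"
  shows "h * BB B r s - BB B r s * h
    = c *\<^sub>q (BB B (r + m) s + BB B r (s + m) - D * BB B (r - m) s - D * BB B r (s - m))"
proof -
  have hB: "h * B j = B j * h + c *\<^sub>q (B (j + m) - D * B (j - m))"
    if "j \<in> {r, r + 1, s, s + 1}" for j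
    using assms(1)[OF that] by (simp add: algebra_simps)
  have hB': "h * (B j * x) = B j * (h * x) + c *\<^sub>q (B (j + m) * x - D * (B (j - m) * x))"
    if "j \<in> {r, r + 1, s, s + 1}" for j x
    using arg_cong[where f="\<lambda>y. y * x", OF hB[OF that]] by (simp add: algebra_simps qscale_linear)
  show ?thesis
    unfolding BB_def
    by (simp add: hB hB' algebra_simps qscale_linear central_left_commute[OF D])
qed

section \<open>Sequences moved by an inner derivation\<close>

text \<open>The relation satisfied by \<open>H\<^sub>1\<close>: up to the factor \<open>[2]\<close>, the inner derivation of \<open>t\<close> acts on the sequence as the
shift minus \<open>C\<close> times the inverse shift.\<close>

locale shift_data =
  fixes B :: "int \<Rightarrow> 'a::qv_algebra" and t C Ci :: 'a
  assumes central_C: "central C" and C_Ci: "C * Ci = 1"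
    and t_B: "t * B r - B r * t = qint 2 *\<^sub>q (B (r + 1) - C * B (r - 1))"
begin

lemma central_Ci: "central Ci"
  using central_inverse[OF central_C C_Ci] .

lemma Ci_C: "Ci * C = 1"
  using C_Ci centralD[OF central_C] by metis

lemma C_Ci_cancel [simp]: "C * (Ci * x) = x" "Ci * (C * x) = x"
  using C_Ci Ci_C by (simp_all flip: mult.assoc)

lemma C_eq_0 [simp]: "C * x = 0 \<longleftrightarrow> x = 0"
  by (metis C_Ci_cancel(2) mult_zero_right)

text \<open>Vanishing of \<open>U\<close> on the diagonal \<open>s - r = d\<close> means that \<open>C\<^sup>-\<^sup>r BB B r (r + d)\<close> is independent of \<open>r\<close>, which is what the
right-hand side of the quadratic Drinfeld relation requires.\<close>

definition U :: "int \<Rightarrow> int \<Rightarrow> 'a" where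
  "U r s = BB B r s - C * BB B (r - 1) (s - 1)"

lemma U_commute: "U r s = U s r"
  by (simp add: U_def BB_commute)

lemma t_BB: "t * BB B r s - BB B r s * t = qint 2 *\<^sub>q (U r (s + 1) + U (r + 1) s)"
  using BB_commutator[of r s t B "qint 2" 1 C] t_B central_C
  by (simp add: U_def algebra_simps)

lemma telescope_U: "BB B r s - C ^ n * BB B (r - int n) (s - int n)
    = (\<Sum>i<n. C ^ i * U (r - int i) (s - int i))"
proof (induction n)
  case 0
  then show ?case by simp
next
  case (Suc n)
  have "C ^ n * U (r - int n) (s - int n)
      = C ^ n * BB B (r - int n) (s - int n) - C ^ Suc n * BB B (r - int (Suc n)) (s - int (Suc n))"
    by (simp only: U_def right_diff_distrib mult.assoc[symmetric] power_Suc2)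
       (simp add: algebra_simps)
  then show ?case
    by (simp only: sum.lessThan_Suc Suc[symmetric]) (simp add: algebra_simps)
qed

text \<open>The general commutator pairs each \<open>BB\<close> with one whose indices are lower by \<open>m\<close>, and such a difference telescopes
into values of \<open>U\<close>.\<close>

lemma BB_diagonal_commutator:
  assumes "\<And>j. j \<in> {r, r + 1} \<Longrightarrow> h * B j - B j * h = c *\<^sub>q (B (j + int m) - C ^ m * B (j - int m))"
  shows "h * BB B r r - BB B r r * h
    = (2 * c) *\<^sub>q (\<Sum>i<m. C ^ i * U (r - int i) (r + int m - int i))"
proof -
  have "h * BB B r r - BB B r r * h
      = c *\<^sub>q (BB B (r + int m) r + BB B r (r + int m)
               - C ^ m * BB B (r - int m) r - C ^ m * BB B r (r - int m))"
    by (rule BB_commutator) (use assms central_power[OF central_C] in auto)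
  also have "\<dots> = c *\<^sub>q ((BB B r (r + int m) - C ^ m * BB B (r - int m) r)
              + (BB B r (r + int m) - C ^ m * BB B (r - int m) r))"
    by (simp add: BB_commute[of B "r + int m" r] BB_commute[of B r "r - int m"] algebra_simps)
  also have "BB B r (r + int m) - C ^ m * BB B (r - int m) r
      = (\<Sum>i<m. C ^ i * U (r - int i) (r + int m - int i))"
    using telescope_U[of r "r + int m" m] by simp
  finally show ?thesis
    by (simp only: qscale_linear mult_2 distrib_right)
qed

lemma BB_step: "U (r + 1) (s + 1) = 0 \<Longrightarrow> BB B (r + 1) (s + 1) = C * BB B r s"
  by (simp add: U_def)

lemma BB_step_down: "U r s = 0 \<Longrightarrow> BB B (r - 1) (s - 1) = Ci * BB B r s"
  by (simp add: U_def)

text \<open>For constant diagonals the vanishing of \<open>BB_move\<close> is a commutation rule between neighbouring \<open>\<Theta>\<close>'s and the \<open>B r\<close>.\<close>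

lemma BB_commutes_with_B:
  assumes "BB_move B a b c = 0" and "U (a + 1) (b + 1) = 0"
  defines "G \<equiv> BB B (a + 1) b + BB B a (b + 1)"
  shows "pv *\<^sub>q (G * B (c + 1) - B (c + 1) * G)
    = BB B a b * B (c + 2) - (pv * pv) *\<^sub>q (B (c + 2) * BB B a b)
      + C * ((pv * pv) *\<^sub>q (BB B a b * B c) - B c * BB B a b)"
  using assms(1) unfolding BB_move_def G_def[symmetric] BB_step[OF assms(2)]
  by (simp add: algebra_simps qscale_linear central_left_commute[OF central_C, of "B c"])

text \<open>The combination \<open>h\<close> is a multiple of \<open>H\<^sub>2 = \<Theta>\<^sub>2 - (v - v\<^sup>-\<^sup>1) \<Theta>\<^sub>1\<^sup>2 / 2\<close> up to a central summand, when
\<open>v\<^sup>2 g\<close> is \<open>\<Theta>\<^sub>2\<close> up to a central summand. The square of \<open>t\<close> absorbs the products \<open>t * B\<close> in the rule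
for \<open>g\<close>, and the coefficient that remains is \<open>[4]\<close>.\<close>

lemma quadratic_commutator:
  assumes "g * B j - B j * g = t * B (j + 1) - (pv * pv) *\<^sub>q (B (j + 1) * t)
      + C * ((pv * pv) *\<^sub>q (t * B (j - 1)) - B (j - 1) * t)"
  defines "h \<equiv> (v * v) *\<^sub>q (g + g) - (v - vi) *\<^sub>q (t * t)"
  shows "h * B j - B j * h
    = ((v * v + vi * vi) * (v + vi)) *\<^sub>q (B (j + 2) - C ^ 2 * B (j - 2))"
proof -
  have tB: "t * B r = B r * t + (v + vi) *\<^sub>q (B (r + 1) - C * B (r - 1))" for r
    using t_B[of r] by (simp add: algebra_simps qint_2)
  have tB': "t * (B r * x) = B r * (t * x) + (v + vi) *\<^sub>q (B (r + 1) * x - C * (B (r - 1) * x))" for r x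
    using arg_cong[where f="\<lambda>y. y * x", OF tB[of r]] by (simp add: algebra_simps qscale_linear)
  have g: "g * B j = B j * g + t * B (j + 1) - (pv * pv) *\<^sub>q (B (j + 1) * t)
      + C * ((pv * pv) *\<^sub>q (t * B (j - 1)) - B (j - 1) * t)"
    using assms(1) by (simp add: algebra_simps)
  show ?thesis
    unfolding h_def power2_eq_square
    by (simp add: g tB tB' algebra_simps qscale_linear central_left_commute[OF central_C, of t]
        central_left_commute[OF central_C, of "B _"] centralD[OF central_C, of "B _"] )
qed

end

context shift_data
begin

section \<open>Propagation along the diagonal\<close>

lemma U_adjacent: "t * BB B r r = BB B r r * t \<Longrightarrow> U r (r + 1) = 0"
  using t_BB[of r r] U_commute[of "r + 1" r] qint_2_nonzero
  by (simp add: qs.scale_eq_0_iff flip: qscale_add_left mult_2[where 'a=qv] qs.scale_left_distrib)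
     (metis one_add_one qs.scale_eq_0_iff qscale_add_left qscale_one zero_neq_numeral)

text \<open>An element that commutes with \<open>t\<close> and acts correctly on \<open>B j\<close> acts correctly on \<open>B (j + 1) - C * B (j - 1)\<close>,
because that difference is the image of \<open>B j\<close> under the derivation of \<open>t\<close>.\<close>

lemma shift_commutator:
  fixes c :: qv and m :: int
  assumes ht: "h * t = t * h" and D: "central D"
  defines "e \<equiv> \<lambda>r. h * B r - B r * h - c *\<^sub>q (B (r + m) - D * B (r - m))"
  assumes j: "e j = 0"
  shows "e (j + 1) = C * e (j - 1)"
proof -
  have D1: "qint 2 *\<^sub>q (B (r + 1) - C * B (r - 1)) = t * B r - B r * t" for r
    using t_B by simp
  have "qint 2 *\<^sub>q (e (j + 1) - C * e (j - 1))
      = h * (qint 2 *\<^sub>q (B (j + 1) - C * B (j - 1))) - (qint 2 *\<^sub>q (B (j + 1) - C * B (j - 1))) * h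
        - c *\<^sub>q (qint 2 *\<^sub>q (B (j + m + 1) - C * B (j + m - 1))
            - D * (qint 2 *\<^sub>q (B (j - m + 1) - C * B (j - m - 1))))"
    by (simp add: e_def algebra_simps qscale_linear central_left_commute[OF central_C, of h]
        central_left_commute[OF central_C, of D])
  also have "\<dots> = t * e j - e j * t"
  proof -
    have "h * (t * x) = t * (h * x)" for x using ht by (simp flip: mult.assoc)
    then show ?thesis unfolding D1
      by (simp add: e_def algebra_simps qscale_linear ht central_left_commute[OF D, of t])
  qed
  also have "\<dots> = 0" using j by simp
  finally show ?thesis
    using qint_2_nonzero by (simp add: qs.scale_eq_0_iff)
qed

text \<open>Here \<open>h\<close> is the multiple of \<open>H\<^sub>2\<close> built around the place \<open>a\<close>; its bracket with \<open>BB B a a\<close> is computed once from its action on the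
sequence and once from \<open>BB B a a = J * t\<close>, and the comparison gives \<open>[h, t] = 0\<close>. Then \<open>h\<close> acts correctly at the
two places next to \<open>a\<close> and \<open>a + 1\<close> as well, and the brackets of \<open>h\<close> and \<open>t\<close> with the neighbouring \<open>BB\<close>'s yield the
next diagonal values of \<open>U\<close>.\<close>

lemma diagonal_propagates:
  assumes J: "central J" "J * Ji = 1" and Q: "BB B a a = J * t"
    and U0: "U a a = 0" and U1: "U (a + 1) (a + 1) = 0"
  shows "U (a + 2) (a + 2) = 0" and "U (a - 1) (a - 1) = 0"
proof -
  have up: "BB B (a + 1) (a + 1) = C * BB B a a"
    using BB_step[OF U1] .
  have down: "BB B (a - 1) (a - 1) = Ci * BB B a a"
    using BB_step_down[OF U0] .
  have "t * BB B a a = BB B a a * t"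
    unfolding Q by (simp add: mult.assoc central_left_commute[OF J(1)])
  then have V: "U a (a + 1) = 0" "U (a + 1) (a + 2) = 0" "U (a - 1) a = 0"
    using U_adjacent[of a] U_adjacent[of "a + 1"] U_adjacent[of "a - 1"]
    by (simp_all add: add.commute[of 2 a] up down mult.assoc central_left_commute[OF central_C] central_left_commute[OF central_Ci])
  define G where "G = BB B a (a + 1)"
  have G_up: "BB B (a + 1) (a + 2) = C * G"
    using BB_step[of a "a + 1"] V(2) by (simp add: G_def add.commute[of 2 a])
  have G_down: "BB B (a - 1) a = Ci * G"
    using BB_step_down[of a "a + 1"] V(1) by (simp add: G_def)
  have Ji_J: "Ji * (J * x) = x" "J * (Ji * x) = x" for x
    using J centralD[OF J(1)] by (metis mult.assoc mult_1)+
  have Ji: "central Ji"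
    using central_inverse J .
  (* normalised so that g commutes with B j like a multiple of Theta_2, without the factor J *)
  define g where "g = pv *\<^sub>q (Ji * (G + G))"
  have g_B: "g * B j - B j * g = t * B (j + 1) - (pv * pv) *\<^sub>q (B (j + 1) * t)
      + C * ((pv * pv) *\<^sub>q (t * B (j - 1)) - B (j - 1) * t)" if "j \<in> {a, a + 1}" for j
  proof -
    have *: "pv *\<^sub>q ((G + G) * B j - B j * (G + G)) = J * (t * B (j + 1) - (pv * pv) *\<^sub>q (B (j + 1) * t)
      + C * ((pv * pv) *\<^sub>q (t * B (j - 1)) - B (j - 1) * t))"
    proof (cases "j = a")
      case True
      have "pv *\<^sub>q ((Ci * G + Ci * G) * B j - B j * (Ci * G + Ci * G))
        = Ci * J * (t * B (j + 1) - (pv * pv) *\<^sub>q (B (j + 1) * t)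
          + C * ((pv * pv) *\<^sub>q (t * B (j - 1)) - B (j - 1) * t))"
        using BB_commutes_with_B[OF BB_move_diagonal, of "a - 1"] U0 True
          BB_commute[of B "a" "a - 1"]
        by (simp add: G_down down Q algebra_simps qscale_linear central_left_commute[OF central_Ci, of "B _"]
            central_left_commute[OF J(1), of "B _"] central_left_commute[OF central_C, of Ci]
            central_left_commute[OF central_C, of J])
      then have "C * (pv *\<^sub>q ((Ci * G + Ci * G) * B j - B j * (Ci * G + Ci * G)))
        = C * (Ci * J * (t * B (j + 1) - (pv * pv) *\<^sub>q (B (j + 1) * t)
          + C * ((pv * pv) *\<^sub>q (t * B (j - 1)) - B (j - 1) * t)))" by simp
      then show ?thesis
        by (simp add: algebra_simps qscale_linear central_left_commute[OF central_C, of "B _"]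
            central_left_commute[OF central_Ci, of "B _"])
    next
      case False
      then show ?thesis
        using BB_commutes_with_B[OF BB_move_diagonal, of "a"] U1 that BB_commute[of B "a + 1" "a"]
        by (simp add: G_def Q algebra_simps qscale_linear central_left_commute[OF J(1), of "B _"]
            central_left_commute[OF central_C, of J])
    qed
    have "g * B j - B j * g = Ji * (pv *\<^sub>q ((G + G) * B j - B j * (G + G)))"
      by (simp only: g_def distrib_right distrib_left qscale_linear right_diff_distrib mult.assoc
          central_left_commute[OF Ji, of "B _"])
    then show ?thesis unfolding * Ji_J .
  qed
  define h where "h = (v * v) *\<^sub>q (g + g) - (v - vi) *\<^sub>q (t * t)"
  define c where "c = (v * v + vi * vi) * (v + vi)"
  have h_B: "h * B j - B j * h = c *\<^sub>q (B (j + int 2) - C ^ 2 * B (j - int 2))"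
    if "j \<in> {a, a + 1}" for j
    using quadratic_commutator[OF g_B[OF that]] by (simp add: h_def c_def)
  have h_BB: "h * BB B r r - BB B r r * h = (2 * c) *\<^sub>q (U r (r + 2) + C * U (r - 1) (r + 1))"
    if "\<And>j. j \<in> {r, r + 1} \<Longrightarrow> h * B j - B j * h = c *\<^sub>q (B (j + int 2) - C ^ 2 * B (j - int 2))" for r
    using BB_diagonal_commutator[where m = 2 and h = h and c = c, OF that]
    by (simp add: numeral_2_eq_2 add.commute[of 1 r])
  define u where "u = U a (a + 2)"
  have t_G: "t * G - G * t = qint 2 *\<^sub>q u"
    using t_BB[of a "a + 1"] U1 by (simp add: G_def u_def add.commute[of 2 a])
  have "t * (Ci * G) - (Ci * G) * t = qint 2 *\<^sub>q U (a - 1) (a + 1)"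
    using t_BB[of "a - 1" "a"] U0 by (simp add: G_down)
  then have "Ci * (qint 2 *\<^sub>q u) = qint 2 *\<^sub>q U (a - 1) (a + 1)"
    by (simp add: t_G[symmetric] right_diff_distrib mult.assoc central_left_commute[OF central_Ci, of t])
  then have "U (a - 1) (a + 1) = Ci * u"
    using qint_2_nonzero by (simp add: qscale_mult_right)
  (* the bracket of h with BB B a a, from the action of h on the sequence *)
  then have "h * BB B a a - BB B a a * h = (2 * c) *\<^sub>q (u + u)"
    using h_BB[of a] h_B by (simp add: u_def)
  (* the same bracket, from BB B a a = J * t and the bracket of t with G *)
  moreover have "h * BB B a a - BB B a a * h
      = - (qint 2 *\<^sub>q u + qint 2 *\<^sub>q u + qint 2 *\<^sub>q u + qint 2 *\<^sub>q u)"
  proof -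
    have X: "Ji * (G * t) - Ji * (t * G) = - (Ji * (qint 2 *\<^sub>q u))"
      unfolding t_G[symmetric] by (simp add: algebra_simps)
    have "h * t - t * h = (Ji * (G * t) - Ji * (t * G)) + (Ji * (G * t) - Ji * (t * G))
        + (Ji * (G * t) - Ji * (t * G)) + (Ji * (G * t) - Ji * (t * G))"
      by (simp add: h_def g_def algebra_simps qscale_linear central_left_commute[OF Ji, of t])
    then have "J * (h * t - t * h) = - (qint 2 *\<^sub>q u + qint 2 *\<^sub>q u + qint 2 *\<^sub>q u + qint 2 *\<^sub>q u)"
      unfolding X by (simp add: distrib_left right_diff_distrib Ji_J)
    then show ?thesis
      by (simp add: Q right_diff_distrib mult.assoc central_left_commute[OF J(1), of h])
  qed
  ultimately have "(2 * c) *\<^sub>q (u + u) + (qint 2 *\<^sub>q u + qint 2 *\<^sub>q u + qint 2 *\<^sub>q u + qint 2 *\<^sub>q u) = 0"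
    by (metis add.left_inverse add.commute)
  then have "(4 * (c + qint 2)) *\<^sub>q u = 0"
    by (simp only: qscale_add_right flip: qscale_add_left) (simp add: algebra_simps)
  moreover have "c + qint 2 \<noteq> 0"
  proof
    assume "c + qint 2 = 0"
    then have "(v - vi) * (c + qint 2) = 0" by simp
    moreover have "(v - vi) * (c + qint 2) = cv 2 + cv 1"
      by (simp add: c_def qint_2 cv_def algebra_simps power2_eq_square eval_nat_numeral)
    ultimately show False using cv_add_cv1_nonzero[of 2] by simp
  qed
  ultimately have u: "u = 0" by (simp add: qs.scale_eq_0_iff)
  have tG: "t * G = G * t" using t_G u by simp
  then have "t * g = g * t"
    by (simp add: g_def qscale_linear algebra_simps central_left_commute[OF Ji, of t])
  then have ht: "h * t = t * h"
    by (simp add: h_def algebra_simps qscale_linear)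
  note C2 = central_power[OF central_C, of 2]
  (* e measures the failure of h to act correctly; it vanishes at a and a + 1 *)
  define e where "e r = h * B r - B r * h - c *\<^sub>q (B (r + int 2) - C ^ 2 * B (r - int 2))" for r
  have e: "e a = 0" "e (a + 1) = 0"
    using h_B by (simp_all add: e_def)
  have e_step: "e (j + 1) = C * e (j - 1)" if "e j = 0" for j
    unfolding e_def by (rule shift_commutator[OF ht C2 that[unfolded e_def]])
  have e': "e (a + 2) = 0" "e (a - 1) = 0"
    using e_step[of "a + 1"] e_step[of a] e by (simp_all add: add.commute[of 2 a])
  have h_B2: "h * B j - B j * h = c *\<^sub>q (B (j + int 2) - C ^ 2 * B (j - int 2))"
    if "j \<in> {a - 1, a, a + 1, a + 2}" for j
  proof -
    have "e j = 0" using that e e' by auto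
    then show ?thesis by (simp add: e_def)
  qed
  have "(v - vi) * c = cv 2"
    by (simp add: c_def cv_def algebra_simps power2_eq_square eval_nat_numeral)
  then have c0: "c \<noteq> 0" using cv_nonzero[of 2] by auto
  have comm: "h * BB B r r = BB B r r * h" if "r \<in> {a - 1, a + 1}" for r
    using that up down ht
    by (auto simp: Q mult.assoc central_left_commute[OF J(1), of h]
        central_left_commute[OF central_C, of h] central_left_commute[OF central_Ci, of h])
  show "U (a + 2) (a + 2) = 0"
  proof -
    have "U (a + 1) (a + 3) + C * U a (a + 2) = 0"
    proof -
      have "h * BB B (a + 1) (a + 1) - BB B (a + 1) (a + 1) * h
          = (2 * c) *\<^sub>q (U (a + 1) (a + 1 + 2) + C * U (a + 1 - 1) (a + 1 + 1))"
        by (rule h_BB, rule h_B2) auto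
      moreover have "a + 1 + 2 = a + 3" "a + 1 - 1 = a" "a + 1 + 1 = a + 2" by simp_all
      ultimately show ?thesis
        using comm[of "a + 1"] c0 by (simp only:) (simp add: qs.scale_eq_0_iff)
    qed
    then have "U (a + 1) (a + 3) = 0" using u by (simp add: u_def)
    moreover have "t * (C * G) - C * G * t = 0"
      using tG by (simp add: mult.assoc central_left_commute[OF central_C, of t])
    ultimately show ?thesis
      using t_BB[of "a + 1" "a + 2"] qint_2_nonzero
      by (simp add: G_up qs.scale_eq_0_iff add.commute[of 2 a] add.commute[of 3 a])
  qed
  show "U (a - 1) (a - 1) = 0"
  proof -
    have "U (a - 1) (a + 1) + C * U (a - 2) a = 0"
    proof -
      have "h * BB B (a - 1) (a - 1) - BB B (a - 1) (a - 1) * h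
          = (2 * c) *\<^sub>q (U (a - 1) (a - 1 + 2) + C * U (a - 1 - 1) (a - 1 + 1))"
        by (rule h_BB, rule h_B2) auto
      moreover have "a - 1 + 2 = a + 1" "a - 1 - 1 = a - 2" "a - 1 + 1 = a" by simp_all
      ultimately show ?thesis
        using comm[of "a - 1"] c0 by (simp only:) (simp add: qs.scale_eq_0_iff)
    qed
    then have "U (a - 2) a = 0" using u \<open>U (a - 1) (a + 1) = Ci * u\<close> by simp
    moreover have "BB B (a - 2) (a - 1) = Ci * (Ci * G)"
      using BB_step_down[of "a - 1" a] V(3) by (simp add: G_down)
    moreover have "t * (Ci * (Ci * G)) - Ci * (Ci * G) * t = 0"
      using tG by (simp add: mult.assoc central_left_commute[OF central_Ci, of t])
    ultimately show ?thesis
      using t_BB[of "a - 2" "a - 1"] qint_2_nonzero by (simp add: qs.scale_eq_0_iff)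
  qed
qed

text \<open>Iterating in both directions needs the proportionality of \<open>BB B r r\<close> and \<open>t\<close> to be carried along; the factor changes
by \<open>C\<close> at each step.\<close>

lemma all_diagonals:
  assumes "central J" "J * Ji = 1" "BB B a a = J * t" "U a a = 0" "U (a + 1) (a + 1) = 0"
  shows "U r r = 0"
proof -
  define P where "P r \<longleftrightarrow> U r r = 0 \<and> U (r + 1) (r + 1) = 0
    \<and> (\<exists>J Ji. central J \<and> J * Ji = 1 \<and> BB B r r = J * t)" for r
  have P_step: "P (r + 1) \<and> P (r - 1)" if "P r" for r
  proof -
    from that obtain J Ji where J: "central J" "J * Ji = 1" "BB B r r = J * t"
      and U: "U r r = 0" "U (r + 1) (r + 1) = 0"
      unfolding P_def by auto
    have Ji_J: "J * (Ji * x) = x" for x using J(2) by (simp flip: mult.assoc)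
    have "C * J * (Ji * Ci) = 1" "Ci * J * (Ji * C) = 1"
      using C_Ci Ci_C by (simp_all add: mult.assoc Ji_J)
    moreover have "BB B (r + 1) (r + 1) = C * J * t"
      using BB_step[OF U(2)] J(3) by (simp add: mult.assoc)
    moreover have "BB B (r - 1) (r - 1) = Ci * J * t"
      using BB_step_down[OF U(1)] J(3) by (simp add: mult.assoc)
    moreover have "U (r + 2) (r + 2) = 0" "U (r - 1) (r - 1) = 0"
      using diagonal_propagates[OF J U] by simp_all
    ultimately show ?thesis
      unfolding P_def using U J(1) central_mult[OF central_C] central_mult[OF central_Ci]
      by (auto simp: add.commute[of 2 r])
  qed
  have "P a" using assms unfolding P_def by blast
  then have "P r" by (induction r rule: int_induct[of _ a]) (use P_step in auto)
  then show ?thesis by (simp add: P_def)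
qed

end

section \<open>Logarithmic derivatives\<close>

lemma qscale_2: "2 *\<^sub>q x = x + x"
  using qscale_add_left[of 1 1 x] by simp

text \<open>The coefficients of \<open>(z \<theta>'(z)) \<theta>(z)\<^sup>-\<^sup>1\<close> for the series \<open>\<theta>(z)\<close> with coefficients \<open>th\<close>. With the derivative to the
left of the inverse, the recursion makes sense for coefficients that do not commute, which matters because
commutativity of the \<open>\<Theta>\<close>'s is a consequence of the argument and cannot be used in it.\<close>

fun log_derivative :: "(int \<Rightarrow> 'a::qv_algebra) \<Rightarrow> nat \<Rightarrow> 'a" where
  "log_derivative th k = of_nat k *\<^sub>q th (int k)
     - (\<Sum>j\<in>{1..<k}. log_derivative th j * th (int k - int j))"

declare log_derivative.simps [simp del]

lemma log_derivative_recursion: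
  assumes "th 0 = 1" and neg: "\<And>m. m < 0 \<Longrightarrow> th m = 0" and "m \<le> int k"
  shows "of_int m *\<^sub>q th m = (\<Sum>j=1..k. log_derivative th j * th (m - int j))"
proof (cases "m \<le> 0")
  case True
  then have "(\<Sum>j=1..k. log_derivative th j * th (m - int j)) = 0"
    by (intro sum.neutral) (simp add: neg)
  then show ?thesis using True neg[of m] by (cases "m = 0") simp_all
next
  case False
  define n where "n = nat m"
  have n: "m = int n" "0 < n" "n \<le> k" using False assms(3) by (simp_all add: n_def)
  have "(\<Sum>j=1..k. log_derivative th j * th (m - int j)) = (\<Sum>j=1..n. log_derivative th j * th (m - int j))"
    by (rule sum.mono_neutral_right) (use n neg in auto)
  also have "\<dots> = (\<Sum>j\<in>{1..<n}. log_derivative th j * th (m - int j)) + log_derivative th n * th (m - int n)"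
  proof -
    have "{1..n} = insert n {1..<n}" using n by auto
    then show ?thesis by (simp add: add.commute)
  qed
  also have "\<dots> = of_int m *\<^sub>q th m"
    using n assms(1) by (simp add: log_derivative.simps[of th n])
  finally show ?thesis by simp
qed

lemma diff_eq_diff: "a + x = s + y \<Longrightarrow> a - s = y - x" for a :: "'a::ab_group_add"
  by (metis add.commute add_diff_cancel add_diff_eq diff_diff_eq2)

lemma sum_telescope_1: "(\<Sum>j=1..k. f j - f (Suc j)) = f 1 - f (Suc k)" for f :: "nat \<Rightarrow> 'a::ab_group_add"
  by (induction k) simp_all

text \<open>With \<open>S\<close> the shift of the sequence, the assumption \<open>th_B\<close> reads
\<open>\<theta>(z) (1 - v\<^sup>2 z S)(1 - v\<^sup>-\<^sup>2 C z S\<^sup>-\<^sup>1) B = ((1 - v\<^sup>-\<^sup>2 z S)(1 - v\<^sup>2 C z S\<^sup>-\<^sup>1) B) \<theta>(z)\<close>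
modulo powers of \<open>z\<close> above \<open>N\<close>. The truncation is essential: in the induction the relation is known only up to some
degree.\<close>

locale theta_shift =
  fixes B th :: "int \<Rightarrow> 'a::qv_algebra" and C :: 'a and N :: nat
  assumes central_C: "central C" and th_0: "th 0 = 1" and th_neg: "\<And>m. m < 0 \<Longrightarrow> th m = 0"
    and th_B: "\<And>k r. k \<le> int N \<Longrightarrow>
      th k * B r + C * (th (k - 2) * B r) - (v * v) *\<^sub>q (th (k - 1) * B (r + 1))
        - pv *\<^sub>q (C * (th (k - 1) * B (r - 1)))
      = B r * th k + C * (B r * th (k - 2)) - pv *\<^sub>q (B (r + 1) * th (k - 1))
        - (v * v) *\<^sub>q (C * (B (r - 1) * th (k - 1)))"
begin

definition twist_left where "twist_left k r = th k * B r + C * (th (k - 2) * B r) - (v * v) *\<^sub>q (th (k - 1) * B (r + 1))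
        - pv *\<^sub>q (C * (th (k - 1) * B (r - 1)))"
definition twist_right where "twist_right k r = B r * th k + C * (B r * th (k - 2)) - pv *\<^sub>q (B (r + 1) * th (k - 1))
        - (v * v) *\<^sub>q (C * (B (r - 1) * th (k - 1)))"

lemma twist_left_right: "k \<le> int N \<Longrightarrow> twist_left k r = twist_right k r"
  using th_B by (simp add: twist_left_def twist_right_def)

abbreviation hh where "hh \<equiv> log_derivative th"

lemmas C_comm = central_left_commute[OF central_C]
lemmas Cp_comm = central_left_commute[OF central_power[OF central_C]]
lemma hh_rec: "m \<le> int k \<Longrightarrow> of_int m *\<^sub>q th m = (\<Sum>j=1..k. hh j * th (m - int j))"
  by (rule log_derivative_recursion) (simp_all add: th_0 th_neg)

text \<open>The four telescoping sums multiply one side of the functional equation by the geometric series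
\<open>\<alpha> z S / (1 - \<alpha> z S)\<close> of one of its four linear factors; up to sign the product is the derivative of that factor times
the complementary one.\<close>

lemma telescope_LU: "(\<Sum>j=1..k. (v * v) ^ j *\<^sub>q twist_left (int k - int j) (r + int j))
  = (v * v) *\<^sub>q (th (int k - 1) * B (r + 1)) - C * (th (int k - 2) * B r)"
proof -
  define F where "F j = (v * v) ^ j *\<^sub>q (th (int k - int j) * B (r + int j))
     - ((v * v) ^ j * pv) *\<^sub>q (C * (th (int k - int j - 1) * B (r + int j - 1)))" for j
  have "(v * v) ^ j *\<^sub>q twist_left (int k - int j) (r + int j) = F j - F (Suc j)" for j
    by (simp add: twist_left_def F_def algebra_simps qscale_linear)
  then have "(\<Sum>j=1..k. (v * v) ^ j *\<^sub>q twist_left (int k - int j) (r + int j)) = F 1 - F (Suc k)"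
    by (simp only: sum_telescope_1)
  also have "F (Suc k) = 0" by (simp add: F_def th_neg)
  finally show ?thesis by (simp add: F_def algebra_simps)
qed

lemma telescope_LD: "(\<Sum>j=1..k. pv ^ j *\<^sub>q (C ^ j * twist_left (int k - int j) (r - int j)))
  = pv *\<^sub>q (C * (th (int k - 1) * B (r - 1))) - C * (th (int k - 2) * B r)"
proof -
  define F where "F j = pv ^ j *\<^sub>q (C ^ j * (th (int k - int j) * B (r - int j)))
     - (pv ^ j * (v * v)) *\<^sub>q (C ^ j * (th (int k - int j - 1) * B (r - int j + 1)))" for j
  have "pv ^ j *\<^sub>q (C ^ j * twist_left (int k - int j) (r - int j)) = F j - F (Suc j)" for j
    by (simp add: twist_left_def F_def algebra_simps qscale_linear Cp_comm[of C])
  then have "(\<Sum>j=1..k. pv ^ j *\<^sub>q (C ^ j * twist_left (int k - int j) (r - int j))) = F 1 - F (Suc k)"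
    by (simp only: sum_telescope_1)
  also have "F (Suc k) = 0" by (simp add: F_def th_neg)
  finally show ?thesis by (simp add: F_def algebra_simps)
qed

lemma telescope_RU: "(\<Sum>j=1..k. pv ^ j *\<^sub>q twist_right (int k - int j) (r + int j))
  = pv *\<^sub>q (B (r + 1) * th (int k - 1)) - C * (B r * th (int k - 2))"
proof -
  define F where "F j = pv ^ j *\<^sub>q (B (r + int j) * th (int k - int j))
     - (pv ^ j * (v * v)) *\<^sub>q (C * (B (r + int j - 1) * th (int k - int j - 1)))" for j
  have "pv ^ j *\<^sub>q twist_right (int k - int j) (r + int j) = F j - F (Suc j)" for j
    by (simp add: twist_right_def F_def algebra_simps qscale_linear)
  then have "(\<Sum>j=1..k. pv ^ j *\<^sub>q twist_right (int k - int j) (r + int j)) = F 1 - F (Suc k)"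
    by (simp only: sum_telescope_1)
  also have "F (Suc k) = 0" by (simp add: F_def th_neg)
  finally show ?thesis by (simp add: F_def algebra_simps)
qed

lemma telescope_RD: "(\<Sum>j=1..k. (v * v) ^ j *\<^sub>q (C ^ j * twist_right (int k - int j) (r - int j)))
  = (v * v) *\<^sub>q (C * (B (r - 1) * th (int k - 1))) - C * (B r * th (int k - 2))"
proof -
  define F where "F j = (v * v) ^ j *\<^sub>q (C ^ j * (B (r - int j) * th (int k - int j)))
     - ((v * v) ^ j * pv) *\<^sub>q (C ^ j * (B (r - int j + 1) * th (int k - int j - 1)))" for j
  have "(v * v) ^ j *\<^sub>q (C ^ j * twist_right (int k - int j) (r - int j)) = F j - F (Suc j)" for j
    by (simp add: twist_right_def F_def algebra_simps qscale_linear Cp_comm[of C])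
  then have "(\<Sum>j=1..k. (v * v) ^ j *\<^sub>q (C ^ j * twist_right (int k - int j) (r - int j))) = F 1 - F (Suc k)"
    by (simp only: sum_telescope_1)
  also have "F (Suc k) = 0" by (simp add: F_def th_neg)
  finally show ?thesis by (simp add: F_def algebra_simps)
qed

text \<open>The coefficient of \<open>z\<^sup>k\<close> in \<open>((1 - v\<^sup>-\<^sup>2 z S)(1 - v\<^sup>2 C z S\<^sup>-\<^sup>1) A(z)) \<theta>(z)\<close>, where the second argument of \<open>A\<close>
is the offset of the index.\<close>

definition twist_sum where
  "twist_sum k A = (\<Sum>j=1..k. A j (0::int) * th (int k - int j) + C * (A j 0 * th (int k - 2 - int j))
      - pv *\<^sub>q (A j 1 * th (int k - 1 - int j)) - (v * v) *\<^sub>q (C * (A j (-1) * th (int k - 1 - int j))))"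

lemma twist_sum_diff:
  "twist_sum k (\<lambda>j i. A j i - A' j i) = twist_sum k A - twist_sum k A'"
  unfolding twist_sum_def sum_subtractf[symmetric]
  by (rule sum.cong) (simp_all add: algebra_simps qscale_linear)

text \<open>The coefficient of \<open>z\<^sup>k\<close> in what remains of the Euler derivative of the functional equation when the terms
containing the derivative of \<open>\<theta>\<close> are removed, right side minus left side.\<close>

definition defect where
  "defect k r = 2 *\<^sub>q (C * (B r * th (int k - 2))) - pv *\<^sub>q (B (r + 1) * th (int k - 1))
        - (v * v) *\<^sub>q (C * (B (r - 1) * th (int k - 1)))
      - (2 *\<^sub>q (C * (th (int k - 2) * B r)) - (v * v) *\<^sub>q (th (int k - 1) * B (r + 1))
        - pv *\<^sub>q (C * (th (int k - 1) * B (r - 1))))"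

text \<open>The expected action of the logarithmic derivative produces the defect: it is the difference of the logarithmic
derivatives of the linear factors on the two sides of the functional equation, and each half is summed with the side
on which it telescopes.\<close>

lemma twist_shift:
  assumes "k \<le> N"
  shows "twist_sum k (\<lambda>j i. cv j *\<^sub>q (B (r + i + int j) - C ^ j * B (r + i - int j))) = defect k r"
proof -
  have cv: "cv j = (v * v) ^ j - pv ^ j" for j
    by (simp add: cv_def power_mult power2_eq_square)
  have "twist_sum k (\<lambda>j i. cv j *\<^sub>q (B (r + i + int j) - C ^ j * B (r + i - int j)))
     = (\<Sum>j=1..k. cv j *\<^sub>q (twist_right (int k - int j) (r + int j) - C ^ j * twist_right (int k - int j) (r - int j)))"
    unfolding twist_sum_def twist_right_def
    by (rule sum.cong)
      (simp_all add: algebra_simps qscale_linear Cp_comm[of C])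
  also have "\<dots> = (\<Sum>j=1..k. (v * v) ^ j *\<^sub>q twist_left (int k - int j) (r + int j)
        + pv ^ j *\<^sub>q (C ^ j * twist_left (int k - int j) (r - int j))
        - pv ^ j *\<^sub>q twist_right (int k - int j) (r + int j)
        - (v * v) ^ j *\<^sub>q (C ^ j * twist_right (int k - int j) (r - int j)))"
    using assms by (intro sum.cong) (simp_all add: twist_left_right cv algebra_simps qscale_linear)
  also have "\<dots> = defect k r"
    unfolding sum.distrib sum_subtractf telescope_LU telescope_LD telescope_RU telescope_RD defect_def
    by (simp add: algebra_simps qscale_linear qscale_2)
  finally show ?thesis .
qed

text \<open>The actual commutators produce the same defect: apply the Euler derivative to both sides of the functional equation and
subtract the equation multiplied on the left by the logarithmic derivative.\<close>

lemma twist_commutator: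
  assumes "k \<le> N"
  shows "twist_sum k (\<lambda>j i. hh j * B (r + i) - B (r + i) * hh j) = defect k r"
proof -
  define S where "S m x y = (\<Sum>j=1..k. x * (hh j * (th (m - int j) * y)))" for m :: int and x y :: 'a
  have S: "of_int m *\<^sub>q (x * (th m * y)) = S m x y" if "m \<le> int k" for m x y
  proof -
    have "of_int m *\<^sub>q (x * (th m * y)) = x * ((of_int m *\<^sub>q th m) * y)" by (simp add: qscale_linear)
    also have "\<dots> = S m x y"
      unfolding S_def hh_rec[OF that] by (simp add: sum_distrib_left sum_distrib_right mult.assoc)
    finally show ?thesis .
  qed
  have L: "of_nat k *\<^sub>q twist_left (int k) r = (\<Sum>j=1..k. hh j * twist_left (int k - int j) r)
      + (2 *\<^sub>q (C * (th (int k - 2) * B r)) - (v * v) *\<^sub>q (th (int k - 1) * B (r + 1))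
        - pv *\<^sub>q (C * (th (int k - 1) * B (r - 1))))"
  proof -
    have "(\<Sum>j=1..k. hh j * twist_left (int k - int j) r)
       = S (int k) 1 (B r) + C * S (int k - 2) 1 (B r) - (v * v) *\<^sub>q S (int k - 1) 1 (B (r + 1))
        - pv *\<^sub>q (C * S (int k - 1) 1 (B (r - 1)))"
      unfolding S_def twist_left_def sum_distrib_left qs.scale_sum_right sum.distrib[symmetric] sum_subtractf[symmetric]
      by (rule sum.cong) (simp_all add: algebra_simps qscale_linear C_comm[of "hh _"])
    also have "\<dots> = of_int (int k) *\<^sub>q (th (int k) * B r) + of_int (int k - 2) *\<^sub>q (C * (th (int k - 2) * B r))
       - ((v * v) * of_int (int k - 1)) *\<^sub>q (th (int k - 1) * B (r + 1))
        - (pv * of_int (int k - 1)) *\<^sub>q (C * (th (int k - 1) * B (r - 1)))"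
      by (simp add: S[symmetric] algebra_simps qscale_linear)
    finally show ?thesis by (simp add: twist_left_def algebra_simps qscale_linear qscale_2)
  qed
  have R: "of_nat k *\<^sub>q twist_right (int k) r = (\<Sum>j=1..k. B r * (hh j * th (int k - int j))
        + C * (B r * (hh j * th (int k - 2 - int j)))
      - pv *\<^sub>q (B (r + 1) * (hh j * th (int k - 1 - int j)))
      - (v * v) *\<^sub>q (C * (B (r - 1) * (hh j * th (int k - 1 - int j)))))
      + (2 *\<^sub>q (C * (B r * th (int k - 2))) - pv *\<^sub>q (B (r + 1) * th (int k - 1))
        - (v * v) *\<^sub>q (C * (B (r - 1) * th (int k - 1))))" (is "_ = ?S + _")
  proof -
    have "?S = S (int k) (B r) 1 + C * S (int k - 2) (B r) 1 - pv *\<^sub>q S (int k - 1) (B (r + 1)) 1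
        - (v * v) *\<^sub>q (C * S (int k - 1) (B (r - 1)) 1)"
      unfolding S_def sum_distrib_left qs.scale_sum_right sum.distrib[symmetric] sum_subtractf[symmetric]
      by (rule sum.cong) simp_all
    also have "\<dots> = of_int (int k) *\<^sub>q (B r * th (int k)) + of_int (int k - 2) *\<^sub>q (C * (B r * th (int k - 2)))
       - (pv * of_int (int k - 1)) *\<^sub>q (B (r + 1) * th (int k - 1))
        - ((v * v) * of_int (int k - 1)) *\<^sub>q (C * (B (r - 1) * th (int k - 1)))"
      by (simp add: S[symmetric] algebra_simps qscale_linear)
    finally show ?thesis by (simp add: twist_right_def algebra_simps qscale_linear qscale_2)
  qed
  have "twist_sum k (\<lambda>j i. hh j * B (r + i) - B (r + i) * hh j) = (\<Sum>j=1..k. hh j * twist_right (int k - int j) r) - ?S"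
    unfolding twist_sum_def twist_right_def sum_subtractf[symmetric]
    by (rule sum.cong) (simp_all add: algebra_simps qscale_linear C_comm[of "hh _"])
  also have "(\<Sum>j=1..k. hh j * twist_right (int k - int j) r) = (\<Sum>j=1..k. hh j * twist_left (int k - int j) r)"
    using assms by (intro sum.cong) (simp_all add: twist_left_right)
  also have "(\<Sum>j=1..k. hh j * twist_left (int k - int j) r) - ?S = defect k r"
    unfolding defect_def
    by (rule diff_eq_diff) (use L R twist_left_right[of "int k" r] assms in \<open>simp only: of_nat_le_iff\<close>)
  finally show ?thesis .
qed

text \<open>The difference \<open>e\<close> of the actual and the expected action has vanishing twisted sum. Since \<open>\<theta>\<close> has constant term \<open>1\<close>, the
lowest coefficient of \<open>e\<close> is isolated, and \<open>e\<close> vanishes by induction.\<close>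

theorem log_derivative_B:
  assumes "1 \<le> k" "k \<le> N"
  shows "hh k * B r - B r * hh k = cv k *\<^sub>q (B (r + int k) - C ^ k * B (r - int k))"
  using assms
proof (induction k arbitrary: r rule: less_induct)
  case (less k)
  define e where "e j i = hh j * B (r + i) - B (r + i) * hh j
      - cv j *\<^sub>q (B (r + i + int j) - C ^ j * B (r + i - int j))" for j i
  have e: "e j i = 0" if "j \<in> {1..<k}" for j i
    using less.IH[of j "r + i"] that less.prems by (simp add: e_def)
  have "twist_sum k e = 0"
    using twist_shift[OF less.prems(2), of r] twist_commutator[OF less.prems(2), of r]
    unfolding e_def twist_sum_diff by simp
  moreover have "twist_sum k e = e k 0"
  proof -
    have "{1..k} = insert k {1..<k}" using less.prems by auto
    then show ?thesis
      unfolding twist_sum_def by (simp add: e th_0 th_neg)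
  qed
  ultimately show ?case by (simp add: e_def)
qed

end

section \<open>Propagation away from the diagonal\<close>

text \<open>The assumptions on \<open>BB\<close> and \<open>U\<close> are the quadratic Drinfeld relation at the three diagonal places \<open>-2\<close>, \<open>-1\<close>, \<open>0\<close>.\<close>

locale drinfeld_data = shift_data B t C Ci
  for B :: "int \<Rightarrow> 'a::qv_algebra" and t C Ci +
  fixes K Ki :: 'a
  assumes central_K: "central K" and K_Ki: "K * Ki = 1"
    and BB_0: "BB B 0 0 = (2 * pv) *\<^sub>q (K * t)"
    and U_0: "U 0 0 = 0" and U_m1: "U (-1) (-1) = 0"
begin

lemma central_Ki: "central Ki"
  using central_inverse[OF central_K K_Ki] .

lemma Ki_K: "Ki * K = 1"
  using K_Ki centralD[OF central_K] by metis

lemma K_Ki_cancel [simp]: "K * (Ki * x) = x" "Ki * (K * x) = x"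
  using K_Ki Ki_K by (simp_all flip: mult.assoc)

lemma U_diag: "U r r = 0"
proof (rule all_diagonals[where a = "-1"])
  show "central ((2 * pv) *\<^sub>q (Ci * K))"
    using central_mult[OF central_Ci central_K] by (simp add: central_def qscale_linear)
  show "(2 * pv) *\<^sub>q (Ci * K) * inverse (2 * pv) *\<^sub>q (C * Ki) = 1"
    using v_nonzero by (simp add: qscale_linear mult.assoc central_left_commute[OF central_C, of K] K_Ki Ci_C)
  show "BB B (- 1) (- 1) = (2 * pv) *\<^sub>q (Ci * K) * t"
    using BB_step_down[of 0 0] U_0 BB_0 by (simp add: qscale_linear mult.assoc)
qed (use U_0 U_m1 in simp_all)

definition Cz :: "int \<Rightarrow> 'a" where "Cz = zpow C Ci"

lemma Cz_0 [simp]: "Cz 0 = 1"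
  by (simp add: Cz_def)

lemma Cz_Suc: "Cz (n + 1) = C * Cz n"
  unfolding Cz_def by (rule zpow_plus_1[OF central_C C_Ci])

lemma Cz_pred: "Cz (n - 1) = Ci * Cz n"
  using Cz_Suc[of "n - 1"] by simp

lemma central_Cz: "central (Cz n)"
  unfolding Cz_def by (rule central_zpow[OF central_C central_Ci])

lemma Cz_minus: "Cz (- n) * Cz n = 1"
proof (induction n rule: int_induct[of _ 0])
  case (step1 i)
  have "- (i + 1) = - i - 1" by simp
  with step1 show ?case
    by (simp only: Cz_Suc Cz_pred mult.assoc)
      (simp add: central_left_commute[OF central_C, of "Cz (- i)"] Ci_C)
next
  case (step2 i)
  have "- (i - 1) = - i + 1" by simp
  with step2 show ?case
    by (simp only: Cz_Suc Cz_pred mult.assoc)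
      (simp add: central_left_commute[OF central_Ci, of "Cz (- i)"] C_Ci)
qed simp

lemma Cz_eq_0: "Cz n * x = 0 \<Longrightarrow> x = 0"
  using Cz_minus[of n] by (metis mult.assoc mult_1 mult_zero_right)

lemma Cz_nat: "Cz (int n) = C ^ n"
  by (simp add: Cz_def zpow_def)

lemma C_power_Cz: "C ^ n * (Cz (- int n) * x) = x"
  using Cz_minus[of "- int n"] by (simp flip: mult.assoc Cz_nat)

definition vanish :: "int \<Rightarrow> bool" where
  "vanish n \<longleftrightarrow> (\<forall>r s. \<bar>s - r\<bar> \<le> n \<longrightarrow> U r s = 0)"

lemma BB_shift:
  assumes "vanish n" "\<bar>y - x\<bar> \<le> n"
  shows "BB B (x + r) (y + r) = Cz r * BB B x y"
proof (induction r rule: int_induct[of _ 0])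
  case (step1 i)
  have "U (x + i + 1) (y + i + 1) = 0" using assms by (simp add: vanish_def)
  from BB_step[OF this] show ?case using step1 by (simp only: Cz_Suc mult.assoc add.assoc)
next
  case (step2 i)
  have "U (x + i) (y + i) = 0" using assms by (simp add: vanish_def)
  from BB_step_down[OF this] have "BB B (x + i - 1) (y + i - 1) = Ci * BB B (x + i) (y + i)" .
  with step2 show ?case by (simp only: Cz_pred mult.assoc add_diff_eq)
qed simp

lemma BB_shift_0:
  assumes "vanish n" "\<bar>d\<bar> \<le> n"
  shows "BB B r (r + d) = Cz r * BB B 0 d"
  using BB_shift[of n d 0 r] assms by (simp add: add.commute)

lemma BB_move_shift:
  assumes V: "vanish n" and d: "\<bar>d\<bar> + 1 \<le> n"
  shows "BB_move B r (r + d) c = Cz r * BB_move B 0 d c"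
proof -
  have eqs: "BB B r (r + d) = Cz r * BB B 0 d"
    "BB B (r + 1) (r + d + 1) = Cz r * BB B 1 (d + 1)"
    "BB B (r + 1) (r + d) = Cz r * BB B 1 d"
    "BB B r (r + d + 1) = Cz r * BB B 0 (d + 1)"
    using BB_shift[OF V, of d 0 r] BB_shift[OF V, of "d + 1" 1 r]
      BB_shift[OF V, of d 1 r] BB_shift[OF V, of "d + 1" 0 r] d
    by (auto simp: add_ac)
  show ?thesis
    unfolding BB_move_def eqs add_0
    by (simp add: algebra_simps qscale_linear central_left_commute[OF central_Cz[of r], of "B _"])
qed

text \<open>The identities in one or two indices give the vanishing only at special places; with constant diagonals a common
shift of the first two indices multiplies \<open>BB_move\<close> by a power of \<open>C\<close>, which moves any place to a special one.\<close>

lemma BB_move_vanishes: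
  assumes V: "vanish n" and d: "\<bar>d\<bar> + 1 \<le> n"
  shows "BB_move B 0 d c = 0"
proof -
  have 0: "BB_move B r r c = 0" for r c
  proof -
    have "Cz c * BB_move B 0 0 c = 0"
      using BB_move_shift[OF V, of 0 c c] BB_move_diagonal[of B c] d by simp
    then have "BB_move B 0 0 c = 0" by (rule Cz_eq_0)
    then show ?thesis using BB_move_shift[OF V, of 0 r c] d by simp
  qed
  have "Cz c * BB_move B 0 d c = 0"
    using BB_move_shift[OF V d, of c c] BB_move_adjacent[OF 0, of c "c + d"] by simp
  then show ?thesis by (rule Cz_eq_0)
qed

text \<open>For \<open>n > 0\<close> this is \<open>(v - v\<^sup>-\<^sup>1) \<Theta>\<^sub>n\<^sub>+\<^sub>1\<close> up to lower terms; for \<open>n = 0\<close> it is twice that element.\<close>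

definition scaled_BB :: "nat \<Rightarrow> 'a" where
  "scaled_BB n = ((v - vi) * v * v) *\<^sub>q (Ki * BB B 0 (int n))"

text \<open>The coefficients \<open>(v - v\<^sup>-\<^sup>1) \<Theta>\<^sub>n\<close>, with constant term \<open>1\<close>, obtained by solving the quadratic relation at \<open>r = 0\<close>
for \<open>\<Theta>\<close>. The last summand accounts for the term of that relation in which \<open>\<Theta>\<^sub>0\<close> occurs a second time.\<close>

fun theta :: "nat \<Rightarrow> 'a" where
  "theta 0 = 1"
| "theta (Suc 0) = (v - vi) *\<^sub>q t"
| "theta (Suc (Suc n)) = scaled_BB (Suc n) + pv *\<^sub>q (C * theta n) - (if n = 0 then C else 0)"

definition th :: "int \<Rightarrow> 'a" where
  "th k = (if k < 0 then 0 else theta (nat k))"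

lemma scaled_BB_0: "scaled_BB 0 = theta 1 + theta 1"
proof -
  have e: "(v - vi) * v * v * (2 * pv) = (v - vi) + (v - vi)"
    by (simp add: algebra_simps)
  have "scaled_BB 0 = ((v - vi) * v * v * (2 * pv)) *\<^sub>q t"
    by (simp add: scaled_BB_def BB_0 qscale_mult_right qscale_qscale)
  then show ?thesis
    by (simp only: e qscale_add_left theta.simps One_nat_def)
qed

definition comm_B :: "'a \<Rightarrow> int \<Rightarrow> 'a" where
  "comm_B x r = x * B r - B r * x"

definition twisted_B :: "'a \<Rightarrow> int \<Rightarrow> 'a" where
  "twisted_B x r = (v * v) *\<^sub>q (x * B (r + 1)) - pv *\<^sub>q (B (r + 1) * x)
      + C * (pv *\<^sub>q (x * B (r - 1)) - (v * v) *\<^sub>q (B (r - 1) * x))"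

lemma comm_B_linear: "comm_B (x + y) r = comm_B x r + comm_B y r" "comm_B (x - y) r = comm_B x r - comm_B y r"
  "comm_B (c *\<^sub>q x) r = c *\<^sub>q comm_B x r" "central z \<Longrightarrow> comm_B (z * x) r = z * comm_B x r"
  "central z \<Longrightarrow> comm_B z r = 0"
  by (simp_all add: comm_B_def algebra_simps qscale_linear central_left_commute centralD)

lemma twisted_B_linear: "twisted_B (x + y) r = twisted_B x r + twisted_B y r" "twisted_B (x - y) r = twisted_B x r - twisted_B y r"
  "twisted_B (c *\<^sub>q x) r = c *\<^sub>q twisted_B x r" "twisted_B (C * x) r = C * twisted_B x r"
  by (simp_all add: twisted_B_def algebra_simps qscale_linear mult.left_commute[of _ c] 
      central_left_commute[OF central_C, of "B _"])

lemma twisted_B_1: "twisted_B 1 r = comm_B (theta 1) r"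
proof -
  have "comm_B (theta 1) r = (v - vi) *\<^sub>q (t * B r - B r * t)"
    by (simp add: comm_B_def qscale_linear algebra_simps)
  also have "\<dots> = cv 1 *\<^sub>q (B (r + 1) - C * B (r - 1))"
    by (simp only: t_B cv_1 qscale_qscale)
  finally show ?thesis
    by (simp add: twisted_B_def cv_def algebra_simps qscale_linear power2_eq_square)
qed

text \<open>The commutation rule before the lower terms are separated. For \<open>d = 0\<close> the two neighbours of the diagonal
coincide, hence the case distinction.\<close>

lemma scaled_BB_B:
  assumes V: "vanish n" and d: "int d + 1 \<le> n"
  shows "comm_B (scaled_BB (Suc d) + (if d = 0 then scaled_BB 1 else C * scaled_BB (d - 1))) r = twisted_B (scaled_BB d) r"
proof -
  let ?G = "BB B 1 (int d) + BB B 0 (int d + 1)"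
  let ?S = "BB B 0 (int d)"
  let ?e = "(v - vi) * v * v"
  have U: "U (0 + 1) (int d + 1) = 0" using V d by (simp add: vanish_def)
  have *: "pv *\<^sub>q (?G * B r - B r * ?G)
    = ?S * B (r + 1) - (pv * pv) *\<^sub>q (B (r + 1) * ?S)
      + C * ((pv * pv) *\<^sub>q (?S * B (r - 1)) - B (r - 1) * ?S)"
    using BB_commutes_with_B[OF BB_move_vanishes[OF V, of "int d" "r - 1"] U] d
    by (simp add: add.commute[of 1 r])
  have "scaled_BB (Suc d) + (if d = 0 then scaled_BB 1 else C * scaled_BB (d - 1)) = ?e *\<^sub>q (Ki * ?G)"
  proof (cases "d = 0")
    case True
    then show ?thesis using BB_commute[of B 1 0] by (simp add: scaled_BB_def algebra_simps qscale_linear)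
  next
    case False
    have "BB B 1 (int d) = C * BB B 0 (int d - 1)"
      using BB_shift[OF V, of "int d - 1" 0 1] d False Cz_Suc[of 0] by simp
    then show ?thesis
      using False by (simp add: scaled_BB_def algebra_simps qscale_linear of_nat_diff central_left_commute[OF central_C, of Ki])
  qed
  then have "comm_B (scaled_BB (Suc d) + (if d = 0 then scaled_BB 1 else C * scaled_BB (d - 1))) r
     = comm_B (?e *\<^sub>q (Ki * ?G)) r"
    by (rule arg_cong)
  also have "\<dots> = (?e * (v * v)) *\<^sub>q (Ki * (pv *\<^sub>q (?G * B r - B r * ?G)))"
    by (simp add: comm_B_def algebra_simps qscale_linear central_left_commute[OF central_Ki, of "B _"])
  also have "\<dots> = twisted_B (scaled_BB d) r"
    unfolding *
    by (simp add: twisted_B_def scaled_BB_def algebra_simps qscale_linear central_left_commute[OF central_Ki, of "B _"]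
       central_left_commute[OF central_Ki, of C])
  finally show ?thesis .
qed

lemma double_cancel: "x + x = y + y \<Longrightarrow> x = (y :: 'a)"
proof -
  assume "x + x = y + y"
  then have "(1 + 1) *\<^sub>q x = (1 + 1) *\<^sub>q y" by (simp only: qscale_linear)
  then show ?thesis by simp
qed

text \<open>Both sides of the rule for \<open>scaled_BB\<close> are the rule for \<open>theta\<close> at the same index minus a multiple of the rule
two steps below.\<close>

lemma theta_B:
  assumes V: "vanish n"
  shows "int m + 1 \<le> n \<Longrightarrow> comm_B (theta (Suc (Suc m))) r + C * comm_B (theta m) r = twisted_B (theta (Suc m)) r"
proof (induction m rule: less_induct)
  case (less m)
  have scaled_BB: "scaled_BB (Suc k) = theta (Suc (Suc k)) - pv *\<^sub>q (C * theta k) + (if k = 0 then C else 0)" for k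
    by simp
  note lin = comm_B_linear(1-3) comm_B_linear(4,5)[OF central_C] twisted_B_linear
  note Y = scaled_BB_B[OF V less.prems, of r]
  consider "m = 0" | "m = 1" | l where "m = Suc (Suc l)"
    by (metis One_nat_def not0_implies_Suc)
  then show ?case
  proof cases
    case 1
    have "comm_B (scaled_BB 1) r + comm_B (scaled_BB 1) r = twisted_B (theta 1) r + twisted_B (theta 1) r"
      using Y 1 by (simp add: scaled_BB_0 lin)
    then have "comm_B (scaled_BB 1) r = twisted_B (theta 1) r"
      by (rule double_cancel)
    moreover have "comm_B (theta (Suc (Suc m))) r = comm_B (scaled_BB 1 + pv *\<^sub>q C - C) r"
      using 1 by simp
    moreover have "comm_B (theta m) r = 0"
      using 1 comm_B_linear(5)[OF central_one] by simp
    ultimately show ?thesis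
      unfolding lin using 1 by (simp del: theta.simps)
  next
    case 2
    have "comm_B (theta (Suc (Suc 1)) - pv *\<^sub>q (C * theta 1) + C * (theta 1 + theta 1)) r
        = twisted_B (theta (Suc 1) - pv *\<^sub>q (C * 1) + C * 1) r"
    proof -
      have "comm_B (scaled_BB (Suc 1) + C * scaled_BB 0) r = twisted_B (scaled_BB 1) r"
        using Y 2 by simp
      moreover have "scaled_BB (Suc 1) = theta (Suc (Suc 1)) - pv *\<^sub>q (C * theta 1)"
        using scaled_BB[of 1] by (simp del: theta.simps)
      moreover have "scaled_BB 1 = theta (Suc 1) - pv *\<^sub>q (C * 1) + C * 1"
        using scaled_BB[of 0] by (simp del: theta.simps(2,3))
      ultimately show ?thesis by (simp only: scaled_BB_0)
    qed
    then show ?thesis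
      unfolding lin twisted_B_1 using 2 by (simp add: algebra_simps qscale_linear del: theta.simps)
  next
    case (3 l)
    have "comm_B (theta (Suc (Suc m)) - pv *\<^sub>q (C * theta m)
          + C * (theta m - pv *\<^sub>q (C * theta l) + (if l = 0 then C else 0))) r
        = twisted_B (theta (Suc m) - pv *\<^sub>q (C * theta (Suc l))) r"
      using Y 3 scaled_BB[of m] scaled_BB[of l] scaled_BB[of "Suc l"] by (simp del: theta.simps)
    moreover have "comm_B (if l = 0 then C else 0) r = 0"
      using comm_B_linear(5)[OF central_C] by (simp add: comm_B_def)
    moreover have ih: "comm_B (theta m) r + C * comm_B (theta l) r = twisted_B (theta (Suc l)) r"
      using less.IH[of l] less.prems 3 by (simp del: theta.simps)
    ultimately show ?thesis
      unfolding lin ih[symmetric] by (simp add: algebra_simps qscale_linear del: theta.simps)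
  qed
qed

lemma th_simps: "th 0 = 1" "m < 0 \<Longrightarrow> th m = 0" "th (int n) = theta n"
  by (simp_all add: th_def)

lemma theta_shift_data:
  assumes V: "vanish n" and n: "0 \<le> n"
  shows "theta_shift B th C (nat n + 1)"
proof
  show "central C" by (rule central_C)
  show "th 0 = 1" "\<And>m. m < 0 \<Longrightarrow> th m = 0" by (simp_all add: th_simps)
  fix k r assume k: "k \<le> int (nat n + 1)"
  have "comm_B (th k) r + C * comm_B (th (k - 2)) r = twisted_B (th (k - 1)) r"
  proof -
    consider "k < 0" | "k = 0" | "k = 1" | m where "k = int (Suc (Suc m))"
    proof -
      assume *: "k < 0 \<Longrightarrow> thesis" "k = 0 \<Longrightarrow> thesis" "k = 1 \<Longrightarrow> thesis"
        "\<And>m. k = int (Suc (Suc m)) \<Longrightarrow> thesis"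
      show thesis
      proof (cases "k < 2")
        case True
        then show ?thesis using * by fastforce
      next
        case False
        then have "k = int (Suc (Suc (nat (k - 2))))" by simp
        then show ?thesis by (rule *(4))
      qed
    qed
    then show ?thesis
    proof cases
      case 1
      then show ?thesis by (simp add: th_simps comm_B_def twisted_B_def)
    next
      case 2
      then show ?thesis by (simp add: th_simps comm_B_def twisted_B_def)
    next
      case 3
      then have "th k = theta 1" using th_simps(3)[of 1] by simp
      moreover have "th (k - 2) = 0" "th (k - 1) = 1" using 3 by (simp_all add: th_simps)
      ultimately show ?thesis using twisted_B_1 by (simp add: comm_B_def)
    next
      case (4 m)
      have "k - 2 = int m" "k - 1 = int (Suc m)" using 4 by simp_all
      then show ?thesis
        using theta_B[OF V, of m r] 4 k n by (simp only: th_simps)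
    qed
  qed
  then show "th k * B r + C * (th (k - 2) * B r) - (v * v) *\<^sub>q (th (k - 1) * B (r + 1))
        - pv *\<^sub>q (C * (th (k - 1) * B (r - 1)))
      = B r * th k + C * (B r * th (k - 2)) - pv *\<^sub>q (B (r + 1) * th (k - 1))
        - (v * v) *\<^sub>q (C * (B (r - 1) * th (k - 1)))"
    by (simp add: comm_B_def twisted_B_def algebra_simps qscale_linear)
qed

lemma t_scaled_BB: "vanish n \<Longrightarrow> int j + 1 \<le> n \<Longrightarrow> t * scaled_BB j = scaled_BB j * t"
proof -
  assume "vanish n" "int j + 1 \<le> n"
  then have "U 0 (int j + 1) = 0" "U 1 (int j) = 0"
    by (simp_all add: vanish_def)
  then have "t * BB B 0 (int j) = BB B 0 (int j) * t"
    using t_BB[of 0 "int j"] by simp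
  then show ?thesis
    by (simp add: scaled_BB_def qscale_linear mult.assoc central_left_commute[OF central_Ki, of t])
qed

lemma t_theta:
  assumes V: "vanish n"
  shows "int j \<le> n \<Longrightarrow> t * theta j = theta j * t"
proof (induction j rule: theta.induct)
  case (3 j)
  then have "t * scaled_BB (Suc j) = scaled_BB (Suc j) * t" "t * theta j = theta j * t"
    using t_scaled_BB[OF V, of "Suc j"] by simp_all
  then show ?case
    by (simp add: algebra_simps qscale_linear central_left_commute[OF central_C, of t] centralD[OF central_C, of t])
qed (simp_all add: qscale_linear algebra_simps)

lemma t_log_derivative:
  assumes V: "vanish n"
  shows "int j \<le> n \<Longrightarrow> t * log_derivative th j = log_derivative th j * t"
proof (induction j rule: less_induct)
  case (less j)
  have "t * (log_derivative th i * th (int j - int i)) = log_derivative th i * th (int j - int i) * t"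
    if "i \<in> {1..<j}" for i
  proof -
    have "t * th (int j - int i) = th (int j - int i) * t"
      using t_theta[OF V, of "j - i"] that less.prems th_simps(3)[of "j - i"] by (simp add: of_nat_diff)
    moreover have "t * log_derivative th i = log_derivative th i * t"
      using less that by simp
    ultimately show ?thesis by (metis mult.assoc)
  qed
  then have "t * (\<Sum>i\<in>{1..<j}. log_derivative th i * th (int j - int i))
      = (\<Sum>i\<in>{1..<j}. log_derivative th i * th (int j - int i)) * t"
    unfolding sum_distrib_left sum_distrib_right by (intro sum.cong) simp_all
  then show ?case
    using t_theta[OF V less.prems]
    by (simp add: log_derivative.simps[of th j] th_simps qscale_linear left_diff_distrib right_diff_distrib)
qed

text \<open>With \<open>m = n + 1\<close> and \<open>u = U 0 m\<close>, the bracket of \<open>H\<^sub>m\<close> with \<open>BB B 0 0\<close> is computed in two ways: its action on the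
sequence gives \<open>2 m [2m] u\<close> up to a common factor, and the bracket of \<open>t\<close> with \<open>\<Theta>\<^sub>m\<close> gives \<open>- 2 m [2] u\<close>.\<close>

lemma vanish_step:
  assumes V: "vanish n" and n: "1 \<le> n"
  shows "vanish (n + 1)"
proof -
  define m where "m = nat n + 1"
  have m: "int m = n + 1" "0 < m" using n by (simp_all add: m_def)
  interpret theta_shift B th C m
    using theta_shift_data[OF V] n by (simp add: m_def)
  define u where "u = U 0 (n + 1)"
  have U_far: "U r (r + (n + 1)) = Cz r * u" for r
  proof -
    have *: "t * BB B r (r + n) - BB B r (r + n) * t = qint 2 *\<^sub>q U r (r + (n + 1))" for r
    proof -
      have "U (r + 1) (r + n) = 0" using V n by (simp add: vanish_def)
      then show ?thesis using t_BB[of r "r + n"] by (simp add: add.assoc)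
    qed
    have "BB B r (r + n) = Cz r * BB B 0 n" using BB_shift_0[OF V, of n r] n by simp
    then have "qint 2 *\<^sub>q U r (r + (n + 1)) = Cz r * (t * BB B 0 n - BB B 0 n * t)"
      using *[of r] by (simp add: right_diff_distrib mult.assoc central_left_commute[OF central_Cz, of t])
    also have "\<dots> = qint 2 *\<^sub>q (Cz r * u)"
      using *[of 0] by (simp add: u_def qscale_linear)
    finally show ?thesis using qint_2_nonzero by simp
  qed
  (* the bracket of hh m with BB B 0 0, from the action of hh m on the sequence *)
  have "hh m * BB B 0 0 - BB B 0 0 * hh m
      = (2 * cv m) *\<^sub>q (\<Sum>i<m. C ^ i * U (0 - int i) (0 + int m - int i))"
    by (rule BB_diagonal_commutator) (use log_derivative_B m in auto)
  also have "(\<Sum>i<m. C ^ i * U (0 - int i) (0 + int m - int i)) = (\<Sum>i<m. u)"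
  proof (rule sum.cong)
    fix i
    have "U (0 - int i) (0 + int m - int i) = Cz (- int i) * u"
      using U_far[of "- int i"] m by (simp add: algebra_simps)
    then show "C ^ i * U (0 - int i) (0 + int m - int i) = u"
      by (simp add: C_power_Cz)
  qed simp
  also have "(\<Sum>i<m. u) = of_nat m *\<^sub>q u"
    using qs.sum_constant_scale[of u "{..<m}"] by simp
  finally have 1: "hh m * BB B 0 0 - BB B 0 0 * hh m = (2 * cv m * of_nat m) *\<^sub>q u"
    by (simp add: qscale_linear)
  (* the same bracket, from BB B 0 0 being a multiple of t and the bracket of t with the m-th Theta *)
  have "t * scaled_BB (nat n) - scaled_BB (nat n) * t = ((v - vi) * v * v * qint 2) *\<^sub>q (Ki * u)"
  proof -
    have "U 1 n = 0" using V n by (simp add: vanish_def)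
    then have "t * BB B 0 n - BB B 0 n * t = qint 2 *\<^sub>q u"
      using t_BB[of 0 n] by (simp add: u_def)
    then have "((v - vi) * v * v) *\<^sub>q (Ki * (t * BB B 0 n - BB B 0 n * t))
        = ((v - vi) * v * v * qint 2) *\<^sub>q (Ki * u)"
      by (simp add: qscale_linear)
    then show ?thesis
      using n by (simp add: scaled_BB_def qscale_linear right_diff_distrib mult.assoc central_left_commute[OF central_Ki, of t])
  qed
  moreover obtain l where l: "nat n = Suc l" using n by (cases "nat n") auto
  moreover have "t * theta l = theta l * t" using t_theta[OF V, of l] l by simp
  ultimately have "t * theta m - theta m * t = ((v - vi) * v * v * qint 2) *\<^sub>q (Ki * u)"
    by (auto simp: m_def algebra_simps qscale_linear central_left_commute[OF central_C, of t] centralD[OF central_C, of t])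
  moreover have "t * hh m - hh m * t = of_nat m *\<^sub>q (t * theta m - theta m * t)"
  proof -
    have "t * (hh i * th (int m - int i)) = hh i * th (int m - int i) * t" if "i \<in> {1..<m}" for i
    proof -
      have "t * th (int m - int i) = th (int m - int i) * t"
        using t_theta[OF V, of "m - i"] that th_simps(3)[of "m - i"] m by (simp add: of_nat_diff)
      moreover have "t * hh i = hh i * t"
        using t_log_derivative[OF V, of i] that m by simp
      ultimately show ?thesis by (metis mult.assoc)
    qed
    then have "t * (\<Sum>i\<in>{1..<m}. hh i * th (int m - int i))
        = (\<Sum>i\<in>{1..<m}. hh i * th (int m - int i)) * t"
      unfolding sum_distrib_left sum_distrib_right by (intro sum.cong) simp_all
    then show ?thesis
      by (simp add: log_derivative.simps[of th m] th_simps qscale_linear left_diff_distrib right_diff_distrib)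
  qed
  ultimately have 2: "K * (t * hh m - hh m * t) = (of_nat m * ((v - vi) * v * v * qint 2)) *\<^sub>q u"
    by (simp add: qscale_linear)
  have "hh m * BB B 0 0 - BB B 0 0 * hh m = - ((2 * pv) *\<^sub>q (K * (t * hh m - hh m * t)))"
    by (simp add: BB_0 qscale_linear right_diff_distrib mult.assoc central_left_commute[OF central_K, of "hh m"])
  also note 2
  also have "(2 * pv) *\<^sub>q (of_nat m * ((v - vi) * v * v * qint 2)) *\<^sub>q u = (2 * cv 1 * of_nat m) *\<^sub>q u"
    unfolding cv_1 qscale_qscale
    by (intro arg_cong[where f="\<lambda>c. c *\<^sub>q u"]) (simp add: algebra_simps)
  finally have "(2 * of_nat m * (cv m + cv 1)) *\<^sub>q u = 0"
    using 1 by (simp add: algebra_simps qscale_linear)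
  then have "u = 0"
    using cv_add_cv1_nonzero[OF m(2)] m(2) by (simp add: qs.scale_eq_0_iff)
  then have U_up: "U r (r + (n + 1)) = 0" for r
    using U_far by simp
  show ?thesis
    unfolding vanish_def
  proof (intro allI impI)
    fix r s assume "\<bar>s - r\<bar> \<le> n + 1"
    then consider "\<bar>s - r\<bar> \<le> n" | "s = r + (n + 1)" | "r = s + (n + 1)" by linarith
    then show "U r s = 0"
      using V U_up U_commute by cases (auto simp: vanish_def)
  qed
qed

lemma U_eq_0: "U r s = 0"
proof -
  have V0: "vanish 0" using U_diag by (auto simp: vanish_def)
  have "t * BB B r r = BB B r r * t" for r
    using BB_shift_0[OF V0, of 0 r]
    by (simp add: BB_0 qscale_linear mult.assoc central_left_commute[OF central_K, of t]
        central_left_commute[OF central_Cz, of t])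
  then have U1: "U r (r + 1) = 0" for r by (rule U_adjacent)
  have "vanish 1"
    unfolding vanish_def
  proof (intro allI impI)
    fix r s :: int assume "\<bar>s - r\<bar> \<le> 1"
    then consider "s = r" | "s = r + 1" | "r = s + 1" by linarith
    then show "U r s = 0"
      using U_diag U1 U_commute by cases auto
  qed
  note V1 = this
  have "vanish (int n + 1)" for n
  proof (induction n)
    case (Suc n)
    have "int (Suc n) + 1 = (int n + 1) + 1" by simp
    then show ?case using vanish_step[OF Suc] by (simp only:)
  qed (use V1 in simp)
  from this[of "nat \<bar>s - r\<bar>"] show ?thesis
    by (simp add: vanish_def)
qed

end

lemma commute_mult: "x * a = a * x \<Longrightarrow> x * b = b * x \<Longrightarrow> x * (a * b) = a * b * x"
  for x :: "'a::semigroup_mult"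
  by (metis mult.assoc)

section \<open>Exponentials of commuting series\<close>

text \<open>Powers of a series whose coefficient algebra may be the zero algebra, where series do not form an instance of the
class of unital rings.\<close>

primrec fps_pow :: "'a::qv_algebra fps \<Rightarrow> nat \<Rightarrow> 'a fps" where
  "fps_pow X 0 = Abs_fps (\<lambda>m. if m = 0 then 1 else 0)"
| "fps_pow X (Suc k) = X * fps_pow X k"

text \<open>The derivation \<open>z d/dz\<close>, which preserves degrees, unlike \<open>d/dz\<close>.\<close>

definition euler :: "'a::qv_algebra fps \<Rightarrow> 'a fps" where
  "euler f = Abs_fps (\<lambda>m. of_nat m *\<^sub>q fps_nth f m)"

lemma euler_mult: "euler (f * g) = euler f * g + f * euler g"
proof (rule fps_ext)
  fix n
  have "of_nat n *\<^sub>q (fps_nth f i * fps_nth g (n - i))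
      = (of_nat i *\<^sub>q fps_nth f i) * fps_nth g (n - i) + fps_nth f i * (of_nat (n - i) *\<^sub>q fps_nth g (n - i))"
    if "i \<in> {0..n}" for i
    using that by (simp add: qscale_linear of_nat_diff algebra_simps)
  then show "fps_nth (euler (f * g)) n = fps_nth (euler f * g + f * euler g) n"
    by (simp add: euler_def fps_mult_nth qs.scale_sum_right flip: sum.distrib)
qed

lemma fps_mult_commute:
  fixes f g :: "'a::ring fps"
  assumes "\<And>i j. fps_nth f i * fps_nth g j = fps_nth g j * fps_nth f i"
  shows "f * g = g * f"
proof (rule fps_ext)
  fix n
  have "fps_nth (g * f) n = (\<Sum>i=0..n. fps_nth g (n - i) * fps_nth f i)"
    unfolding fps_mult_nth by (rule sum.reindex_bij_witness[of _ "\<lambda>i. n - i" "\<lambda>i. n - i"]) auto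
  then show "fps_nth (f * g) n = fps_nth (g * f) n"
    by (simp add: fps_mult_nth assms)
qed

lemma euler_pow:
  assumes "\<And>i j. fps_nth X i * fps_nth X j = fps_nth X j * fps_nth X i"
  shows "fps_nth (euler (fps_pow X (Suc k))) m = of_nat (Suc k) *\<^sub>q fps_nth (euler X * fps_pow X k) m"
proof (induction k arbitrary: m)
  case 0
  have "euler (fps_pow X 0) = 0"
    by (rule fps_ext) (simp add: euler_def)
  then show ?case by (simp add: euler_mult)
next
  case (Suc k)
  have comm: "X * euler X = euler X * X"
    by (rule fps_mult_commute) (simp add: euler_def qscale_linear assms)
  have "fps_nth (X * euler (fps_pow X (Suc k))) m = of_nat (Suc k) *\<^sub>q fps_nth (X * (euler X * fps_pow X k)) m"
    unfolding fps_mult_nth[of X] Suc by (simp add: qscale_mult_right qs.scale_sum_right)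
  also have "X * (euler X * fps_pow X k) = euler X * fps_pow X (Suc k)"
    by (simp add: comm flip: mult.assoc)
  finally show ?case
    unfolding fps_pow.simps(2)[of X "Suc k"] euler_mult[of X] by (simp add: qscale_linear qscale_2)
qed

lemma fps_pow_low_zero:
  assumes "fps_nth X 0 = 0"
  shows "m < k \<Longrightarrow> fps_nth (fps_pow X k) m = 0"
proof (induction k arbitrary: m)
  case (Suc k)
  have "fps_nth X i * fps_nth (fps_pow X k) (m - i) = 0" if "i \<in> {0..m}" for i
    using that Suc assms by (cases "i = 0") auto
  then show ?case by (simp add: fps_mult_nth)
qed simp

definition exp_coeff :: "'a::qv_algebra fps \<Rightarrow> nat \<Rightarrow> 'a" where
  "exp_coeff X m = (\<Sum>k\<le>m. (1 / fact k) *\<^sub>q fps_nth (fps_pow X k) m)"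

lemma exp_coeff_extend:
  assumes "fps_nth X 0 = 0" "m \<le> n"
  shows "exp_coeff X m = (\<Sum>k\<le>n. (1 / fact k) *\<^sub>q fps_nth (fps_pow X k) m)"
  unfolding exp_coeff_def
proof (rule sum.mono_neutral_left)
  show "\<forall>i\<in>{..n} - {..m}. (1 / fact i) *\<^sub>q fps_nth (fps_pow X i) m = 0"
    using fps_pow_low_zero[OF assms(1)] by simp
qed (use assms(2) in auto)

lemma exp_coeff_0: "exp_coeff X 0 = 1"
  by (simp add: exp_coeff_def)

text \<open>The differential equation \<open>z E' = (z X') E\<close> of \<open>E = exp X\<close>.\<close>

lemma exp_coeff_recursion:
  assumes X0: "fps_nth X 0 = 0"
    and comm: "\<And>i j. fps_nth X i * fps_nth X j = fps_nth X j * fps_nth X i"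
  shows "of_nat m *\<^sub>q exp_coeff X m = (\<Sum>j=1..m. (of_nat j *\<^sub>q fps_nth X j) * exp_coeff X (m - j))"
proof (cases m)
  case (Suc n)
  have "of_nat m *\<^sub>q exp_coeff X m
      = (\<Sum>k\<le>Suc n. (1 / fact k) *\<^sub>q fps_nth (euler (fps_pow X k)) m)"
    by (simp add: exp_coeff_def Suc euler_def qs.scale_sum_right qscale_qscale mult.commute del: sum.atMost_Suc)
  also have "\<dots> = (\<Sum>k\<le>n. (1 / fact (Suc k)) *\<^sub>q fps_nth (euler (fps_pow X (Suc k))) m)"
    by (subst sum.atMost_Suc_shift) (simp add: Suc euler_def)
  also have "\<dots> = (\<Sum>k\<le>n. (1 / fact k) *\<^sub>q fps_nth (euler X * fps_pow X k) m)"
  proof (rule sum.cong)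
    fix k
    have "(1 / fact (Suc k)) * of_nat (Suc k) = (1 / fact k :: qv)"
      by (simp add: field_simps del: of_nat_Suc)
    then show "(1 / fact (Suc k)) *\<^sub>q fps_nth (euler (fps_pow X (Suc k))) m
        = (1 / fact k) *\<^sub>q fps_nth (euler X * fps_pow X k) m"
      unfolding euler_pow[OF comm] qscale_qscale by simp
  qed simp
  also have "\<dots> = (\<Sum>k\<le>n. \<Sum>j=1..m. (of_nat j *\<^sub>q fps_nth X j) * ((1 / fact k) *\<^sub>q fps_nth (fps_pow X k) (m - j)))"
    by (simp add: fps_mult_nth euler_def sum.atLeast_Suc_atMost qs.scale_sum_right qscale_linear mult.commute)
  also have "\<dots> = (\<Sum>j=1..m. (of_nat j *\<^sub>q fps_nth X j) * exp_coeff X (m - j))"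
  proof (subst sum.swap, rule sum.cong)
    fix j assume "j \<in> {1..m}"
    then have "m - j \<le> n" using Suc by auto
    from exp_coeff_extend[OF X0 this]
    show "(\<Sum>k\<le>n. (of_nat j *\<^sub>q fps_nth X j) * ((1 / fact k) *\<^sub>q fps_nth (fps_pow X k) (m - j)))
        = (of_nat j *\<^sub>q fps_nth X j) * exp_coeff X (m - j)"
      by (simp add: sum_distrib_left)
  qed simp
  finally show ?thesis .
qed simp

text \<open>Both sides solve the same differential equation, so the exponential inverts the logarithmic derivative.\<close>

lemma exp_log_derivative:
  assumes th0: "th 0 = 1" and comm: "\<And>i j. log_derivative th i * log_derivative th j
      = log_derivative th j * log_derivative th i"
  shows "exp_coeff (Abs_fps (\<lambda>j. if j = 0 then 0 else (1 / of_nat j) *\<^sub>q log_derivative th j)) m = th (int m)"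
proof (induction m rule: less_induct)
  case (less m)
  let ?X = "Abs_fps (\<lambda>j. if j = 0 then 0 else (1 / of_nat j) *\<^sub>q log_derivative th j)"
  show ?case
  proof (cases "m = 0")
    case True
    then show ?thesis using th0 by (simp add: exp_coeff_0)
  next
    case False
    have "of_nat m *\<^sub>q exp_coeff ?X m = (\<Sum>j=1..m. (of_nat j *\<^sub>q fps_nth ?X j) * exp_coeff ?X (m - j))"
      by (rule exp_coeff_recursion) (simp_all add: qscale_linear comm mult.commute)
    also have "\<dots> = (\<Sum>j=1..m. log_derivative th j * th (int m - int j))"
    proof (rule sum.cong)
      fix j assume j: "j \<in> {1..m}"
      then have "exp_coeff ?X (m - j) = th (int m - int j)"
        using less[of "m - j"] by (simp add: of_nat_diff)
      then show "(of_nat j *\<^sub>q fps_nth ?X j) * exp_coeff ?X (m - j) = log_derivative th j * th (int m - int j)"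
        using j by (simp add: qscale_qscale)
    qed simp
    also have "\<dots> = of_nat m *\<^sub>q th (int m)"
    proof -
      have "{1..m} = insert m {1..<m}" using False by auto
      then show ?thesis using th0 by (simp add: log_derivative.simps[of th m])
    qed
    finally show ?thesis using False by simp
  qed
qed

section \<open>The Drinfeld relations\<close>

context drinfeld_data
begin

lemma vanish_all: "vanish n"
  by (simp add: vanish_def U_eq_0)

abbreviation logth where "logth \<equiv> log_derivative th"

lemma hh_B:
  assumes "1 \<le> k"
  shows "logth k * B r - B r * logth k = cv k *\<^sub>q (B (r + int k) - C ^ k * B (r - int k))"
proof -
  interpret theta_shift B th C "nat (int k) + 1"
    by (rule theta_shift_data[OF vanish_all]) simp
  show ?thesis by (rule log_derivative_B) (use assms in auto)
qed

lemma BB_eq: "BB B (x + r) (y + r) = Cz r * BB B x y"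
  by (rule BB_shift[OF vanish_all order.refl])

text \<open>Once all \<open>U\<close> vanish, the derivation of \<open>H\<^sub>k\<close> kills every \<open>BB\<close>, hence every \<open>\<Theta>\<close>.\<close>

lemma hh_commutes_BB:
  assumes "1 \<le> k"
  shows "logth k * BB B r s = BB B r s * logth k"
proof -
  have "logth k * BB B r s - BB B r s * logth k
    = cv k *\<^sub>q (BB B (r + int k) s + BB B r (s + int k) - C ^ k * BB B (r - int k) s - C ^ k * BB B r (s - int k))"
    by (rule BB_commutator) (use hh_B[OF assms] central_power[OF central_C] in auto)
  also have "BB B (r + int k) s = C ^ k * BB B r (s - int k)"
    using BB_eq[of r "int k" "s - int k"] by (simp add: Cz_nat)
  also have "BB B r (s + int k) = C ^ k * BB B (r - int k) s"
    using BB_eq[of "r - int k" "int k" s] by (simp add: Cz_nat)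
  finally show ?thesis by simp
qed

lemma hh_0: "logth 0 = 0"
  by (simp add: log_derivative.simps[of th 0])

lemma hh_commutes_theta: "logth k * theta j = theta j * logth k"
proof (cases "k = 0")
  case False
  then have scaled_BB: "logth k * scaled_BB j = scaled_BB j * logth k" for j
    using hh_commutes_BB[of k 0 "int j"]
    by (simp add: scaled_BB_def qscale_linear mult.assoc central_left_commute[OF central_Ki, of "logth k"])
  show ?thesis
  proof (induction j rule: theta.induct)
    case 2
    have "logth k * (theta 1 + theta 1) = (theta 1 + theta 1) * logth k"
      using scaled_BB[of 0] unfolding scaled_BB_0 .
    then have "logth k * theta 1 = theta 1 * logth k"
      by (intro double_cancel[of "logth k * theta 1" "theta 1 * logth k"]) (simp only: distrib_left distrib_right)
    then show ?case by simp
  next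
    case (3 j)
    then show ?case using scaled_BB[of "Suc j"]
      by (auto simp: algebra_simps qscale_linear central_left_commute[OF central_C, of "logth k"] centralD[OF central_C, of "logth k"])
  qed simp
qed (simp add: hh_0)

lemma hh_commute: "logth j * logth k = logth k * logth j"
proof (induction k rule: less_induct)
  case (less k)
  have "logth j * (logth i * th (int k - int i)) = logth i * th (int k - int i) * logth j" if "i \<in> {1..<k}" for i
  proof -
    have "logth j * th (int k - int i) = th (int k - int i) * logth j"
      using that hh_commutes_theta[of j "k - i"] th_simps(3)[of "k - i"] by (simp add: of_nat_diff)
    moreover have "logth j * logth i = logth i * logth j" using less that by simp
    ultimately show ?thesis by (rule commute_mult[rotated])
  qed
  then have "logth j * (\<Sum>i\<in>{1..<k}. logth i * th (int k - int i)) = (\<Sum>i\<in>{1..<k}. logth i * th (int k - int i)) * logth j"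
    unfolding sum_distrib_left sum_distrib_right by (intro sum.cong) simp_all
  then show ?case
    using hh_commutes_theta[of j k]
    by (simp add: log_derivative.simps[of th k] th_simps qscale_linear left_diff_distrib right_diff_distrib)
qed

definition Theta :: "int \<Rightarrow> 'a" where
  "Theta k = (1 / (v - vi)) *\<^sub>q th k"

text \<open>The cases \<open>d = 0\<close> and \<open>d = 1\<close> are those in which \<open>\<Theta>\<^sub>1\<close>, respectively \<open>\<Theta>\<^sub>0\<close>, contributes twice.\<close>

lemma BB_theta_aux:
  "((v - vi) * v * v) *\<^sub>q BB B r (r + int d)
    = (th (int d + 1) * Cz r - pv *\<^sub>q (th (int d - 1) * Cz (r + 1))
       + th (1 - int d) * Cz (r + int d) - pv *\<^sub>q (th (- int d - 1) * Cz (r + int d + 1))) * K"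
proof -
  have scaled_BB: "((v - vi) * v * v) *\<^sub>q BB B r (r + int d) = scaled_BB d * Cz r * K"
  proof -
    have "scaled_BB d * Cz r * K = K * (Cz r * scaled_BB d)"
      by (simp add: centralD[OF central_Cz, of "scaled_BB d"] centralD[OF central_K, of "Cz r * scaled_BB d"])
    also have "\<dots> = ((v - vi) * v * v) *\<^sub>q (Cz r * BB B 0 (int d))"
      by (simp add: scaled_BB_def qscale_mult_right central_left_commute[OF central_Cz, of K])
    finally show ?thesis
      using BB_shift_0[OF vanish_all, of "int d" "int d" r] by simp
  qed
  have neg: "th (- int d - 1) = 0" by (simp add: th_simps)
  consider "d = 0" | "d = 1" | l where "d = Suc (Suc l)"
    by (metis One_nat_def not0_implies_Suc)
  then have "scaled_BB d * Cz r = th (int d + 1) * Cz r - pv *\<^sub>q (th (int d - 1) * Cz (r + 1))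
       + th (1 - int d) * Cz (r + int d)"
  proof cases
    case 1
    then show ?thesis
      using scaled_BB_0 th_simps(3)[of 1] by (simp add: th_simps(2) distrib_right del: theta.simps)
  next
    case 2
    have "th 2 = scaled_BB 1 + pv *\<^sub>q C - C" using th_simps(3)[of 2] by (simp add: numeral_2_eq_2)
    moreover have "int d + 1 = 2" "int d - 1 = 0" "1 - int d = 0" "r + int d = r + 1"
      using 2 by simp_all
    ultimately show ?thesis
      using 2 by (simp only: th_simps(1) Cz_Suc) (simp add: algebra_simps qscale_linear)
  next
    case (3 l)
    define T where "T = theta (Suc l)"
    have "int d + 1 = int (Suc d)" "int d - 1 = int (Suc l)"
      using 3 by simp_all
    then have "th (int d + 1) = theta (Suc d)" "th (int d - 1) = theta (Suc l)"
      by (simp_all only: th_simps(3))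
    moreover have "theta (Suc d) = scaled_BB d + pv *\<^sub>q (C * T)"
      using 3 by (simp add: T_def del: theta.simps(2))
    moreover have "th (1 - int d) = 0" using 3 by (simp add: th_simps)
    moreover have "T * (C * x) = C * (T * x)" for x
      by (rule central_left_commute[OF central_C])
    ultimately show ?thesis
      by (simp only: T_def[symmetric] Cz_Suc) (simp add: algebra_simps qscale_linear)
  qed
  then show ?thesis unfolding scaled_BB neg by simp
qed

lemma BB_theta:
  "BB B r s = (v powi (-2)) *\<^sub>q (Theta (s - r + 1) * Cz r * K)
     - (v powi (-4)) *\<^sub>q (Theta (s - r - 1) * Cz (r + 1) * K)
     + (v powi (-2)) *\<^sub>q (Theta (r - s + 1) * Cz s * K)
     - (v powi (-4)) *\<^sub>q (Theta (r - s - 1) * Cz (s + 1) * K)" (is "_ = ?R r s")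
proof -
  have v2: "v powi (-2) = pv" by (simp add: power_int_minus power2_eq_square)
  have v4: "v powi (-4) = pv * pv" by (simp add: power_int_minus eval_nat_numeral)
  have up: "BB B r s = ?R r s" if "r \<le> s" for r s
  proof -
    define d where "d = nat (s - r)"
    have s: "s = r + int d" using that by (simp add: d_def)
    have e: "1 / (v - vi) * (vi * vi) * ((v - vi) * v * v) = 1"
    proof -
      have "1 / x * (vi * vi) * (x * v * v) = 1" if "x \<noteq> 0" for x
        using that v_nonzero by (simp add: field_simps)
      then show ?thesis using v_minus_vi_nonzero .
    qed
    have "BB B r s = (1 / (v - vi) * (vi * vi)) *\<^sub>q ((v - vi) * v * v) *\<^sub>q BB B r (r + int d)"
      unfolding qscale_qscale e s by simp
    also have "\<dots> = ?R r s"
      unfolding BB_theta_aux v2 v4 s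
      by (simp add: Theta_def left_diff_distrib distrib_right qscale_linear)
    finally show ?thesis .
  qed
  show ?thesis
  proof (cases "r \<le> s")
    case False
    then have "BB B s r = ?R s r" by (intro up) simp
    then show ?thesis unfolding BB_commute[of B r s] by (simp add: algebra_simps)
  qed (rule up)
qed

end

section \<open>Imaginary root vectors as quadratic expressions\<close>

context drinfeld_data
begin

text \<open>The expression \<open>acute \<Theta>\<^sub>m\<close> around the place \<open>r\<close>, before division by the Cartan element. Consecutive values along an
antidiagonal differ by one instance of the quadratic expression \<open>BB\<close>.\<close>

definition quad_sum :: "nat \<Rightarrow> int \<Rightarrow> 'a" where
  "quad_sum m r = (v * v) *\<^sub>q (B r * B (r + int m)) - B (r + int m) * B r
     + (v * v - 1) *\<^sub>q (\<Sum>p\<in>{r + 1..r + int m - 1}. B p * B (2 * r + int m - p))"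

lemma quad_sum_1: "quad_sum 1 r + quad_sum 1 r = (v * v) *\<^sub>q BB B r r"
  by (simp add: quad_sum_def BB_def algebra_simps qscale_linear)

lemma quad_sum_2: "quad_sum 2 r = (v * v) *\<^sub>q BB B r (r + 1)"
proof -
  have "{r + 1..r + int 2 - 1} = {r + 1}" by auto
  then show ?thesis by (simp add: quad_sum_def BB_def algebra_simps qscale_linear)
qed

lemma quad_sum_step:
  assumes "1 \<le> n"
  shows "quad_sum (n + 2) r = (v * v) *\<^sub>q BB B r (r + int n + 1) + quad_sum n (r + 1)"
proof -
  let ?f = "\<lambda>p. B p * B (2 * r + int n + 2 - p)"
  have "{r + 1..r + int n + 1} = insert (r + 1) (insert (r + int n + 1) {r + 2..r + int n})"
    using assms by auto
  then have "(\<Sum>p\<in>{r + 1..r + int n + 1}. ?f p) = ?f (r + 1) + (?f (r + int n + 1) + (\<Sum>p\<in>{r + 2..r + int n}. ?f p))"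
    using assms by simp
  moreover have "2 * r + int n + 2 - (r + 1) = r + int n + 1" "2 * r + int n + 2 - (r + int n + 1) = r + 1"
    by simp_all
  ultimately have 1: "(\<Sum>p\<in>{r + 1..r + int n + 1}. ?f p) =
      B (r + 1) * B (r + int n + 1) + (B (r + int n + 1) * B (r + 1) + (\<Sum>p\<in>{r + 2..r + int n}. ?f p))"
    by simp
  define \<Sigma> where "\<Sigma> = (\<Sum>p\<in>{r + 2..r + int n}. ?f p)"
  have s1: "quad_sum (n + 2) r = (v * v) *\<^sub>q (B r * B (r + int n + 2)) - B (r + int n + 2) * B r
     + (v * v - 1) *\<^sub>q (B (r + 1) * B (r + int n + 1) + (B (r + int n + 1) * B (r + 1) + \<Sigma>))"
  proof -
    have "r + int (n + 2) = r + int n + 2" "r + int (n + 2) - 1 = r + int n + 1"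
      "2 * r + int (n + 2) = 2 * r + int n + 2"
      by simp_all
    then show ?thesis
      unfolding quad_sum_def \<Sigma>_def 1[symmetric] by (simp only:)
  qed
  have s2: "quad_sum n (r + 1) = (v * v) *\<^sub>q (B (r + 1) * B (r + int n + 1)) - B (r + int n + 1) * B (r + 1)
     + (v * v - 1) *\<^sub>q \<Sigma>"
    unfolding quad_sum_def \<Sigma>_def by (simp add: algebra_simps)
  have s3: "BB B r (r + int n + 1) = B r * B (r + int n + 2) - pv *\<^sub>q (B (r + 1) * B (r + int n + 1))
            + B (r + int n + 1) * B (r + 1) - pv *\<^sub>q (B (r + int n + 2) * B r)"
    by (simp add: BB_def add.assoc)
  show ?thesis unfolding s1 s2 s3 by (simp add: algebra_simps qscale_linear)
qed

lemma quad_sum_shift: "1 \<le> m \<Longrightarrow> quad_sum m (r + 1) = C * quad_sum m r"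
proof (induction m arbitrary: r rule: less_induct)
  case (less m)
  have BB: "BB B (r + 1) (s + 1) = C * BB B r s" for s
    by (rule BB_step) (simp add: U_eq_0)
  consider "m = 1" | "m = 2" | n where "m = n + 2" "1 \<le> n"
  proof -
    assume *: "m = 1 \<Longrightarrow> thesis" "m = 2 \<Longrightarrow> thesis" "\<And>n. m = n + 2 \<Longrightarrow> 1 \<le> n \<Longrightarrow> thesis"
    show thesis using * less.prems *(3)[of "m - 2"] by linarith
  qed
  then show ?case
  proof cases
    case 1
    have "quad_sum 1 (r + 1) + quad_sum 1 (r + 1) = C * quad_sum 1 r + C * quad_sum 1 r"
      unfolding quad_sum_1 BB distrib_left[symmetric] by (simp add: qscale_mult_right)
    then show ?thesis using double_cancel 1 by blast
  next
    case 2
    then show ?thesis unfolding 2 quad_sum_2 BB by (simp add: qscale_mult_right)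
  next
    case (3 n)
    have "r + 1 + int n + 1 = r + int n + 1 + 1" by simp
    then show ?thesis
      using less.IH[of n "r + 1"] 3
      by (simp only: quad_sum_step BB) (simp add: distrib_left qscale_mult_right)
  qed
qed

definition acute :: "nat \<Rightarrow> 'a" where
  "acute m = C * Ki * quad_sum m (-1)"

lemma acute_eq: "1 \<le> m \<Longrightarrow> acute m = Ki * quad_sum m 0"
  using quad_sum_shift[of m "-1"] by (simp add: acute_def mult.assoc central_left_commute[OF central_C, of Ki])

lemma acute_1: "(v - vi) *\<^sub>q acute 1 = theta 1"
proof (rule double_cancel)
  have "(v - vi) *\<^sub>q acute 1 + (v - vi) *\<^sub>q acute 1 = (v - vi) *\<^sub>q (Ki * (quad_sum 1 0 + quad_sum 1 0))"
    by (simp add: acute_eq distrib_left qscale_add_right)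
  also have "\<dots> = scaled_BB 0"
    unfolding quad_sum_1 by (simp add: scaled_BB_def qscale_linear mult.assoc)
  finally show "(v - vi) *\<^sub>q acute 1 + (v - vi) *\<^sub>q acute 1 = theta 1 + theta 1"
    unfolding scaled_BB_0 .
qed

lemma acute_2: "(v - vi) *\<^sub>q acute 2 = scaled_BB 1"
proof -
  have "(v - vi) *\<^sub>q acute 2 = (v - vi) *\<^sub>q (Ki * quad_sum 2 0)"
    by (simp add: acute_eq)
  then show ?thesis
    unfolding quad_sum_2 by (simp add: scaled_BB_def qscale_linear mult.assoc)
qed

lemma acute_step: "1 \<le> n \<Longrightarrow> (v - vi) *\<^sub>q acute (n + 2) = scaled_BB (n + 1) + (v - vi) *\<^sub>q (acute n * C)"
  using acute_eq[of "n + 2"] quad_sum_step[of n 0] quad_sum_shift[of n 0]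
  by (simp add: acute_eq scaled_BB_def qscale_linear distrib_left mult.assoc centralD[OF central_C]
      central_left_commute[OF central_C, of Ki] add.commute)

definition theta_sum :: "nat \<Rightarrow> 'a" where
  "theta_sum m = acute m
     - (\<Sum>a=1..(m - 1) div 2. ((v\<^sup>2 - 1) * v powi (- 2 * int a)) *\<^sub>q (acute (m - 2 * a) * C ^ a))
     - (if even m then (v powi (1 - int m)) *\<^sub>q (C ^ (m div 2)) else 0)"

lemma v_powi_even: "v powi (- 2 * int a) = pv ^ a"
proof -
  have "v powi (- 2 * int a) = (v powi (-2)) powi int a"
    by (rule power_int_mult)
  also have "v powi (-2) = pv" by (simp add: power_int_minus power2_eq_square)
  finally show ?thesis by simp
qed

text \<open>The sum over \<open>a\<close> is a truncated geometric series in \<open>v\<^sup>-\<^sup>2 C\<close>, so two consecutive sums cancel up to two terms. This is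
\<open>\<Theta>(z) (1 - v\<^sup>-\<^sup>2 C z\<^sup>2) = acute \<Theta>(z) (1 - C z\<^sup>2)\<close>.\<close>

lemma theta_sum_step:
  assumes "1 \<le> n"
  shows "theta_sum (n + 2) - pv *\<^sub>q (theta_sum n * C) = acute (n + 2) - acute n * C"
proof -
  define A where "A = (n - 1) div 2"
  have A: "(n + 2 - 1) div 2 = Suc A" using assms by (simp add: A_def) 
  let ?c = "v * v - 1"
  have "(\<Sum>a=1..Suc A. ((v\<^sup>2 - 1) * v powi (- 2 * int a)) *\<^sub>q (acute (n + 2 - 2 * a) * C ^ a))
      = (\<Sum>a=1..Suc A. (?c * pv ^ a) *\<^sub>q (acute (n + 2 - 2 * a) * C ^ a))"
    by (simp only: v_powi_even power2_eq_square)
  also have "\<dots> = (?c * pv) *\<^sub>q (acute n * C)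
      + (\<Sum>a=1..A. (?c * pv ^ Suc a) *\<^sub>q (acute (n + 2 - 2 * Suc a) * C ^ Suc a))"
    unfolding sum.atLeast_Suc_atMost[of 1 "Suc A", simplified] One_nat_def sum.shift_bounds_cl_Suc_ivl
    by (simp add: sum.atLeast_Suc_atMost[of 0 A])
  also have "(\<Sum>a=1..A. (?c * pv ^ Suc a) *\<^sub>q (acute (n + 2 - 2 * Suc a) * C ^ Suc a))
     = pv *\<^sub>q ((\<Sum>a=1..A. ((v\<^sup>2 - 1) * v powi (- 2 * int a)) *\<^sub>q (acute (n - 2 * a) * C ^ a)) * C)"
    unfolding sum_distrib_right qs.scale_sum_right v_powi_even
    by (rule sum.cong) (simp_all add: qscale_mult_left qscale_qscale power2_eq_square mult_ac power_commutes)
  finally have *: "(\<Sum>a=1..Suc A. ((v\<^sup>2 - 1) * v powi (- 2 * int a)) *\<^sub>q (acute (n + 2 - 2 * a) * C ^ a))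
    = (?c * pv) *\<^sub>q (acute n * C)
     + pv *\<^sub>q ((\<Sum>a=1..A. ((v\<^sup>2 - 1) * v powi (- 2 * int a)) *\<^sub>q (acute (n - 2 * a) * C ^ a)) * C)" .
  have **: "v powi (1 - int (n + 2)) = pv * v powi (1 - int n)"
  proof -
    have "v powi ((1 - int n) + (-2)) = v powi (1 - int n) * v powi (-2)"
      by (rule power_int_add) (simp add: v_nonzero)
    moreover have "1 - int (n + 2) = (1 - int n) + (-2)" by simp
    moreover have "v powi (-2) = pv" by (simp add: power_int_minus power2_eq_square)
    ultimately show ?thesis by (simp only: mult.commute)
  qed
  have ***: "(if even (n + 2) then (v powi (1 - int (n + 2))) *\<^sub>q (C ^ ((n + 2) div 2)) else 0)
     = pv *\<^sub>q ((if even n then (v powi (1 - int n)) *\<^sub>q (C ^ (n div 2)) else 0) * C)"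
    unfolding ** by (simp add: qscale_linear power_commutes)
  show ?thesis
    unfolding theta_sum_def A * *** A_def[symmetric]
    by (simp add: left_diff_distrib qscale_linear algebra_simps)
qed

lemma theta_sum_eq: "1 \<le> m \<Longrightarrow> (v - vi) *\<^sub>q theta_sum m = theta m"
proof (induction m rule: less_induct)
  case (less m)
  consider "m = 1" | "m = 2" | n where "m = n + 2" "1 \<le> n"
  proof -
    assume *: "m = 1 \<Longrightarrow> thesis" "m = 2 \<Longrightarrow> thesis" "\<And>n. m = n + 2 \<Longrightarrow> 1 \<le> n \<Longrightarrow> thesis"
    show thesis using * less.prems *(3)[of "m - 2"] by linarith
  qed
  then show ?case
  proof cases
    case 1
    then show ?thesis using acute_1 by (simp add: theta_sum_def)
  next
    case 2
    have "v powi (1 - int 2) = vi" by (simp add: power_int_minus)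
    moreover have "(v - vi) * vi = 1 - pv" by (simp add: algebra_simps)
    ultimately have "(v - vi) *\<^sub>q theta_sum 2 = scaled_BB 1 + pv *\<^sub>q C - C"
      using acute_2 by (simp add: theta_sum_def qscale_linear del: qs.scale_left_diff_distrib)
        (simp add: algebra_simps qscale_linear)
    moreover have "theta 2 = scaled_BB 1 + pv *\<^sub>q C - C" by (simp add: numeral_2_eq_2)
    ultimately show ?thesis using 2 by simp
  next
    case (3 n)
    have "theta_sum m = acute (n + 2) - acute n * C + pv *\<^sub>q (theta_sum n * C)"
      using theta_sum_step[OF 3(2)] 3 by (simp add: algebra_simps)
    then have "(v - vi) *\<^sub>q theta_sum m = ((v - vi) *\<^sub>q acute (n + 2) - (v - vi) *\<^sub>q (acute n * C))
        + pv *\<^sub>q (((v - vi) *\<^sub>q theta_sum n) * C)"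
      by (simp only: qscale_add_right qs.scale_right_diff_distrib qscale_qscale qscale_mult_left mult.commute)
    also have "\<dots> = scaled_BB (n + 1) + pv *\<^sub>q (C * theta n)"
      using acute_step[OF 3(2)] less.IH[of n] 3 by (simp add: centralD[OF central_C] del: theta.simps)
    also have "\<dots> = theta m"
      using 3 by (simp add: less_eq_Suc_le)
    finally show ?thesis .
  qed
qed

end

section \<open>Homomorphisms out of presented algebras\<close>

lemma algebra_homD:
  assumes "algebra_hom f"
  shows "f 1 = 1" "f (x + y) = f x + f y" "f (x * y) = f x * f y" "f (c *\<^sub>q x) = c *\<^sub>q f x"
    and "f 0 = 0" "f (- x) = - f x" "f (x - y) = f x - f y" "f (x ^ n) = f x ^ n"
proof -
  show *: "f 1 = 1" "f (x + y) = f x + f y" "f (x * y) = f x * f y" "f (c *\<^sub>q x) = c *\<^sub>q f x" for x y c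
    using assms by (simp_all add: algebra_hom_def)
  show 0: "f 0 = 0" using *(2)[of 0 0] by simp
  show m: "f (- x) = - f x" for x
    using *(2)[of x "- x"] 0 by (simp add: eq_neg_iff_add_eq_0 add.commute)
  show "f (x - y) = f x - f y" using *(2)[of x "- y"] m by simp
  show "f (x ^ n) = f x ^ n" by (induction n) (simp_all add: *)
qed

lemma algebra_hom_sum: "algebra_hom f \<Longrightarrow> f (sum g A) = (\<Sum>x\<in>A. f (g x))"
  by (induction A rule: infinite_finite_induct) (simp_all add: algebra_homD)

lemma algebra_hom_comp: "algebra_hom f \<Longrightarrow> algebra_hom g \<Longrightarrow> algebra_hom (f \<circ> g)"
  by (simp add: algebra_hom_def)

fun word_eval :: "('g \<Rightarrow> 'a::qv_algebra) \<Rightarrow> 'g word \<Rightarrow> 'a" where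
  "word_eval g (Word xs) = prod_list (map g xs)"

lemma word_eval_plus: "word_eval g (a + b) = word_eval g a * word_eval g b"
  by (cases a; cases b) simp

lemma word_eval_0: "word_eval g 0 = 1"
  by (simp add: zero_word_def)

definition poly_eval :: "('g \<Rightarrow> 'a::qv_algebra) \<Rightarrow> ('g word \<Rightarrow>\<^sub>0 qv) \<Rightarrow> 'a" where
  "poly_eval g p = (\<Sum>w\<in>Poly_Mapping.keys p. Poly_Mapping.lookup p w *\<^sub>q word_eval g w)"

lemma poly_eval_superset:
  assumes "finite A" "Poly_Mapping.keys p \<subseteq> A"
  shows "poly_eval g p = (\<Sum>w\<in>A. Poly_Mapping.lookup p w *\<^sub>q word_eval g w)"
  unfolding poly_eval_def
  by (rule sum.mono_neutral_left) (use assms in \<open>auto simp: in_keys_iff\<close>)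

lemma poly_eval_add: "poly_eval g (p + q) = poly_eval g p + poly_eval g q"
proof -
  let ?A = "Poly_Mapping.keys p \<union> Poly_Mapping.keys q"
  have "poly_eval g (p + q) = (\<Sum>w\<in>?A. Poly_Mapping.lookup (p + q) w *\<^sub>q word_eval g w)"
    by (rule poly_eval_superset) (auto simp: in_keys_iff lookup_add)
  also have "\<dots> = poly_eval g p + poly_eval g q"
    by (simp add: poly_eval_superset[of ?A p] poly_eval_superset[of ?A q] lookup_add qscale_add_left sum.distrib)
  finally show ?thesis .
qed

lemma poly_eval_single: "poly_eval g (Poly_Mapping.single w c) = c *\<^sub>q word_eval g w"
  by (subst poly_eval_superset[of "{w}"]) (auto simp: lookup_single)

lemma poly_mapping_additive_induct [case_names zero add]:
  assumes "P 0" "\<And>f a b. P f \<Longrightarrow> P (f + Poly_Mapping.single a b)"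
  shows "P (p :: 'a \<Rightarrow>\<^sub>0 'b::comm_monoid_add)"
proof (induction p rule: update_induct)
  case (update f a b)
  have "Poly_Mapping.update a b f = f + Poly_Mapping.single a b"
  proof (rule poly_mapping_eqI)
    fix k
    show "Poly_Mapping.lookup (Poly_Mapping.update a b f) k
        = Poly_Mapping.lookup (f + Poly_Mapping.single a b) k"
      using update(1)
      by (cases "k = a") (auto simp: lookup_update lookup_add lookup_single in_keys_iff)
  qed
  then show ?case using assms(2) update(3) by simp
qed (use assms in simp)

lemma poly_eval_mult: "poly_eval g (p * q) = poly_eval g p * poly_eval g q"
proof (induction p rule: poly_mapping_additive_induct)
  case zero
  then show ?case by (simp add: poly_eval_def)
next
  case (add f a b)
  have "poly_eval g (Poly_Mapping.single a b * q) = poly_eval g (Poly_Mapping.single a b) * poly_eval g q"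
  proof (induction q rule: poly_mapping_additive_induct)
    case zero
    then show ?case by (simp add: poly_eval_def)
  next
    case (add f' a' b')
    then show ?case
      by (simp add: distrib_left poly_eval_add mult_single poly_eval_single word_eval_plus qscale_linear)
  qed
  with add show ?case by (simp add: distrib_right poly_eval_add)
qed

definition free_eval :: "('g \<Rightarrow> 'a::qv_algebra) \<Rightarrow> 'g free_algebra \<Rightarrow> 'a" where
  "free_eval g x = poly_eval g (Rep_free_algebra x)"

lemma free_eval_hom: "algebra_hom (free_eval g)"
  by (simp add: algebra_hom_def free_eval_def one_free_algebra.rep_eq plus_free_algebra.rep_eq
      times_free_algebra.rep_eq qscale_free_algebra.rep_eq poly_eval_add poly_eval_mult
      poly_eval_single word_eval_0 qscale_mult_left flip: single_one)

lemma free_eval_gen: "free_eval g (gen x) = g x"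
  by (simp add: free_eval_def gen.rep_eq poly_eval_single)

lemma free_algebra_induct [case_names scalar gen add mult]:
  assumes scalar: "\<And>c. P (c *\<^sub>q 1)" and gen: "\<And>g. P (gen g)"
    and add: "\<And>x y. P x \<Longrightarrow> P y \<Longrightarrow> P (x + y)" and mult: "\<And>x y. P x \<Longrightarrow> P y \<Longrightarrow> P (x * y)"
  shows "P x"
proof -
  have word: "P (Abs_free_algebra (Poly_Mapping.single (Word xs) 1))" for xs
  proof (induction xs)
    case Nil
    have "Abs_free_algebra (Poly_Mapping.single (Word []) 1) = (1 :: 'a free_algebra)"
      by (simp add: one_free_algebra_def zero_word_def flip: single_one)
    then show ?case using scalar[of 1] by simp
  next
    case (Cons g xs)
    have "Abs_free_algebra (Poly_Mapping.single (Word (g # xs)) 1)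
        = gen g * Abs_free_algebra (Poly_Mapping.single (Word xs) 1)"
      by (simp add: Rep_free_algebra_inject[symmetric] times_free_algebra.rep_eq gen.rep_eq
          Abs_free_algebra_inverse mult_single)
    then show ?case using Cons gen mult by simp
  qed
  have "P (Abs_free_algebra p)" for p
  proof (induction p rule: poly_mapping_additive_induct)
    case zero
    have "Abs_free_algebra 0 = (0 :: 'a free_algebra)" by (simp add: zero_free_algebra_def)
    then show ?case using scalar[of 0] by simp
  next
    case (add f a b)
    obtain xs where a: "a = Word xs" by (cases a)
    have "Abs_free_algebra (f + Poly_Mapping.single a b)
       = Abs_free_algebra f + (b *\<^sub>q 1) * Abs_free_algebra (Poly_Mapping.single (Word xs) 1)"
      by (simp add: a qscale_mult_left Rep_free_algebra_inject[symmetric] plus_free_algebra.rep_eq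
          qscale_free_algebra.rep_eq Abs_free_algebra_inverse mult_single)
    then show ?case using add word scalar mult assms(3) by simp
  qed
  from this[of "Rep_free_algebra x"] show ?thesis by (simp add: Rep_free_algebra_inverse)
qed

lemma of_free_hom: "algebra_hom (of_free :: 'g::presentation free_algebra \<Rightarrow> 'g presented)"
  unfolding algebra_hom_def by (intro conjI allI; transfer) (simp_all add: presentation_eq_def relation_ideal.zero)

lemma of_free_eq_iff: "of_free x = of_free y \<longleftrightarrow> x - y \<in> relation_ideal"
  by transfer (simp add: presentation_eq_def)

lemma of_free_surj: "\<exists>y. of_free y = x"
  by transfer (metis diff_self relation_ideal.zero presentation_eq_def)

lemma relator_eq: "(l, r) \<in> relators \<Longrightarrow> of_free l = of_free r"
  unfolding of_free_eq_iff by (rule relation_ideal.rel)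

lemma presented_induct [case_names scalar gen add mult]:
  assumes "\<And>c. P (c *\<^sub>q 1)" "\<And>g. P (of_free (gen g))"
    "\<And>x y. P x \<Longrightarrow> P y \<Longrightarrow> P (x + y)" "\<And>x y. P x \<Longrightarrow> P y \<Longrightarrow> P (x * y)"
  shows "P x"
proof -
  obtain y where y: "of_free y = x" using of_free_surj by blast
  have "P (of_free y)"
    by (induction y rule: free_algebra_induct) (simp_all add: assms algebra_homD[OF of_free_hom])
  then show ?thesis using y by simp
qed

lemma presented_hom_ext:
  assumes f: "algebra_hom f" and g: "algebra_hom g"
    and gen: "\<And>x. f (of_free (gen x)) = g (of_free (gen x))"
  shows "f = g"
proof
  fix x show "f x = g x"
    by (induction x rule: presented_induct)
      (simp_all add: gen algebra_homD[OF f] algebra_homD[OF g])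
qed

text \<open>A homomorphism from the free algebra that respects the relators kills the ideal they generate, hence is constant on
the classes.\<close>

lemma presented_hom_exists:
  fixes g :: "'g::presentation \<Rightarrow> 'a::qv_algebra"
  assumes rel: "\<And>l r. (l, r) \<in> relators \<Longrightarrow> free_eval g l = free_eval g r"
  shows "\<exists>f. algebra_hom f \<and> (\<forall>y. f (of_free y) = free_eval g y)"
proof -
  note ev = algebra_homD[OF free_eval_hom[of g]]
  have ideal: "free_eval g x = 0" if "x \<in> relation_ideal" for x
    using that by induction (simp_all add: ev rel)
  define f where "f x = free_eval g (SOME y. of_free y = x)" for x
  have f: "f (of_free y) = free_eval g y" for y
  proof -
    have "of_free (SOME z. of_free z = of_free y) = of_free y"
      by (rule someI[of "\<lambda>z. of_free z = of_free y"]) simp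
    then have "free_eval g ((SOME z. of_free z = of_free y) - y) = 0"
      using ideal of_free_eq_iff by blast
    then show ?thesis by (simp add: f_def ev)
  qed
  note of = algebra_homD[OF of_free_hom, symmetric]
  have "algebra_hom f"
    unfolding algebra_hom_def
  proof (intro conjI allI)
    show "f 1 = 1" unfolding of(1) f by (rule ev)
    fix x y :: "'g presented" and c
    obtain x' y' where [symmetric, simp]: "of_free x' = x" "of_free y' = y"
      using of_free_surj by metis
    show "f (x + y) = f x + f y" "f (x * y) = f x * f y" "f (c *\<^sub>q x) = c *\<^sub>q f x"
      by (simp_all add: of f ev)
  qed
  then show ?thesis using f by blast
qed

section \<open>Serre relations\<close>

text \<open>The left-hand side of the defining relation of the q-Onsager algebra; the middle coefficient is \<open>[3]\<close>.\<close>

definition serre_cubic :: "'a::qv_algebra \<Rightarrow> 'a \<Rightarrow> 'a" where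
  "serre_cubic y x = y * y * y * x - (v * v + 1 + pv) *\<^sub>q (y * y * x * y)
     + (v * v + 1 + pv) *\<^sub>q (y * x * y * y) - x * y * y * y"

lemma qint_1: "qint 1 = 1"
  using v_minus_vi_nonzero by (simp add: qint_def power_int_minus)

lemma qint_3: "qint 3 = v * v + 1 + pv"
proof -
  have "(v - vi) * (v * v + 1 + pv) = v ^ 3 - vi ^ 3"
    by (simp add: algebra_simps eval_nat_numeral)
  moreover have "qint 3 = (v ^ 3 - vi ^ 3) / (v - vi)"
    by (simp add: qint_def power_int_minus power_inverse)
  ultimately show ?thesis
    using v_minus_vi_nonzero by (simp add: divide_eq_eq mult.commute)
qed

lemma qbinom_3: "qbinom 3 0 = 1" "qbinom 3 1 = v * v + 1 + pv" "qbinom 3 2 = v * v + 1 + pv" "qbinom 3 3 = 1"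
proof -
  have "qint 3 \<noteq> 0"
  proof
    assume "qint 3 = 0"
    then have "v * v * (v * v + 1 + pv) = 0" by (simp add: qint_3)
    then have "to_fract (monom 1 4 + monom 1 2 + 1) = (0::qv)"
      by (simp add: algebra_simps flip: v_power) (simp add: eval_nat_numeral)
    then show False using poly_in_v_nonzero[of "monom 1 4 + monom 1 2 + 1"] by (simp add: poly_monom)
  qed
  then show "qbinom 3 0 = 1" "qbinom 3 1 = v * v + 1 + pv" "qbinom 3 2 = v * v + 1 + pv" "qbinom 3 3 = 1"
    using qint_2_nonzero qint_1 qint_3
    by (simp_all add: qbinom_def numeral_2_eq_2 numeral_3_eq_3 lessThan_Suc atLeastAtMostSuc_conv)
qed

lemma serre_sum:
  "(\<Sum>r\<le>3. ((-1) ^ r * qbinom 3 r) *\<^sub>q (y ^ (3 - r) * x * y ^ r)) = serre_cubic y x"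
proof -
  have "{..3::nat} = {0, 1, 2, 3}" by auto
  then show ?thesis
    by (simp add: qbinom_3 qbinom_3(2)[unfolded One_nat_def] serre_cubic_def
        power2_eq_square power3_eq_cube mult.assoc qscale_linear)
qed

lemma BB_same: "BB B r r = 2 *\<^sub>q (B r * B (r + 1) - pv *\<^sub>q (B (r + 1) * B r))"
  unfolding qscale_2 BB_def by (simp add: algebra_simps)

lemma double_eqD: "2 *\<^sub>q x = 2 *\<^sub>q y \<Longrightarrow> x = y"
  by (simp add: qs.scale_left_imp_eq)

text \<open>The multiple of \<open>\<Theta>\<^sub>1\<close> prescribed by the quadratic relation, when \<open>x\<close> and \<open>y\<close> are consecutive terms of the sequence.\<close>

definition theta1 :: "'a::qv_algebra \<Rightarrow> 'a \<Rightarrow> 'a" where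
  "theta1 x y = (v * v) *\<^sub>q (x * y) - y * x"

lemma theta1_right: "(v * v) *\<^sub>q (y * (theta1 x y * y - y * theta1 x y)) - (theta1 x y * y - y * theta1 x y) * y
    = (v * v) *\<^sub>q serre_cubic y x"
  by (simp add: theta1_def serre_cubic_def algebra_simps qscale_linear)

lemma theta1_left: "x * (theta1 x y * x - x * theta1 x y) - (v * v) *\<^sub>q ((theta1 x y * x - x * theta1 x y) * x)
    = - ((v * v) *\<^sub>q serre_cubic x y)"
  by (simp add: theta1_def serre_cubic_def algebra_simps qscale_linear)

locale central_pair =
  fixes C Ci K Ki :: "'a::qv_algebra"
  assumes cC: "central C" and C_Ci': "C * Ci = 1" and cK: "central K" and K_Ki': "K * Ki = 1"
begin

lemma cancel: "C * (Ci * x) = x" "Ci * (C * x) = x" "K * (Ki * x) = x" "Ki * (K * x) = x"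
  using C_Ci' K_Ki' centralD[OF cC, of Ci] centralD[OF cK, of Ki] by (simp_all flip: mult.assoc)

lemma cancel_0: "C * x = 0 \<longleftrightarrow> x = 0" "K * x = 0 \<longleftrightarrow> x = 0"
  by (metis cancel mult_zero_right)+

lemma cCi: "central Ci" and cKi: "central Ki"
  using central_inverse cC C_Ci' cK K_Ki' by blast+

lemmas cl = central_left_commute[OF cC] central_left_commute[OF cK]

text \<open>Here \<open>x\<close>, \<open>y\<close>, \<open>z\<close> are consecutive terms of the sequence. Eliminating \<open>z\<close> from the quadratic relation between \<open>y\<close> and
\<open>z\<close> turns it into a cubic relation between \<open>y\<close> and \<open>x\<close>: the two differ by an invertible factor.\<close>

lemma serre_right_iff:
  assumes Kt: "K * t = C * theta1 x y" and z: "t * y - y * t = qint 2 *\<^sub>q (z - C * x)"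
  shows "y * z - pv *\<^sub>q (z * y) = pv *\<^sub>q (K * t)
    \<longleftrightarrow> serre_cubic y x = - ((vi * (qint 2)\<^sup>2) *\<^sub>q ((y * x - x * y) * K))"
proof -
  let ?D1 = "y * z - pv *\<^sub>q (z * y) - pv *\<^sub>q (K * t)"
  let ?D2 = "serre_cubic y x + (vi * (qint 2)\<^sup>2) *\<^sub>q ((y * x - x * y) * K)"
  let ?T = "theta1 x y"
  have "K * (t * y - y * t) = C * (?T * y - y * ?T)"
  proof -
    have "K * (t * y - y * t) = (K * t) * y - y * (K * t)"
      by (simp add: right_diff_distrib mult.assoc cl(2)[of y])
    then show ?thesis unfolding Kt by (simp add: right_diff_distrib mult.assoc cl(1)[of y])
  qed
  then have Kz: "qint 2 *\<^sub>q (K * z) = C * (?T * y - y * ?T) + qint 2 *\<^sub>q (C * (K * x))"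
    unfolding z by (simp add: algebra_simps qscale_linear cl(1)[of K])
  have "(v * v * qint 2) *\<^sub>q (K * ?D1)
      = (v * v) *\<^sub>q (y * (qint 2 *\<^sub>q (K * z))) - (qint 2 *\<^sub>q (K * z)) * y - qint 2 *\<^sub>q (K * (K * t))"
    by (simp add: algebra_simps qscale_linear cl(2)[of y])
  also have "\<dots> = C * (((v * v) *\<^sub>q (y * (?T * y - y * ?T)) - (?T * y - y * ?T) * y)
      + qint 2 *\<^sub>q (K * ((v * v) *\<^sub>q (y * x) - x * y - ?T)))"
    unfolding Kz Kt by (simp add: algebra_simps qscale_linear cl(1)[of y] cl(2)[of y] cl(1)[of K])
  also have "(v * v) *\<^sub>q (y * x) - x * y - ?T = (v * v + 1) *\<^sub>q (y * x - x * y)"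
    by (simp add: theta1_def algebra_simps qscale_linear)
  also have "((v * v) *\<^sub>q (y * (?T * y - y * ?T)) - (?T * y - y * ?T) * y)
      + qint 2 *\<^sub>q (K * ((v * v + 1) *\<^sub>q (y * x - x * y))) = (v * v) *\<^sub>q ?D2"
  proof -
    have "v * v * (vi * (qint 2)\<^sup>2) = qint 2 * (v * v + 1)"
      by (simp add: qint_2 power2_eq_square algebra_simps)
    then show ?thesis
      unfolding theta1_right qscale_add_right qscale_mult_right qscale_qscale
      by (simp only: centralD[OF cK, of "y * x - x * y"])
  qed
  finally have "?D1 = 0 \<longleftrightarrow> ?D2 = 0"
    using v_nonzero qint_2_nonzero by (metis cancel_0 mult_eq_0_iff qs.scale_eq_0_iff)
  then show ?thesis by (simp add: eq_neg_iff_add_eq_0)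
qed

text \<open>The mirror image, with \<open>w\<close> the term before \<open>x\<close>.\<close>

lemma serre_left_iff:
  assumes Kt: "K * t = C * theta1 x y" and w: "t * x - x * t = qint 2 *\<^sub>q (y - C * w)"
  shows "w * x - pv *\<^sub>q (x * w) = pv *\<^sub>q (Ci * (Ci * (K * t)))
    \<longleftrightarrow> C * serre_cubic x y = - ((vi * (qint 2)\<^sup>2) *\<^sub>q ((x * y - y * x) * K))"
proof -
  let ?D1 = "w * x - pv *\<^sub>q (x * w) - pv *\<^sub>q (Ci * (Ci * (K * t)))"
  let ?D2 = "C * serre_cubic x y + (vi * (qint 2)\<^sup>2) *\<^sub>q ((x * y - y * x) * K)"
  let ?T = "theta1 x y"
  have "K * (t * x - x * t) = C * (?T * x - x * ?T)"
  proof -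
    have "K * (t * x - x * t) = (K * t) * x - x * (K * t)"
      by (simp add: right_diff_distrib mult.assoc cl(2)[of x])
    then show ?thesis unfolding Kt by (simp add: right_diff_distrib mult.assoc cl(1)[of x])
  qed
  then have Kw: "qint 2 *\<^sub>q (C * (K * w)) = qint 2 *\<^sub>q (K * y) - C * (?T * x - x * ?T)"
    unfolding w by (simp add: algebra_simps qscale_linear cl(1)[of K])
  have "(v * v * qint 2) *\<^sub>q (C * (K * ?D1))
      = (v * v) *\<^sub>q ((qint 2 *\<^sub>q (C * (K * w))) * x) - x * (qint 2 *\<^sub>q (C * (K * w)))
        - qint 2 *\<^sub>q (Ci * (K * (K * t)))"
    by (simp add: algebra_simps qscale_linear cl(1)[of x] cl(2)[of x] cancel central_left_commute[OF cCi, of K])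
  also have "\<dots> = - (C * (x * (- (?T * x - x * ?T)) - (v * v) *\<^sub>q ((- (?T * x - x * ?T)) * x))
      + qint 2 *\<^sub>q (K * (- ((v * v) *\<^sub>q (y * x) - x * y - ?T))))"
    unfolding Kw Kt by (simp add: algebra_simps qscale_linear cl(1)[of x] cl(2)[of x] cl(1)[of K] cancel)
  also have "\<dots> = C * (x * (?T * x - x * ?T) - (v * v) *\<^sub>q ((?T * x - x * ?T) * x))
      - qint 2 *\<^sub>q (K * (- ((v * v) *\<^sub>q (y * x) - x * y - ?T)))"
    by (simp add: algebra_simps qscale_linear)
  also have "- ((v * v) *\<^sub>q (y * x) - x * y - ?T) = (v * v + 1) *\<^sub>q (x * y - y * x)"
    by (simp add: theta1_def algebra_simps qscale_linear)
  also have "C * (x * (?T * x - x * ?T) - (v * v) *\<^sub>q ((?T * x - x * ?T) * x))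
      - qint 2 *\<^sub>q (K * ((v * v + 1) *\<^sub>q (x * y - y * x))) = - ((v * v) *\<^sub>q ?D2)"
  proof -
    have "v * v * (vi * (qint 2)\<^sup>2) = qint 2 * (v * v + 1)"
      by (simp add: qint_2 power2_eq_square algebra_simps)
    then show ?thesis
      unfolding theta1_left qscale_add_right qscale_mult_right qscale_qscale
      by (simp add: centralD[OF cK, of "x * y - y * x"] qscale_mult_right)
  qed
  finally have "?D1 = 0 \<longleftrightarrow> ?D2 = 0"
    using v_nonzero qint_2_nonzero
    by (metis cancel_0 mult_eq_0_iff qs.scale_eq_0_iff neg_equal_0_iff_equal)
  then show ?thesis by (simp add: eq_neg_iff_add_eq_0)
qed

end

text \<open>The two halves of the sequence generated by consecutive terms \<open>x\<close>, \<open>y\<close> under the derivation of \<open>t\<close>.\<close>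

fun seq_up :: "'a::qv_algebra \<Rightarrow> 'a \<Rightarrow> 'a \<Rightarrow> 'a \<Rightarrow> nat \<Rightarrow> 'a" where
  "seq_up x y t C 0 = y"
| "seq_up x y t C (Suc 0) = C * x + (1 / qint 2) *\<^sub>q (t * y - y * t)"
| "seq_up x y t C (Suc (Suc n)) = C * seq_up x y t C n
     + (1 / qint 2) *\<^sub>q (t * seq_up x y t C (Suc n) - seq_up x y t C (Suc n) * t)"

fun seq_down :: "'a::qv_algebra \<Rightarrow> 'a \<Rightarrow> 'a \<Rightarrow> 'a \<Rightarrow> nat \<Rightarrow> 'a" where
  "seq_down x y t Ci 0 = y"
| "seq_down x y t Ci (Suc 0) = x"
| "seq_down x y t Ci (Suc (Suc n)) = Ci * (seq_down x y t Ci n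
     - (1 / qint 2) *\<^sub>q (t * seq_down x y t Ci (Suc n) - seq_down x y t Ci (Suc n) * t))"

context central_pair
begin

definition seqB :: "'a \<Rightarrow> 'a \<Rightarrow> int \<Rightarrow> 'a" where
  "seqB x y r = (if 0 \<le> r then seq_up x y (C * (Ki * theta1 x y)) C (nat r)
     else seq_down x y (C * (Ki * theta1 x y)) Ci (nat (- r)))"

lemma seqB_shift:
  "(C * (Ki * theta1 x y)) * seqB x y r - seqB x y r * (C * (Ki * theta1 x y))
    = qint 2 *\<^sub>q (seqB x y (r + 1) - C * seqB x y (r - 1))"
proof -
  let ?t = "C * (Ki * theta1 x y)"
  consider n where "r = int (Suc n)" | "r = 0" | n where "r = - int (Suc n)"
    by (metis int_cases int_cases2 not0_implies_Suc of_nat_0 minus_zero)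
  then show ?thesis
  proof cases
    case (1 n)
    then have "nat r = Suc n" "nat (r + 1) = Suc (Suc n)" "nat (r - 1) = n" by simp_all
    then show ?thesis using 1 qint_2_nonzero by (simp add: seqB_def qscale_linear del: of_nat_Suc)
  next
    case 2
    then show ?thesis using qint_2_nonzero by (simp add: seqB_def qscale_linear)
  next
    case (3 n)
    have e: "nat (- r) = Suc n" "nat (- (r - 1)) = Suc (Suc n)" "r < 0" "r - 1 < 0"
      using 3 by simp_all
    have "seqB x y (r + 1) = seq_down x y ?t Ci n"
    proof (cases "n = 0")
      case True
      then show ?thesis using 3 by (simp add: seqB_def)
    next
      case False
      then have "r + 1 < 0" "nat (- (r + 1)) = n" using 3 by simp_all
      then show ?thesis by (simp add: seqB_def)
    qed
    then show ?thesis using e qint_2_nonzero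
      by (simp add: seqB_def qscale_linear cancel)
  qed
qed

theorem drinfeld_data_of_serre:
  assumes R: "serre_cubic y x = - ((vi * (qint 2)\<^sup>2) *\<^sub>q ((y * x - x * y) * K))"
    and L: "C * serre_cubic x y = - ((vi * (qint 2)\<^sup>2) *\<^sub>q ((x * y - y * x) * K))"
  shows "drinfeld_data (seqB x y) (C * (Ki * theta1 x y)) C Ci K Ki"
proof -
  let ?t = "C * (Ki * theta1 x y)"
  let ?B = "seqB x y"
  interpret shift_data ?B ?t C Ci
    by unfold_locales (rule cC C_Ci' seqB_shift)+
  have B: "?B (-1) = x" "?B 0 = y" by (simp_all add: seqB_def)
  have Kt: "K * ?t = C * theta1 x y" by (simp add: cl(1)[of K] cancel)
  have z: "?t * y - y * ?t = qint 2 *\<^sub>q (?B 1 - C * x)"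
    using seqB_shift[of x y 0] by (simp add: B)
  have w: "?t * x - x * ?t = qint 2 *\<^sub>q (y - C * ?B (-2))"
    using seqB_shift[of x y "-1"] by (simp add: B)
  note BB = BB_same[of ?B]
  have BB0: "BB ?B 0 0 = (2 * pv) *\<^sub>q (K * ?t)"
    using serre_right_iff[OF Kt z] R BB[of 0] by (simp add: B qscale_linear)
  have BBm2: "BB ?B (-2) (-2) = (2 * pv) *\<^sub>q (Ci * (Ci * (K * ?t)))"
    using serre_left_iff[OF Kt w] L BB[of "-2"] by (simp add: B qscale_linear)
  have BBm1: "BB ?B (-1) (-1) = (2 * pv) *\<^sub>q (Ci * (K * ?t))"
    using BB[of "-1"] unfolding Kt by (simp add: B qscale_linear theta1_def cancel)
  show ?thesis
    by unfold_locales
      (use cK K_Ki' BB0 BBm1 BBm2 in \<open>simp_all add: U_def cancel qscale_linear\<close>)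
qed

end

lemma serre_cubic_central:
  assumes "central k"
  shows "serre_cubic y (k * x) = k * serre_cubic y x" "serre_cubic (k * y) x = k * (k * (k * serre_cubic y x))"
  by (simp_all add: serre_cubic_def algebra_simps qscale_linear central_left_commute[OF assms, of x]
      central_left_commute[OF assms, of y])

context drinfeld_data
begin

sublocale cp: central_pair C Ci K Ki
  by unfold_locales (rule central_C C_Ci central_K K_Ki)+

lemma t_theta1: "t = C * (Ki * theta1 (B (-1)) (B 0))"
proof -
  have "BB B (-1) (-1) = (2 * pv) *\<^sub>q (Ci * (K * t))"
    using BB_step_down[OF U_0] BB_0 by (simp add: qscale_linear)
  moreover have "BB B (-1) (-1) = (2 * pv) *\<^sub>q theta1 (B (-1)) (B 0)"
  proof -
    have "pv *\<^sub>q theta1 (B (-1)) (B 0) = B (-1) * B 0 - pv *\<^sub>q (B 0 * B (-1))"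
      by (simp add: theta1_def qscale_linear mult.assoc)
    moreover have "(2 * pv) *\<^sub>q theta1 (B (-1)) (B 0) = 2 *\<^sub>q pv *\<^sub>q theta1 (B (-1)) (B 0)"
      by (simp only: qscale_qscale)
    ultimately show ?thesis using BB_same[of B "-1"] by simp
  qed
  ultimately have "Ci * (K * t) = theta1 (B (-1)) (B 0)"
    using v_nonzero by simp
  then show ?thesis
    by (metis C_Ci_cancel(1) K_Ki_cancel(2) central_left_commute[OF central_C])
qed

lemma serre_right: "serre_cubic (B 0) (B (-1)) = - ((vi * (qint 2)\<^sup>2) *\<^sub>q ((B 0 * B (-1) - B (-1) * B 0) * K))"
proof -
  have "K * t = C * theta1 (B (-1)) (B 0)"
    by (subst t_theta1) (simp add: central_left_commute[OF central_C, of K])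
  moreover have "t * B 0 - B 0 * t = qint 2 *\<^sub>q (B 1 - C * B (-1))"
    using t_B[of 0] by simp
  moreover have "B 0 * B 1 - pv *\<^sub>q (B 1 * B 0) = pv *\<^sub>q (K * t)"
  proof -
    have "2 *\<^sub>q (B 0 * B 1 - pv *\<^sub>q (B 1 * B 0)) = 2 *\<^sub>q (pv *\<^sub>q (K * t))"
      using BB_0 BB_same[of B 0] by (simp add: qscale_qscale)
    then show ?thesis by (rule double_eqD)
  qed
  ultimately show ?thesis using cp.serre_right_iff by blast
qed

lemma serre_left: "C * serre_cubic (B (-1)) (B 0) = - ((vi * (qint 2)\<^sup>2) *\<^sub>q ((B (-1) * B 0 - B 0 * B (-1)) * K))"
proof -
  have "K * t = C * theta1 (B (-1)) (B 0)"
    by (subst t_theta1) (simp add: central_left_commute[OF central_C, of K])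
  moreover have "t * B (-1) - B (-1) * t = qint 2 *\<^sub>q (B 0 - C * B (-2))"
    using t_B[of "-1"] by simp
  moreover have "B (-2) * B (-1) - pv *\<^sub>q (B (-1) * B (-2)) = pv *\<^sub>q (Ci * (Ci * (K * t)))"
  proof -
    have "BB B (-2) (-2) = (2 * pv) *\<^sub>q (Ci * (Ci * (K * t)))"
      using BB_step_down[OF U_0] BB_step_down[OF U_m1] BB_0 by (simp add: qscale_linear)
    then have "2 *\<^sub>q (B (-2) * B (-1) - pv *\<^sub>q (B (-1) * B (-2))) = 2 *\<^sub>q (pv *\<^sub>q (Ci * (Ci * (K * t))))"
      using BB_same[of B "-2"] by (simp add: qscale_qscale)
    then show ?thesis by (rule double_eqD)
  qed
  ultimately show ?thesis using cp.serre_left_iff by blast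
qed

text \<open>The factor of \<open>t\<close> in \<open>BB B r r\<close> is \<open>C\<^sup>r\<close> times the one in \<open>BB B 0 0\<close>, so \<open>C\<^sup>r K\<close> takes the place of \<open>K\<close>.\<close>

lemma shifted: "drinfeld_data (\<lambda>i. B (i + r)) t C Ci (Cz r * K) (Cz (- r) * Ki)"
proof -
  interpret s: shift_data "\<lambda>i. B (i + r)" t C Ci
    by unfold_locales (use central_C C_Ci t_B in \<open>simp_all add: algebra_simps\<close>)
  have BB: "BB (\<lambda>i. B (i + r)) i j = BB B (i + r) (j + r)" for i j
    by (simp add: BB_def algebra_simps)
  have "BB B r r = (2 * pv) *\<^sub>q (Cz r * (K * t))"
    using BB_eq[of 0 r 0] by (simp add: BB_0 qscale_linear)
  moreover have "s.U i i = 0" for i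
    using U_eq_0[of "i + r" "i + r"] by (simp add: s.U_def U_def BB algebra_simps)
  moreover have "Cz r * K * (Cz (- r) * Ki) = 1"
    using Cz_minus[of r] centralD[OF central_Cz, of "Cz (- r)" r]
    by (simp add: mult.assoc central_left_commute[OF central_Cz, of K] K_Ki)
  ultimately show ?thesis
    by unfold_locales (simp_all add: BB mult.assoc central_mult[OF central_Cz central_K])
qed

end

section \<open>Root vectors of the q-Onsager algebra\<close>

lemma serre_cubic_hom: "algebra_hom f \<Longrightarrow> f (serre_cubic y x) = serre_cubic (f y) (f x)"
  by (simp add: serre_cubic_def algebra_homD)

lemma v_powi_m1: "v powi (-1) = vi"
  by (simp add: power_int_minus)

lemma oK_oKinv: "oK i * oKinv i = 1" "oKinv i * oK i = 1"
proof -
  have "(gen (GK i) * gen (GKinv i), 1) \<in> relators" "(gen (GKinv i) * gen (GK i), 1) \<in> relators"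
    by (auto simp: relators_onsager_gen_def)
  from this[THEN relator_eq] show "oK i * oKinv i = 1" "oKinv i * oK i = 1"
    by (simp_all add: oK_def oKinv_def algebra_homD[OF of_free_hom])
qed

lemma central_oK: "central (oK i)"
  unfolding central_def
proof
  fix x show "oK i * x = x * oK i"
  proof (induction x rule: presented_induct)
    case (gen g)
    have "(gen (GK i) * gen g, gen g * gen (GK i)) \<in> relators"
      by (auto simp: relators_onsager_gen_def)
    from relator_eq[OF this] show ?case by (simp add: oK_def algebra_homD[OF of_free_hom])
  next
    case (mult x y)
    then show ?case by (rule commute_mult)
  qed (simp_all add: qscale_linear algebra_simps)
qed

lemma onsager_serre: "serre_cubic (oB i) (oB (other i))
  = - ((vi * (qint 2)\<^sup>2) *\<^sub>q ((oB i * oB (other i) - oB (other i) * oB i) * oK i))"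
proof -
  have "((\<Sum>r\<le>3. ((-1) ^ r * qbinom 3 r) *\<^sub>q (gen (GB i) ^ (3 - r) * gen (GB (other i)) * gen (GB i) ^ r)),
       (- (v powi (-1)) * (qint 2)\<^sup>2) *\<^sub>q
            ((gen (GB i) * gen (GB (other i)) - gen (GB (other i)) * gen (GB i)) * gen (GK i))) \<in> relators"
    by (auto simp: relators_onsager_gen_def)
  from relator_eq[OF this] show ?thesis
    unfolding serre_sum v_powi_m1
    by (simp add: serre_cubic_hom[OF of_free_hom] oB_def oK_def algebra_homD[OF of_free_hom] qs.scale_minus_left)
qed

lemma onsager_hom_exists:
  fixes b k ki :: "node \<Rightarrow> 'a::qv_algebra"
  assumes k: "\<And>i. central (k i)" "\<And>i. k i * ki i = 1"
    and serre: "\<And>i. serre_cubic (b i) (b (other i))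
      = - ((vi * (qint 2)\<^sup>2) *\<^sub>q ((b i * b (other i) - b (other i) * b i) * k i))"
  shows "\<exists>f. algebra_hom f \<and> (\<forall>i. f (oB i) = b i \<and> f (oK i) = k i \<and> f (oKinv i) = ki i)"
proof -
  define g where "g x = (case x of GB i \<Rightarrow> b i | GK i \<Rightarrow> k i | GKinv i \<Rightarrow> ki i)" for x
  note ev = algebra_homD[OF free_eval_hom[of g]] free_eval_gen[of g]
  have g: "g (GB i) = b i" "g (GK i) = k i" "g (GKinv i) = ki i" for i by (simp_all add: g_def)
  have ki: "ki i * k i = 1" for i
    using k(2)[of i] centralD[OF k(1), of "ki i" i] by simp
  have "free_eval g l = free_eval g r" if "(l, r) \<in> relators" for l r
    using that unfolding relators_onsager_gen_def serre_sum v_powi_m1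
    by (auto simp: ev g k ki centralD[OF k(1)] serre_cubic_hom[OF free_eval_hom] serre qs.scale_minus_left)
  from presented_hom_exists[of g, OF this] obtain f where f: "algebra_hom f" "\<And>y. f (of_free y) = free_eval g y"
    by blast
  then show ?thesis
    by (intro exI[of _ f]) (simp add: oB_def oK_def oKinv_def ev g)
qed

lemma inverse_unique: "a * b = 1 \<Longrightarrow> b * a = 1 \<Longrightarrow> a * c = 1 \<Longrightarrow> b = c" for a :: "'a::monoid_mult"
  by (metis mult.assoc mult_1 mult_1_right)

lemma onsager_hom_ext:
  assumes f: "algebra_hom f" and g: "algebra_hom g"
    and B: "\<And>i. f (oB i) = g (oB i)" and K: "\<And>i. f (oK i) = g (oK i)"
  shows "f = g"
proof (rule presented_hom_ext[OF f g])
  have Kinv: "f (oKinv i) = g (oKinv i)" for i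
  proof (rule inverse_unique)
    show "f (oK i) * f (oKinv i) = 1" "f (oKinv i) * f (oK i) = 1" "f (oK i) * g (oKinv i) = 1"
      unfolding algebra_homD(3)[OF f, symmetric]
      by (simp_all add: oK_oKinv algebra_homD[OF f] K)
        (simp add: oK_oKinv algebra_homD[OF g] flip: algebra_homD(3)[OF g])
  qed
  fix x show "f (of_free (gen x)) = g (of_free (gen x))"
    using B K Kinv by (cases x) (simp_all add: oB_def oK_def oKinv_def)
qed

lemma algebra_isoI:
  assumes "algebra_hom f" "f \<circ> g = id" "g \<circ> f = id"
  shows "algebra_iso f"
  using assms o_bij[of g f] by (simp add: algebra_iso_def)

context drinfeld_data
begin

text \<open>The relation for \<open>B\<^sub>1\<close> is \<open>serre_right\<close> and the one for \<open>B\<^sub>0\<close> is \<open>serre_left\<close>, both multiplied by central factors because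
\<open>B\<^sub>0 = C K\<^sup>-\<^sup>1 B (-1)\<close>.\<close>

lemma onsager_hom: "\<exists>f. algebra_hom f \<and> f (oB N1) = B 0 \<and> f (oB N0) = C * (Ki * B (-1))
   \<and> f (oK N1) = K \<and> f (oK N0) = C * Ki \<and> f (oKinv N1) = Ki \<and> f (oKinv N0) = Ci * K"
proof -
  define b where "b i = (case i of N0 \<Rightarrow> C * Ki * B (-1) | N1 \<Rightarrow> B 0)" for i
  define k where "k i = (case i of N0 \<Rightarrow> C * Ki | N1 \<Rightarrow> K)" for i
  define ki where "ki i = (case i of N0 \<Rightarrow> Ci * K | N1 \<Rightarrow> Ki)" for i
  have ck: "central (C * Ki)" by (rule central_mult[OF central_C central_Ki])
  note cl = central_left_commute[OF ck] centralD[OF ck] serre_cubic_central[OF ck]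
  let ?c = "vi * (qint 2)\<^sup>2"
  have "\<exists>f. algebra_hom f \<and> (\<forall>i. f (oB i) = b i \<and> f (oK i) = k i \<and> f (oKinv i) = ki i)"
  proof (rule onsager_hom_exists)
    show "central (k i)" for i
      using ck central_K by (cases i) (simp_all add: k_def)
    show "k i * ki i = 1" for i
      by (cases i) (simp_all add: k_def ki_def mult.assoc K_Ki C_Ci central_left_commute[OF central_Ci, of Ki] Ki_K)
    show "serre_cubic (b i) (b (other i)) = - (?c *\<^sub>q ((b i * b (other i) - b (other i) * b i) * k i))" for i
    proof (cases i)
      case N1
      have "serre_cubic (b i) (b (other i)) = C * Ki * - (?c *\<^sub>q ((B 0 * B (-1) - B (-1) * B 0) * K))"
        using N1 serre_right by (simp add: b_def cl(3))
      also have "\<dots> = - (?c *\<^sub>q ((B 0 * (C * Ki * B (-1)) - C * Ki * B (-1) * B 0) * K))"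
        by (simp add: cl(1)[of "B 0"] qscale_mult_right mult.assoc[of "C * Ki"] left_diff_distrib right_diff_distrib
            del: mult.assoc)
      finally show ?thesis using N1 by (simp add: b_def k_def)
    next
      case N0
      let ?x = "B (-1)" and ?y = "B 0"
      have "C * Ki * serre_cubic ?x ?y = Ki * - (?c *\<^sub>q ((?x * ?y - ?y * ?x) * K))"
        unfolding serre_left[symmetric] by (simp add: mult.assoc central_left_commute[OF central_C, of Ki])
      also have "\<dots> = - (?c *\<^sub>q (?x * ?y - ?y * ?x))"
        by (simp add: qscale_mult_right centralD[OF central_K, of "?x * ?y - ?y * ?x"])
      finally have "serre_cubic (b i) (b (other i)) = (C * Ki) * ((C * Ki) * - (?c *\<^sub>q (?x * ?y - ?y * ?x)))"
        using N0 by (simp add: b_def cl(4))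
      also have "\<dots> = - (?c *\<^sub>q ((C * Ki * ?x * ?y - ?y * (C * Ki * ?x)) * (C * Ki)))"
        by (simp only: cl(1)[of ?y] cl(2) mult.assoc[of "C * Ki"] qscale_mult_right mult_minus_right right_diff_distrib)
      finally show ?thesis using N0 by (simp add: b_def k_def)
    qed
  qed
  then obtain f where "algebra_hom f" "\<forall>i. f (oB i) = b i \<and> f (oK i) = k i \<and> f (oKinv i) = ki i" by blast
  then show ?thesis
    by (intro exI[of _ f]) (simp add: b_def k_def ki_def mult.assoc)
qed

lemma B_next: "B (r + 1) = C * B (r - 1) + (1 / qint 2) *\<^sub>q (t * B r - B r * t)"
  unfolding t_B using qint_2_nonzero by (simp add: qscale_qscale)

lemma B_prev: "B (r - 1) = Ci * (B (r + 1) - (1 / qint 2) *\<^sub>q (t * B r - B r * t))"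
  unfolding t_B using qint_2_nonzero by (simp add: qscale_qscale)

lemma generated_by_two:
  assumes P: "P (B (-1))" "P (B 0)"
    and up: "\<And>r. P (B (r - 1)) \<Longrightarrow> P (B r) \<Longrightarrow> P (C * B (r - 1) + (1 / qint 2) *\<^sub>q (t * B r - B r * t))"
    and down: "\<And>r. P (B (r + 1)) \<Longrightarrow> P (B r) \<Longrightarrow> P (Ci * (B (r + 1) - (1 / qint 2) *\<^sub>q (t * B r - B r * t)))"
  shows "P (B r)"
proof -
  have "P (B (r - 1)) \<and> P (B r)"
  proof (induction r rule: int_induct[of _ 0])
    case (step1 i)
    then show ?case using up[of i] by (simp add: B_next[symmetric])
  next
    case (step2 i)
    then show ?case using down[of "i - 1"] B_prev[of "i - 1"] by simp
  qed (use P in simp)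
  then show ?thesis ..
qed

end

definition oC_inv :: onsager where "oC_inv = oKinv N0 * oKinv N1"
text \<open>The root vector that precedes \<open>B\<^sub>1\<close>.\<close>

definition oBm :: onsager where "oBm = oKinv N0 * oB N0"

lemma oKdelta_central: "central oKdelta"
  unfolding oKdelta_def by (intro central_mult central_oK)

lemma oKinv_central: "central (oKinv i)"
  by (rule central_inverse[OF central_oK oK_oKinv(1)])

lemma oK_cancel: "oK i * (oKinv i * x) = x" "oKinv i * (oK i * x) = x"
  by (simp_all add: oK_oKinv flip: mult.assoc)

lemma oB_N0: "oB N0 = oK N0 * oBm"
  by (simp add: oBm_def oK_cancel)

lemma oK_N0: "oK N0 = oKdelta * oKinv N1"
  by (simp add: oKdelta_def mult.assoc oK_oKinv)

global_interpretation onsager: central_pair oKdelta oC_inv "oK N1" "oKinv N1"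
  defines oseq = "onsager.seqB oBm (oB N1)"
proof
  show "oKdelta * oC_inv = 1"
    by (simp add: oKdelta_def oC_inv_def mult.assoc oK_oKinv oK_cancel
        central_left_commute[OF oKinv_central, of "oK N1"])
qed (simp_all add: oKdelta_central central_oK oK_oKinv)

global_interpretation ons: drinfeld_data oseq "oKdelta * (oKinv N1 * theta1 oBm (oB N1))" oKdelta oC_inv "oK N1" "oKinv N1"
  unfolding oseq_def
proof (rule onsager.drinfeld_data_of_serre)
  let ?c = "vi * (qint 2)\<^sup>2"
  note c0 = central_left_commute[OF central_oK[of N0]]
  have "oK N0 * serre_cubic (oB N1) oBm = oK N0 * - (?c *\<^sub>q ((oB N1 * oBm - oBm * oB N1) * oK N1))"
    using onsager_serre[of N1]
    by (simp add: oB_N0 serre_cubic_central[OF central_oK] right_diff_distrib left_diff_distrib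
        qscale_mult_right c0[of "oB N1"] mult.assoc)
  then show "serre_cubic (oB N1) oBm = - (?c *\<^sub>q ((oB N1 * oBm - oBm * oB N1) * oK N1))"
    by (metis oK_cancel(2))
  let ?k = "oK N0" and ?x = oBm and ?y = "oB N1"
  have "?k * (?k * (?k * serre_cubic ?x ?y)) = ?k * (?k * - (?c *\<^sub>q (?x * ?y - ?y * ?x)))"
  proof -
    have "?k * (?k * (?k * serre_cubic ?x ?y)) = - (?c *\<^sub>q ((?k * ?x * ?y - ?y * (?k * ?x)) * ?k))"
      using onsager_serre[of N0] by (simp add: oB_N0 serre_cubic_central[OF central_oK])
    also have "\<dots> = ?k * (?k * - (?c *\<^sub>q (?x * ?y - ?y * ?x)))"
      by (simp only: c0[of ?y] centralD[OF central_oK[of N0]] mult.assoc[of ?k] qscale_mult_right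
          mult_minus_right right_diff_distrib)
    finally show ?thesis .
  qed
  then have "?k * serre_cubic ?x ?y = - (?c *\<^sub>q (?x * ?y - ?y * ?x))"
    by (metis oK_cancel(2))
  then have "oK N1 * (?k * serre_cubic ?x ?y) = oK N1 * - (?c *\<^sub>q (?x * ?y - ?y * ?x))"
    by simp
  then show "oKdelta * serre_cubic ?x ?y = - (?c *\<^sub>q ((?x * ?y - ?y * ?x) * oK N1))"
    by (simp add: oKdelta_def mult.assoc central_left_commute[OF central_oK[of N1], of ?k] qscale_mult_right
        centralD[OF central_oK[of N1], of "?x * ?y - ?y * ?x"])
qed

lemma oseq_values: "oseq 0 = oB N1" "oseq (-1) = oBm"
  by (simp_all add: oseq_def onsager.seqB_def)

definition otheta1 :: onsager where "otheta1 = oKdelta * (oKinv N1 * theta1 oBm (oB N1))"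

definition shift_hom :: "int \<Rightarrow> onsager \<Rightarrow> onsager" where
  "shift_hom r = (SOME f. algebra_hom f \<and> f (oB N1) = oseq r
     \<and> f (oB N0) = oKdelta * (ons.Cz (- r) * oKinv N1 * oseq (r - 1))
     \<and> f (oK N1) = ons.Cz r * oK N1 \<and> f (oK N0) = oKdelta * (ons.Cz (- r) * oKinv N1)
     \<and> f (oKinv N1) = ons.Cz (- r) * oKinv N1 \<and> f (oKinv N0) = oC_inv * (ons.Cz r * oK N1))"

lemma shift_hom: "algebra_hom (shift_hom r)" "shift_hom r (oB N1) = oseq r"
  "shift_hom r (oB N0) = oKdelta * (ons.Cz (- r) * oKinv N1 * oseq (r - 1))"
  "shift_hom r (oK N1) = ons.Cz r * oK N1" "shift_hom r (oK N0) = oKdelta * (ons.Cz (- r) * oKinv N1)"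
  "shift_hom r (oKinv N1) = ons.Cz (- r) * oKinv N1" "shift_hom r (oKinv N0) = oC_inv * (ons.Cz r * oK N1)"
proof -
  interpret s: drinfeld_data "\<lambda>i. oseq (i + r)" "oKdelta * (oKinv N1 * theta1 oBm (oB N1))" oKdelta oC_inv
    "ons.Cz r * oK N1" "ons.Cz (- r) * oKinv N1"
    by (rule ons.shifted)
  note someI_ex[OF s.onsager_hom, simplified, folded shift_hom_def]
  then show "algebra_hom (shift_hom r)" "shift_hom r (oB N1) = oseq r"
  "shift_hom r (oB N0) = oKdelta * (ons.Cz (- r) * oKinv N1 * oseq (r - 1))"
  "shift_hom r (oK N1) = ons.Cz r * oK N1" "shift_hom r (oK N0) = oKdelta * (ons.Cz (- r) * oKinv N1)"
  "shift_hom r (oKinv N1) = ons.Cz (- r) * oKinv N1" "shift_hom r (oKinv N0) = oC_inv * (ons.Cz r * oK N1)"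
    by simp_all
qed

text \<open>The generators expressed through the data of \<open>drinfeld_data\<close>.\<close>

lemma onsager_hom_ext_Bm:
  assumes f: "algebra_hom f" and g: "algebra_hom g"
    and "f (oB N1) = g (oB N1)" "f oBm = g oBm" "f (oK N1) = g (oK N1)" "f oKdelta = g oKdelta"
  shows "f = g"
proof (rule onsager_hom_ext[OF f g])
  note f' = algebra_homD[OF f] and g' = algebra_homD[OF g]
  have Kinv: "f (oKinv N1) = g (oKinv N1)"
  proof (rule inverse_unique)
    show "f (oK N1) * f (oKinv N1) = 1" "f (oKinv N1) * f (oK N1) = 1"
      by (simp_all add: oK_oKinv f' flip: f'(3))
    show "f (oK N1) * g (oKinv N1) = 1"
      unfolding assms(5) by (simp add: oK_oKinv g' flip: g'(3))
  qed
  show K: "f (oK i) = g (oK i)" for i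
    using assms Kinv by (cases i) (simp_all add: oK_N0 f' g')
  show "f (oB i) = g (oB i)" for i
    using assms K by (cases i) (simp_all add: oB_N0 f' g')
qed

lemma shift_hom_oKdelta: "shift_hom r oKdelta = oKdelta"
proof -
  have "shift_hom r oKdelta = oKdelta * (ons.Cz (- r) * oKinv N1) * (ons.Cz r * oK N1)"
    unfolding oKdelta_def[symmetric]
    by (subst oKdelta_def) (simp add: algebra_homD[OF shift_hom(1)] shift_hom)
  also have "\<dots> = oKdelta * (ons.Cz (- r) * ons.Cz r)"
    by (simp add: mult.assoc central_left_commute[OF ons.central_Cz, of "oKinv N1"] oK_oKinv)
  finally show ?thesis by (simp add: ons.Cz_minus)
qed

lemma shift_hom_Cz: "shift_hom r (ons.Cz n) = ons.Cz n"
proof -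
  note h = algebra_homD[OF shift_hom(1)]
  have "shift_hom r oC_inv = oC_inv"
  proof (rule inverse_unique)
    show "oKdelta * shift_hom r oC_inv = 1" "shift_hom r oC_inv * oKdelta = 1"
      by (subst shift_hom_oKdelta[of r, symmetric], simp add: ons.C_Ci ons.Ci_C h flip: h(3))+
  qed (rule ons.C_Ci)
  then show ?thesis
    unfolding ons.Cz_def zpow_def by (simp add: h shift_hom_oKdelta)
qed

lemma shift_hom_oBm: "shift_hom r oBm = oseq (r - 1)"
proof -
  have "shift_hom r oBm = oC_inv * (ons.Cz r * oK N1) * (oKdelta * (ons.Cz (- r) * oKinv N1 * oseq (r - 1)))"
    by (simp add: oBm_def algebra_homD[OF shift_hom(1)] shift_hom)
  also have "\<dots> = oC_inv * (oKdelta * (ons.Cz r * oK N1 * (ons.Cz (- r) * oKinv N1) * oseq (r - 1)))"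
    by (simp only: mult.assoc[of oC_inv] mult.assoc[of "ons.Cz r * oK N1"]
        central_left_commute[OF oKdelta_central, of "ons.Cz r * oK N1"])
  also have "\<dots> = oseq (r - 1)"
    unfolding drinfeld_data.K_Ki[OF ons.shifted] by simp
  finally show ?thesis .
qed

lemma theta1_hom: "algebra_hom f \<Longrightarrow> f (theta1 x y) = theta1 (f x) (f y)"
  by (simp add: theta1_def algebra_homD)

text \<open>Invariance of \<open>\<Theta>\<^sub>1\<close> under the shift, since every pair of consecutive terms yields the same \<open>t\<close>.\<close>

lemma shift_hom_otheta1: "shift_hom r otheta1 = otheta1"
proof -
  interpret s: drinfeld_data "\<lambda>i. oseq (i + r)" "oKdelta * (oKinv N1 * theta1 oBm (oB N1))" oKdelta oC_inv
    "ons.Cz r * oK N1" "ons.Cz (- r) * oKinv N1"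
    by (rule ons.shifted)
  have "otheta1 = oKdelta * (ons.Cz (- r) * oKinv N1 * theta1 (oseq (r - 1)) (oseq r))"
    using s.t_theta1 by (simp add: otheta1_def)
  moreover have "shift_hom r otheta1 = oKdelta * (ons.Cz (- r) * oKinv N1 * theta1 (oseq (r - 1)) (oseq r))"
    by (simp add: otheta1_def algebra_homD[OF shift_hom(1)] shift_hom shift_hom_oKdelta
        theta1_hom[OF shift_hom(1)] shift_hom_oBm)
  ultimately show ?thesis by simp
qed

lemma shift_hom_oseq: "shift_hom r (oseq i) = oseq (i + r)"
proof -
  note h = algebra_homD[OF shift_hom(1)[of r]]
  have Ci: "shift_hom r oC_inv = oC_inv"
    using shift_hom_Cz[of r "-1"] ons.Cz_pred[of 0] by simp
  have "shift_hom r (oseq (i - 1)) = oseq (i - 1 + r) \<and> shift_hom r (oseq i) = oseq (i + r)"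
  proof (induction i rule: int_induct[of _ 0])
    case base
    then show ?case by (simp add: oseq_values shift_hom_oBm shift_hom add.commute)
  next
    case (step1 i)
    have "shift_hom r (oseq (i + 1)) = oseq (i + r + 1)"
      unfolding ons.B_next[of i] ons.B_next[of "i + r"]
      using step1 by (simp add: h shift_hom_oKdelta shift_hom_otheta1 diff_add_eq flip: otheta1_def)
    then show ?case using step1 by (simp add: algebra_simps)
  next
    case (step2 i)
    have "shift_hom r (oseq (i - 1 - 1)) = oseq (i - 1 + r - 1)"
      unfolding ons.B_prev[of "i - 1"] ons.B_prev[of "i - 1 + r"]
      using step2 by (simp add: h Ci shift_hom_otheta1 flip: otheta1_def)
    then show ?case using step2 by (simp add: algebra_simps)
  qed
  then show ?thesis ..
qed

lemma id_hom: "algebra_hom id"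
  by (simp add: algebra_hom_def)

lemma shift_hom_inverse: "shift_hom r \<circ> shift_hom (- r) = id"
proof (rule onsager_hom_ext_Bm)
  show "algebra_hom (shift_hom r \<circ> shift_hom (- r))" by (intro algebra_hom_comp shift_hom)
  show "(shift_hom r \<circ> shift_hom (- r)) (oK N1) = id (oK N1)"
    by (simp add: shift_hom algebra_homD[OF shift_hom(1)] shift_hom_Cz ons.Cz_minus flip: mult.assoc)
qed (simp_all add: id_hom shift_hom shift_hom_oBm shift_hom_oseq shift_hom_oKdelta oseq_values)

lemma shift_hom_iso: "algebra_iso (shift_hom r)"
  by (rule algebra_isoI[OF shift_hom(1) shift_hom_inverse]) (use shift_hom_inverse[of "- r"] in simp)

lemma inv_shift_hom: "inv (shift_hom r) = shift_hom (- r)"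
  using shift_hom_inverse[of r] shift_hom_inverse[of "- r"] by (intro inv_unique_comp) simp_all

lemma other_other [simp]: "other (other i) = i"
  by (cases i) simp_all

section \<open>The automorphisms defining the root vectors\<close>

lemma dagger_exists: "\<exists>f. algebra_hom f \<and> (\<forall>i. f (oB i) = oB (other i) \<and> f (oK i) = oK (other i) \<and> f (oKinv i) = oKinv (other i))"
  by (rule onsager_hom_exists) (use onsager_serre[of "other _"] in \<open>simp_all add: central_oK oK_oKinv\<close>)

lemma dagger: "algebra_iso dagger" "dagger \<circ> dagger = id" "dagger (oB i) = oB (other i)" "dagger (oK i) = oK (other i)"
proof -
  let ?P = "\<lambda>f. algebra_iso f \<and> f \<circ> f = id \<and>
     f (oB N0) = oB N1 \<and> f (oB N1) = oB N0 \<and> f (oK N0) = oK N1 \<and> f (oK N1) = oK N0"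
  obtain f where f: "algebra_hom f" "\<And>i. f (oB i) = oB (other i)" "\<And>i. f (oK i) = oK (other i)"
    using dagger_exists by auto
  have ff: "f \<circ> f = id"
    by (rule onsager_hom_ext) (simp_all add: algebra_hom_comp f id_hom)
  have "?P f" using algebra_isoI[OF f(1) ff ff] ff f by simp
  moreover have "g = f" if "?P g" for g
  proof (rule onsager_hom_ext)
    show "g (oB i) = f (oB i)" "g (oK i) = f (oK i)" for i
      using that f by (cases i; simp)+
  qed (use that f in \<open>simp_all add: algebra_iso_def\<close>)
  ultimately have "?P dagger"
    unfolding dagger_def by (rule theI)
  then show "algebra_iso dagger" "dagger \<circ> dagger = id" "dagger (oB i) = oB (other i)" "dagger (oK i) = oK (other i)"
    by (simp_all, (cases i; simp)+)
qed

lemma dagger_hom: "algebra_hom dagger"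
  using dagger(1) by (simp add: algebra_iso_def)

lemma dagger_oKinv: "dagger (oKinv i) = oKinv (other i)"
proof (rule inverse_unique)
  show "oK (other i) * dagger (oKinv i) = 1" "dagger (oKinv i) * oK (other i) = 1"
    by (simp_all add: oK_oKinv algebra_homD[OF dagger_hom] flip: dagger(4) algebra_homD(3)[OF dagger_hom])
qed (rule oK_oKinv)

lemma dagger_oKdelta: "dagger oKdelta = oKdelta"
  by (simp add: oKdelta_def algebra_homD[OF dagger_hom] dagger centralD[OF central_oK, of "oK N1" N0])

text \<open>The first three values are immediate. The last one is \<open>dagger\<close> applied to a multiple of the term of index \<open>-2\<close>, which is
\<open>B\<^sub>1\<close> minus a multiple of the bracket of \<open>\<Theta>\<^sub>1\<close> with the term of index \<open>-1\<close>, up to a power of \<open>C\<close>.\<close>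

lemma dagger_shift_values:
  defines "f \<equiv> dagger \<circ> shift_hom (-1)"
  shows "f (oK N1) = oKinv N1" "f (oK N0) = oKdelta * oK N1" "f (oB N1) = oKinv N1 * oB N1"
    "f (oB N0) = (1 / qint 2) *\<^sub>q (oB N0 * (oB N1)\<^sup>2 - (v * qint 2) *\<^sub>q (oB N1 * oB N0 * oB N1)
                        + v\<^sup>2 *\<^sub>q ((oB N1)\<^sup>2 * oB N0)) + oB N0 * oK N1"
proof -
  note h = algebra_homD[OF dagger_hom]
  have Cz: "ons.Cz (-1) = oC_inv" "ons.Cz 1 = oKdelta"
    using ons.Cz_pred[of 0] ons.Cz_Suc[of 0] by simp_all
  show "f (oK N1) = oKinv N1"
  proof -
    have "shift_hom (-1) (oK N1) = oKinv N0"
      unfolding shift_hom Cz by (simp add: oC_inv_def mult.assoc oK_oKinv)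
    then show ?thesis by (simp add: f_def dagger_oKinv)
  qed
  show "f (oK N0) = oKdelta * oK N1"
    by (simp add: f_def shift_hom Cz h dagger_oKdelta dagger flip: oK_N0)
  show "f (oB N1) = oKinv N1 * oB N1"
    by (simp add: f_def shift_hom oseq_values oBm_def h dagger dagger_oKinv)
  have t: "otheta1 = theta1 (oB N0) (oB N1)"
  proof -
    have "otheta1 = oK N0 * theta1 oBm (oB N1)"
      by (simp add: otheta1_def oK_N0 mult.assoc)
    also have "\<dots> = theta1 (oB N0) (oB N1)"
      by (simp add: theta1_def oB_N0 right_diff_distrib qscale_mult_right mult.assoc
          central_left_commute[OF central_oK, of "oB N1"])
    finally show ?thesis .
  qed
  have "shift_hom (-1) (oB N0) = oK N0 * (oKdelta * oseq (-2))"
    by (simp add: shift_hom Cz oK_N0 mult.assoc central_left_commute[OF oKinv_central, of oKdelta])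
  also have "oKdelta * oseq (-2) = oB N1 - (1 / qint 2) *\<^sub>q (otheta1 * oBm - oBm * otheta1)"
    using ons.B_prev[of "-1"] by (simp add: oseq_values flip: otheta1_def)
  also have "oK N0 * \<dots> = oK N0 * oB N1 - (1 / qint 2) *\<^sub>q (otheta1 * oB N0 - oB N0 * otheta1)"
    by (simp add: oB_N0 right_diff_distrib qscale_mult_right mult.assoc
        central_left_commute[OF central_oK, of otheta1])
  finally have "f (oB N0) = oK N1 * oB N0 - (1 / qint 2) *\<^sub>q
      (theta1 (oB N1) (oB N0) * oB N1 - oB N1 * theta1 (oB N1) (oB N0))"
    by (simp add: f_def h dagger t theta1_hom[OF dagger_hom])
  moreover have "theta1 (oB N1) (oB N0) * oB N1 - oB N1 * theta1 (oB N1) (oB N0)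
     = - (oB N0 * (oB N1)\<^sup>2 - (v * qint 2) *\<^sub>q (oB N1 * oB N0 * oB N1) + v\<^sup>2 *\<^sub>q ((oB N1)\<^sup>2 * oB N0))"
    by (simp add: theta1_def qint_2 power2_eq_square algebra_simps qscale_linear)
  ultimately show "f (oB N0) = (1 / qint 2) *\<^sub>q (oB N0 * (oB N1)\<^sup>2 - (v * qint 2) *\<^sub>q (oB N1 * oB N0 * oB N1)
                        + v\<^sup>2 *\<^sub>q ((oB N1)\<^sup>2 * oB N0)) + oB N0 * oK N1"
    by (simp only: qs.scale_minus_right centralD[OF central_oK, of "oB N0"]) simp
qed

lemma T1_eq: "T1 = dagger \<circ> shift_hom (-1)"
proof -
  have iso: "algebra_iso (dagger \<circ> shift_hom (-1))"
    using dagger(1) shift_hom_iso[of "-1"] by (simp add: algebra_iso_def algebra_hom_comp bij_comp)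
  show ?thesis
    unfolding T1_def
  proof (rule the_equality)
    fix g assume g: "algebra_iso g \<and> g (oK N1) = oKinv N1 \<and> g (oK N0) = oKdelta * oK N1 \<and>
     g (oB N1) = oKinv N1 * oB N1 \<and>
     g (oB N0) = (1 / qint 2) *\<^sub>q (oB N0 * (oB N1)\<^sup>2 - (v * qint 2) *\<^sub>q (oB N1 * oB N0 * oB N1)
                        + v\<^sup>2 *\<^sub>q ((oB N1)\<^sup>2 * oB N0)) + oB N0 * oK N1"
    show "g = dagger \<circ> shift_hom (-1)"
    proof (rule onsager_hom_ext)
      show "algebra_hom g" "algebra_hom (dagger \<circ> shift_hom (-1))"
        using g iso by (simp_all add: algebra_iso_def)
      show "g (oB i) = (dagger \<circ> shift_hom (-1)) (oB i)" "g (oK i) = (dagger \<circ> shift_hom (-1)) (oK i)" for i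
        using g dagger_shift_values by (cases i; simp)+
    qed
  qed (use iso dagger_shift_values in simp)
qed

lemma shift_hom_funpow: "(shift_hom r ^^ n) (oseq i) = oseq (i + int n * r)"
  by (induction n) (simp_all add: shift_hom_oseq algebra_simps)

lemma oB1_eq: "oB1 n = oseq n"
proof -
  have "dagger \<circ> T1 = shift_hom (-1)"
    unfolding T1_eq by (simp add: dagger(2) flip: comp_assoc)
  then show ?thesis
    using shift_hom_funpow[of _ _ 0] inv_shift_hom[of "-1"]
    by (simp add: oB1_def int_iterate_def flip: oseq_values(1))
qed

lemma oTheta_eq: "1 \<le> m \<Longrightarrow> oTheta m = ons.Theta (int m)"
proof -
  assume m: "1 \<le> m"
  have acute: "oTheta_acute m = ons.acute m" for m
  proof -
    have "ons.acute m = oK N0 * ((v * v) *\<^sub>q (oBm * oseq (int m - 1)) - oseq (int m - 1) * oBm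
      + (v * v - 1) *\<^sub>q (\<Sum>p\<in>{0..int m - 2}. oseq p * oseq (int m - 2 - p)))"
      by (simp add: ons.acute_def ons.quad_sum_def oK_N0 oseq_values algebra_simps)
    also have "\<dots> = oTheta_acute m"
      by (simp add: oTheta_acute_def oB1_eq oB_N0 distrib_left right_diff_distrib qscale_mult_right mult.assoc
          central_left_commute[OF central_oK, of "oseq _"] power2_eq_square sum_distrib_left
          centralD[OF central_oK, of "oseq _"] diff_diff_eq diff_diff_eq2 algebra_simps)
    finally show ?thesis ..
  qed
  have "oTheta m = ons.theta_sum m"
    by (simp add: oTheta_def ons.theta_sum_def acute)
  then have "ons.theta m = (v - vi) *\<^sub>q oTheta m"
    using ons.theta_sum_eq[OF m] by simp
  then show ?thesis
    using v_minus_vi_nonzero by (simp add: ons.Theta_def ons.th_simps qscale_qscale del: qs.scale_left_diff_distrib)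
qed

lemma hom_fps_pow:
  fixes X :: "'b::{ring_1, qv_algebra} fps"
  assumes "algebra_hom f"
  shows "f (fps_nth (X ^ k) m) = fps_nth (fps_pow (Abs_fps (\<lambda>i. f (fps_nth X i))) k) m"
proof (induction k arbitrary: m)
  case 0
  then show ?case by (simp add: algebra_homD[OF assms])
next
  case (Suc k)
  then show ?case by (simp add: fps_mult_nth algebra_homD[OF assms] algebra_hom_sum[OF assms])
qed

lemma hom_series_exp:
  "algebra_hom f \<Longrightarrow> f (fps_nth (series_exp X) m) = exp_coeff (Abs_fps (\<lambda>i. f (fps_nth X i))) m"
  by (simp add: series_exp_def exp_coeff_def algebra_homD algebra_hom_sum hom_fps_pow)

lemma hom_fTheta:
  assumes "algebra_hom f" "0 \<le> k"
  shows "f (fTheta k) = (1 / (v - vi)) *\<^sub>q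
    exp_coeff (Abs_fps (\<lambda>j. if j = 0 then 0 else (v - vi) *\<^sub>q f (fH j))) (nat k)"
proof -
  have "f (fTheta k) = (1 / (v - vi)) *\<^sub>q
    exp_coeff (Abs_fps (\<lambda>j. f (if j = 0 then 0 else (v - vi) *\<^sub>q fH j))) (nat k)"
    using assms(2) unfolding fTheta_def v_powi_m1 by (simp add: algebra_homD[OF assms(1)] hom_series_exp[OF assms(1)])
  also have "(\<lambda>j. f (if j = 0 then 0 else (v - vi) *\<^sub>q fH j)) = (\<lambda>j. if j = 0 then 0 else (v - vi) *\<^sub>q f (fH j))"
    by (rule ext) (simp add: algebra_homD[OF assms(1)])
  finally show ?thesis .
qed

lemma hom_fTheta_neg: "algebra_hom f \<Longrightarrow> k < 0 \<Longrightarrow> f (fTheta k) = 0"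
  by (simp add: fTheta_def algebra_homD)

lemma hom_fCpow: "algebra_hom f \<Longrightarrow> f (fCpow n) = zpow (f (gen DC)) (f (gen DCinv)) n"
  by (simp add: fCpow_def zpow_def algebra_homD)

lemma drinfeld_relation_lhs: "vcomm (-2) (B r) (B (s + 1)) - (v powi (-2)) *\<^sub>q vcomm 2 (B (r + 1)) (B s) = BB B r s"
proof -
  have "v powi (-2) = pv" by (simp add: power_int_minus power2_eq_square)
  moreover have "v powi 2 = v * v" by (simp add: power2_eq_square)
  ultimately show ?thesis by (simp add: vcomm_def BB_def qscale_linear mult.assoc)
qed

section \<open>From the Drinfeld presentation to the Onsager algebra\<close>

text \<open>The \<open>H\<^sub>m\<close> are recovered from \<open>\<Theta>(z) = exp ((v - v\<^sup>-\<^sup>1) H(z))\<close> by a logarithmic derivative.\<close>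

definition oH :: "nat \<Rightarrow> onsager" where
  "oH m = (1 / ((v - vi) * of_nat m)) *\<^sub>q log_derivative ons.th m"

definition drinfeld_image :: "drinfeld_gen \<Rightarrow> onsager" where
  "drinfeld_image x = (case x of DK1 \<Rightarrow> oK N1 | DK1inv \<Rightarrow> oKinv N1 | DC \<Rightarrow> oKdelta | DCinv \<Rightarrow> oC_inv
     | DH k \<Rightarrow> oH (Suc k) | DB r \<Rightarrow> oseq r)"

lemma drinfeld_image_values: "drinfeld_image DK1 = oK N1" "drinfeld_image DK1inv = oKinv N1"
  "drinfeld_image DC = oKdelta" "drinfeld_image DCinv = oC_inv" "drinfeld_image (DH k) = oH (Suc k)"
  "drinfeld_image (DB r) = oseq r"
  by (simp_all add: drinfeld_image_def)

abbreviation "evD \<equiv> free_eval drinfeld_image"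

lemmas evD = algebra_homD[OF free_eval_hom[of drinfeld_image]] free_eval_gen[of drinfeld_image]
  drinfeld_image_values

lemma evD_fH: "1 \<le> m \<Longrightarrow> evD (fH m) = oH m"
  by (simp add: fH_def evD)

lemma evD_fTheta: "evD (fTheta k) = ons.Theta k"
proof (cases "k < 0")
  case True
  then show ?thesis by (simp add: hom_fTheta_neg[OF free_eval_hom] ons.Theta_def ons.th_simps)
next
  case False
  have "(\<lambda>j. if j = 0 then 0 else (v - vi) *\<^sub>q evD (fH j))
      = (\<lambda>j. if j = 0 then 0 else (1 / of_nat j) *\<^sub>q log_derivative ons.th j)"
    using v_minus_vi_nonzero
    by (intro ext) (simp add: evD_fH oH_def qscale_qscale del: qs.scale_left_diff_distrib)
  then show ?thesis
    using False exp_log_derivative[of ons.th "nat k"]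
    by (simp add: hom_fTheta[OF free_eval_hom] ons.th_simps ons.hh_commute ons.Theta_def)
qed

lemma evD_fCpow: "evD (fCpow n) = ons.Cz n"
  by (simp add: hom_fCpow[OF free_eval_hom] evD ons.Cz_def)

lemma oH_oseq: "1 \<le> m \<Longrightarrow> oH m * oseq r - oseq r * oH m
    = (qint (2 * int m) / of_nat m) *\<^sub>q (oseq (r + int m) - oKdelta ^ m * oseq (r - int m))"
proof -
  assume m: "1 \<le> m"
  have "oH m * oseq r - oseq r * oH m
     = (1 / ((v - vi) * of_nat m)) *\<^sub>q (log_derivative ons.th m * oseq r - oseq r * log_derivative ons.th m)"
    by (simp add: oH_def qscale_linear)
  also have "\<dots> = (1 / ((v - vi) * of_nat m) * cv m) *\<^sub>q (oseq (r + int m) - oKdelta ^ m * oseq (r - int m))"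
    unfolding ons.hh_B[OF m] qscale_qscale by simp
  also have "1 / ((v - vi) * of_nat m) * cv m = qint (2 * int m) / of_nat m"
    by (simp add: qint_even)
  finally show ?thesis .
qed

lemma oH_commute: "oH m * oH n = oH n * oH m"
  by (simp add: oH_def qscale_linear ons.hh_commute mult.commute)

lemma evD_relators: 
  assumes "(l, r) \<in> relators"
  shows "evD l = evD r"
proof -
  have K: "oK N1 * evD x = evD x * oK N1" and C: "oKdelta * evD x = evD x * oKdelta" for x
    using centralD[OF central_oK] centralD[OF oKdelta_central] by simp_all
  consider (K1) "l = gen DK1 * gen DK1inv" "r = 1" | (C1) "l = gen DC * gen DCinv" "r = 1"
    | (K) x where "l = gen DK1 * gen x" "r = gen x * gen DK1"
    | (C) x where "l = gen DC * gen x" "r = gen x * gen DC"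
    | (HH) m n where "1 \<le> m" "1 \<le> n" "l = fH m * fH n - fH n * fH m" "r = 0"
    | (HB) m i where "1 \<le> m" "l = fH m * gen (DB i) - gen (DB i) * fH m"
       "r = (qint (2 * int m) / of_nat m) *\<^sub>q gen (DB (i + int m))
       - (qint (2 * int m) / of_nat m) *\<^sub>q (gen (DB (i - int m)) * gen DC ^ m)"
    | (BB) i j where "l = vcomm (-2) (gen (DB i)) (gen (DB (j + 1)))
       - (v powi (-2)) *\<^sub>q vcomm 2 (gen (DB (i + 1))) (gen (DB j))"
       "r = (v powi (-2)) *\<^sub>q (fTheta (j - i + 1) * fCpow i * gen DK1)
       - (v powi (-4)) *\<^sub>q (fTheta (j - i - 1) * fCpow (i + 1) * gen DK1)
       + (v powi (-2)) *\<^sub>q (fTheta (i - j + 1) * fCpow j * gen DK1)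
       - (v powi (-4)) *\<^sub>q (fTheta (i - j - 1) * fCpow (j + 1) * gen DK1)"
    using assms unfolding relators_drinfeld_gen_def by blast
  then show ?thesis
  proof cases
    case (HH m n)
    then show ?thesis by (simp add: evD evD_fH oH_commute)
  next
    case (HB m i)
    have "evD l = oH m * oseq i - oseq i * oH m" using HB by (simp add: evD evD_fH)
    moreover have "evD r = (qint (2 * int m) / of_nat m) *\<^sub>q (oseq (i + int m) - oKdelta ^ m * oseq (i - int m))"
      using HB centralD[OF central_power[OF oKdelta_central], of "oseq (i - int m)" m]
      by (simp add: evD qs.scale_right_diff_distrib)
    ultimately show ?thesis using oH_oseq[OF HB(1)] by simp
  next
    case (BB i j)
    have "evD l = BB oseq i j"
      using BB unfolding drinfeld_relation_lhs[of oseq, symmetric] by (simp only: vcomm_def evD)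
    also have "\<dots> = evD r"
      unfolding ons.BB_theta BB(2) by (simp only: evD evD_fTheta evD_fCpow)
    finally show ?thesis .
  qed (simp_all add: evD oK_oKinv ons.C_Ci centralD[OF central_oK] centralD[OF oKdelta_central])
qed

lemma to_onsager_exists: "\<exists>f. algebra_hom f \<and> (\<forall>y. f (of_free y) = evD y)"
  by (rule presented_hom_exists) (rule evD_relators)

section \<open>From the Onsager algebra to the Drinfeld presentation\<close>

definition dCinv :: drinfeld where "dCinv = of_free (gen DCinv)"
definition dH :: "nat \<Rightarrow> drinfeld" where "dH m = of_free (fH m)"

lemmas of_free = algebra_homD[OF of_free_hom]

lemma drinfeld_central:
  assumes "\<And>x. of_free (gen z) * of_free (gen x) = of_free (gen x) * (of_free (gen z) :: drinfeld)"
  shows "central (of_free (gen z) :: drinfeld)"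
  unfolding central_def
proof
  fix x show "of_free (gen z) * x = x * (of_free (gen z) :: drinfeld)"
  proof (induction x rule: presented_induct)
    case (mult x y)
    then show ?case by (rule commute_mult)
  qed (simp_all add: assms qscale_linear algebra_simps)
qed

lemma dK1_central: "central dK1"
  unfolding dK1_def
proof (rule drinfeld_central)
  fix x
  have "(gen DK1 * gen x, gen x * gen DK1) \<in> relators"
    by (auto simp: relators_drinfeld_gen_def)
  from relator_eq[OF this] show "of_free (gen DK1) * of_free (gen x) = of_free (gen x) * of_free (gen DK1)"
    by (simp add: of_free)
qed

lemma dC_central: "central dC"
  unfolding dC_def
proof (rule drinfeld_central)
  fix x
  have "(gen DC * gen x, gen x * gen DC) \<in> relators"
    by (auto simp: relators_drinfeld_gen_def)
  from relator_eq[OF this] show "of_free (gen DC) * of_free (gen x) = of_free (gen x) * of_free (gen DC)"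
    by (simp add: of_free)
qed

lemma dK1_inverse: "dK1 * dK1inv = 1" and dC_inverse: "dC * dCinv = 1"
proof -
  have "(gen DK1 * gen DK1inv, 1) \<in> relators" "(gen DC * gen DCinv, 1) \<in> relators"
    by (auto simp: relators_drinfeld_gen_def)
  from this[THEN relator_eq] show "dK1 * dK1inv = 1" "dC * dCinv = 1"
    by (simp_all add: dK1_def dK1inv_def dC_def dCinv_def of_free)
qed

lemma dH_commute: "1 \<le> m \<Longrightarrow> 1 \<le> n \<Longrightarrow> dH m * dH n = dH n * dH m"
proof -
  assume "1 \<le> m" "1 \<le> n"
  then have "(fH m * fH n - fH n * fH m, 0) \<in> relators"
    unfolding relators_drinfeld_gen_def by blast
  from relator_eq[OF this] show ?thesis by (simp add: dH_def of_free)
qed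

lemma dH_dB1: "1 \<le> m \<Longrightarrow> dH m * dB1 r - dB1 r * dH m
   = (qint (2 * int m) / of_nat m) *\<^sub>q (dB1 (r + int m) - dC ^ m * dB1 (r - int m))"
proof -
  assume m: "1 \<le> m"
  then have "(fH m * gen (DB r) - gen (DB r) * fH m,
       (qint (2 * int m) / of_nat m) *\<^sub>q gen (DB (r + int m))
       - (qint (2 * int m) / of_nat m) *\<^sub>q (gen (DB (r - int m)) * gen DC ^ m)) \<in> relators"
    unfolding relators_drinfeld_gen_def by blast
  from relator_eq[OF this] have "dH m * dB1 r - dB1 r * dH m = (qint (2 * int m) / of_nat m) *\<^sub>q dB1 (r + int m)
    - (qint (2 * int m) / of_nat m) *\<^sub>q (dB1 (r - int m) * dC ^ m)"
    by (simp only: of_free dH_def dB1_def dC_def)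
  then show ?thesis
    using centralD[OF central_power[OF dC_central], of "dB1 (r - int m)" m]
    by (simp add: qs.scale_right_diff_distrib)
qed

lemma dB1_dTheta: "BB dB1 r s = (v powi (-2)) *\<^sub>q (dTheta (s - r + 1) * zpow dC dCinv r * dK1)
     - (v powi (-4)) *\<^sub>q (dTheta (s - r - 1) * zpow dC dCinv (r + 1) * dK1)
     + (v powi (-2)) *\<^sub>q (dTheta (r - s + 1) * zpow dC dCinv s * dK1)
     - (v powi (-4)) *\<^sub>q (dTheta (r - s - 1) * zpow dC dCinv (s + 1) * dK1)"
proof -
  have "(vcomm (-2) (gen (DB r)) (gen (DB (s + 1)))
       - (v powi (-2)) *\<^sub>q vcomm 2 (gen (DB (r + 1))) (gen (DB s)),
       (v powi (-2)) *\<^sub>q (fTheta (s - r + 1) * fCpow r * gen DK1)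
       - (v powi (-4)) *\<^sub>q (fTheta (s - r - 1) * fCpow (r + 1) * gen DK1)
       + (v powi (-2)) *\<^sub>q (fTheta (r - s + 1) * fCpow s * gen DK1)
       - (v powi (-4)) *\<^sub>q (fTheta (r - s - 1) * fCpow (s + 1) * gen DK1)) \<in> relators"
    unfolding relators_drinfeld_gen_def by blast
  from relator_eq[OF this] show ?thesis
    unfolding drinfeld_relation_lhs[of dB1, symmetric]
    by (simp only: of_free vcomm_def dTheta_def dK1_def dB1_def hom_fCpow[OF of_free_hom] dC_def dCinv_def)
qed

lemma dTheta_neg: "k < 0 \<Longrightarrow> dTheta k = 0"
  by (simp add: dTheta_def hom_fTheta_neg[OF of_free_hom])

definition dX :: "drinfeld fps" where
  "dX = Abs_fps (\<lambda>j. if j = 0 then 0 else (v - vi) *\<^sub>q dH j)"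

lemma dTheta_exp: "dTheta (int m) = (1 / (v - vi)) *\<^sub>q exp_coeff dX m"
  unfolding dTheta_def dX_def dH_def hom_fTheta[OF of_free_hom of_nat_0_le_iff] nat_int ..

lemma exp_coeff_dX: "of_nat m *\<^sub>q exp_coeff dX m
    = (\<Sum>j=1..m. (of_nat j *\<^sub>q (v - vi) *\<^sub>q dH j) * exp_coeff dX (m - j))"
proof -
  have "of_nat m *\<^sub>q exp_coeff dX m = (\<Sum>j=1..m. (of_nat j *\<^sub>q fps_nth dX j) * exp_coeff dX (m - j))"
  proof (rule exp_coeff_recursion)
    show "fps_nth dX i * fps_nth dX j = fps_nth dX j * fps_nth dX i" for i j
      using dH_commute[of i j]
      by (simp add: dX_def qscale_mult_left qscale_mult_right del: qs.scale_left_diff_distrib)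
  qed (simp add: dX_def)
  also have "\<dots> = (\<Sum>j=1..m. (of_nat j *\<^sub>q (v - vi) *\<^sub>q dH j) * exp_coeff dX (m - j))"
    by (rule sum.cong) (simp_all add: dX_def)
  finally show ?thesis .
qed

lemma dTheta_1: "dTheta 1 = dH 1"
  using dTheta_exp[of 1] exp_coeff_dX[of 1] v_minus_vi_nonzero
  by (simp add: exp_coeff_0 qscale_qscale del: qs.scale_left_diff_distrib)

global_interpretation dri: drinfeld_data dB1 "dH 1" dC dCinv dK1 dK1inv
proof
  show "central dC" "dC * dCinv = 1" "central dK1" "dK1 * dK1inv = 1"
    by (rule dC_central dC_inverse dK1_central dK1_inverse)+
  show shift: "dH 1 * dB1 r - dB1 r * dH 1 = qint 2 *\<^sub>q (dB1 (r + 1) - dC * dB1 (r - 1))" for r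
    using dH_dB1[of 1 r] by simp
  then interpret shift_data dB1 "dH 1" dC dCinv
    by unfold_locales (rule dC_central dC_inverse)+
  have diag: "BB dB1 r r = (2 * pv) *\<^sub>q (dH 1 * zpow dC dCinv r * dK1)" for r
  proof -
    have "v powi (-2) = pv" by (simp add: power_int_minus power2_eq_square)
    moreover have "BB dB1 r r = 2 *\<^sub>q (v powi (-2)) *\<^sub>q (dH 1 * zpow dC dCinv r * dK1)"
      unfolding dB1_dTheta qscale_2 by (simp add: dTheta_neg dTheta_1)
    ultimately show ?thesis by (simp only: qscale_qscale)
  qed
  show "BB dB1 0 0 = (2 * pv) *\<^sub>q (dK1 * dH 1)"
    using diag[of 0] centralD[OF dK1_central, of "dH 1"] by simp
  have "U (r + 1) (r + 1) = 0" for r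
    unfolding U_def diag zpow_plus_1[OF dC_central dC_inverse]
    by (simp add: diag qscale_linear mult.assoc central_left_commute[OF dC_central, of "dH (Suc 0)"])
  from this[of "-1"] this[of "-2"] show "U 0 0 = 0" "U (-1) (-1) = 0" by simp_all
qed

text \<open>The \<open>B r\<close> come from brackets with \<open>H\<^sub>1 = \<Theta>\<^sub>1\<close>, which is quadratic in the two given ones; the quadratic relation at
\<open>(0, m - 1)\<close> then yields \<open>\<Theta>\<^sub>m\<close> from earlier \<open>\<Theta>\<close>'s, and the differential equation of the exponential yields \<open>H\<^sub>m\<close>.\<close>

lemma drinfeld_generators:
  assumes hom: "algebra_hom (f :: onsager \<Rightarrow> drinfeld)"
    and gens: "dB1 0 \<in> range f" "dB1 (-1) \<in> range f" "dK1 \<in> range f" "dK1inv \<in> range f"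
      "dC \<in> range f" "dCinv \<in> range f"
  shows "x \<in> range f"
proof -
  note h = algebra_homD[OF hom, symmetric]
  have add: "x + y \<in> range f" and diff: "x - y \<in> range f" and mult: "x * y \<in> range f"
    if "x \<in> range f" "y \<in> range f" for x y
    using that by (auto simp: h)
  have scale: "c *\<^sub>q x \<in> range f" if "x \<in> range f" for c x using that by (auto simp: h)
  have one: "1 \<in> range f" and zero: "0 \<in> range f" by (metis h(1) rangeI, metis h(5) rangeI)
  have pow: "x ^ n \<in> range f" if "x \<in> range f" for x n using that by (auto simp: h)
  have Cz: "zpow dC dCinv n \<in> range f" for n using gens pow by (simp add: zpow_def)
  have t: "dH 1 \<in> range f"
    unfolding dri.t_theta1 theta1_def by (intro mult diff scale gens)
  have B: "dB1 r \<in> range f" for r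
    by (rule dri.generated_by_two) (intro gens add mult diff scale t | assumption)+
  have BB: "BB dB1 r s \<in> range f" for r s
    unfolding BB_def by (intro add diff mult scale B)
  have Theta: "dTheta (int m) \<in> range f" for m
  proof (induction m rule: less_induct)
    case (less m)
    show ?case
    proof (cases "m = 0")
      case True
      then show ?thesis using dTheta_exp[of 0] scale one by (simp add: exp_coeff_0)
    next
      case False
      define s where "s = int m - 1"
      have small: "dTheta k \<in> range f" if "k < int m" for k
        using that less.IH[of "nat k"] zero dTheta_neg[of k] by (cases "k < 0") auto
      define R where "R = (v powi (-4)) *\<^sub>q (dTheta (s - 0 - 1) * zpow dC dCinv (0 + 1) * dK1)
         + (v powi (-4)) *\<^sub>q (dTheta (0 - s - 1) * zpow dC dCinv (s + 1) * dK1)"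
      have R: "R \<in> range f"
        unfolding R_def by (intro add mult scale small Cz gens) (use False in \<open>simp_all add: s_def\<close>)
      have e: "BB dB1 0 s + R = (v powi (-2)) *\<^sub>q (dTheta (int m) * dK1)
           + (v powi (-2)) *\<^sub>q (dTheta (1 - s) * zpow dC dCinv s * dK1)"
        unfolding R_def dB1_dTheta[of 0 s] by (simp add: s_def)
      have main: "(v powi (-2)) *\<^sub>q (dTheta (int m) * dK1) \<in> range f"
      proof (cases "m = 1")
        case True
        then have "dTheta (int m) = dH 1" by (simp add: dTheta_1)
        then show ?thesis using t by (intro mult scale gens) simp
      next
        case False
        then have "dTheta (1 - s) \<in> range f"
          using \<open>m \<noteq> 0\<close> by (intro small) (simp add: s_def)
        then have "(v powi (-2)) *\<^sub>q (dTheta (1 - s) * zpow dC dCinv s * dK1) \<in> range f"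
          by (intro mult scale Cz gens)
        then have "(BB dB1 0 s + R) - (v powi (-2)) *\<^sub>q (dTheta (1 - s) * zpow dC dCinv s * dK1) \<in> range f"
          by (intro diff add BB R)
        then show ?thesis unfolding e by simp
      qed
      have "(v powi 2) *\<^sub>q ((v powi (-2)) *\<^sub>q (dTheta (int m) * dK1)) * dK1inv \<in> range f"
        by (intro mult scale gens main[unfolded qscale_mult_left])
      moreover have "v powi 2 * v powi (-2) = 1" using v_nonzero by (simp add: power_int_minus)
      ultimately show ?thesis
        by (simp add: qscale_qscale mult.assoc dK1_inverse qscale_mult_left)
    qed
  qed
  have E: "exp_coeff dX m \<in> range f" for m
  proof -
    have "(v - vi) *\<^sub>q dTheta (int m) = exp_coeff dX m"
      using v_minus_vi_nonzero by (simp add: dTheta_exp qscale_qscale del: qs.scale_left_diff_distrib)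
    then show ?thesis using scale[OF Theta, of "v - vi" m] by simp
  qed
  have sum: "(\<Sum>i\<in>A. g i) \<in> range f" if "\<And>i. i \<in> A \<Longrightarrow> g i \<in> range f" for g :: "nat \<Rightarrow> drinfeld" and A
    using that by (induction A rule: infinite_finite_induct) (auto intro: zero add)
  have H: "1 \<le> m \<Longrightarrow> dH m \<in> range f" for m
  proof (induction m rule: less_induct)
    case (less m)
    let ?g = "\<lambda>j. (of_nat j *\<^sub>q (v - vi) *\<^sub>q dH j) * exp_coeff dX (m - j)"
    have "{1..m} = insert m {1..<m}" using less.prems by auto
    then have "of_nat m *\<^sub>q exp_coeff dX m = (\<Sum>j\<in>{1..<m}. ?g j) + of_nat m *\<^sub>q (v - vi) *\<^sub>q dH m"
      unfolding exp_coeff_dX by (simp add: exp_coeff_0 add.commute del: qs.scale_left_diff_distrib)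
    then have "of_nat m *\<^sub>q (v - vi) *\<^sub>q dH m = of_nat m *\<^sub>q exp_coeff dX m - (\<Sum>j\<in>{1..<m}. ?g j)"
      by simp
    also have "\<dots> \<in> range f"
      by (intro diff scale E sum mult less.IH) auto
    finally have "(1 / (of_nat m * (v - vi))) *\<^sub>q (of_nat m *\<^sub>q (v - vi) *\<^sub>q dH m) \<in> range f"
      by (rule scale)
    then show ?case
      using less.prems v_minus_vi_nonzero by (simp add: qscale_qscale del: qs.scale_left_diff_distrib)
  qed
  show ?thesis
  proof (induction x rule: presented_induct)
    case (scalar c)
    then show ?case by (intro scale one)
  next
    case (gen g)
    show ?case
    proof (cases g)
      case (DH k)
      then show ?thesis using H[of "Suc k"] by (simp add: dH_def fH_def)
    qed (use gens B in \<open>simp_all add: dK1_def dK1inv_def dC_def dCinv_def dB1_def\<close>)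
  qed (auto intro: add mult)
qed

theorem theorem2p16:
  shows "\<exists>\<Phi> :: drinfeld \<Rightarrow> onsager.
    algebra_iso \<Phi> \<and>
    (\<forall>r::int. \<Phi> (dB1 r) = oB1 r) \<and>
    (\<forall>m::nat. 1 \<le> m \<longrightarrow> \<Phi> (dTheta (int m)) = oTheta m) \<and>
    \<Phi> dK1 = oK N1 \<and>
    \<Phi> dC = oKdelta \<and>
    inv \<Phi> (oK N1) = dK1 \<and>
    inv \<Phi> (oK N0) = dC * dK1inv \<and>
    inv \<Phi> (oB N1) = dB1 0 \<and>
    inv \<Phi> (oB N0) = dB1 (-1) * dC * dK1inv"
proof -
  obtain \<Phi> where \<Phi>: "algebra_hom \<Phi>" "\<And>y. \<Phi> (of_free y) = evD y"
    using to_onsager_exists by blast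
  obtain \<Psi> where \<Psi>: "algebra_hom \<Psi>" "\<Psi> (oB N1) = dB1 0" "\<Psi> (oB N0) = dC * (dK1inv * dB1 (-1))"
    "\<Psi> (oK N1) = dK1" "\<Psi> (oK N0) = dC * dK1inv" "\<Psi> (oKinv N1) = dK1inv" "\<Psi> (oKinv N0) = dCinv * dK1"
    using dri.onsager_hom by blast
  note \<Psi>' = algebra_homD[OF \<Psi>(1)] and \<Phi>' = algebra_homD[OF \<Phi>(1)]
  have \<Phi>_gens: "\<Phi> (dB1 r) = oseq r" "\<Phi> dK1 = oK N1" "\<Phi> dK1inv = oKinv N1" "\<Phi> dC = oKdelta" for r
    by (simp_all add: dB1_def dK1_def dK1inv_def dC_def \<Phi>(2) evD)
  have \<Psi>_C: "\<Psi> oKdelta = dC"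
    by (simp add: oKdelta_def \<Psi> \<Psi>' mult.assoc dri.Ki_K)
  have \<Psi>_Bm: "\<Psi> oBm = dB1 (-1)"
    by (simp add: oBm_def \<Psi> \<Psi>' mult.assoc central_left_commute[OF dC_central, of dK1])
  have \<Psi>_Cinv: "\<Psi> oC_inv = dCinv"
    by (simp add: oC_inv_def \<Psi> \<Psi>' mult.assoc dK1_inverse)
  have \<Phi>\<Psi>: "\<Phi> \<circ> \<Psi> = id"
    by (rule onsager_hom_ext_Bm)
      (simp_all add: algebra_hom_comp \<Phi> \<Psi> id_hom \<Psi>_C \<Psi>_Bm \<Phi>_gens oseq_values)
  have "x \<in> range \<Psi>" for x
    by (rule drinfeld_generators[OF \<Psi>(1)])
      (metis rangeI \<Psi> \<Psi>_C \<Psi>_Bm \<Psi>_Cinv)+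
  then have \<Psi>\<Phi>: "\<Psi> \<circ> \<Phi> = id"
    using \<Phi>\<Psi> by (metis comp_apply comp_assoc id_apply rangeE ext)
  have iso: "algebra_iso \<Phi>"
    by (rule algebra_isoI[OF \<Phi>(1) \<Phi>\<Psi> \<Psi>\<Phi>])
  have inv: "inv \<Phi> = \<Psi>"
    by (rule inv_unique_comp[OF \<Phi>\<Psi> \<Psi>\<Phi>])
  have "dC * (dK1inv * dB1 (-1)) = dB1 (-1) * dC * dK1inv"
    by (simp add: mult.assoc centralD[OF dri.central_Ki, of "dB1 (-1)"] central_left_commute[OF dC_central, of "dB1 (-1)"]
        centralD[OF dri.central_Ki, of "dC * _"])
  then show ?thesis
    using iso \<Phi>_gens \<Psi> by (intro exI[of _ \<Phi>])
      (simp add: inv oB1_eq oTheta_eq dTheta_def \<Phi>(2) evD_fTheta)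
qed

end
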